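(* Let $\lambda>\mu>0$ and suppose there is a thinning from $\lambda$ to $\mu$ on $[0,1]$. (i) If $\lambda'>\lambda$, then there exists a thinning from $\lambda'$ to $\mu$ on $[0,1]$. (ii) If $\mu'/\lambda'=\mu/\lambda$ and $\lambda'>\lambda$, then there exists a thinning from $\lambda'$ to $\mu'$ on $[0,1]$.
   Context: Point processes on $[0,1]$ are viewed as random simple point measures on $[0,1]$ (finite $\{0,1,2,\dots\}$-valued measures with mass at most one at each point), with the $\sigma$-algebra generated by the maps $\nu\mapsto\nu(A)$, $A$ Borel. For $\lambda>\mu>0$, a (deterministic, Poisson) thinning from $\lambda$ to $\mu$ on $[0,1]$ is a measurable function $f$ from the set of simple point measures on $[0,1]$ to itself such that, if $\Pi$ is a homogeneous Poisson point process of intensity $\lambda$ on $[0,1]$ (with respect to Lebesgue measure), then $f(\Pi)$ is a homogeneous Poisson point process of intensity $\mu$ on $[0,1]$, and every point of $f(\Pi)$ is a point of $\Pi$ almost surely. *)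

theory Defs
  imports "HOL-Probability.Probability"
begin

abbreviation unit_borel :: "real measure" where
  "unit_borel \<equiv> restrict_space borel {0..1}"

definition simple_point_measures :: "real measure set" where
  "simple_point_measures =
    {\<nu>. space \<nu> = {0..1} \<and> sets \<nu> = sets unit_borel \<and>
        (\<forall>A\<in>sets unit_borel. \<exists>n::nat. emeasure \<nu> A = of_nat n) \<and>
        (\<forall>x\<in>{0..1}. emeasure \<nu> {x} \<le> 1)}"

text \<open>The \<open>\<sigma>\<close>-algebra generated by the evaluation maps; compare \<^const>\<open>subprob_algebra\<close>.\<close>

definition spm_algebra :: "real measure measure" where
  "spm_algebra =
    (SUP A\<in>sets unit_borel. vimage_algebra simple_point_measures (\<lambda>\<nu>. emeasure \<nu> A) borel)"

definition points :: "real measure \<Rightarrow> real set" where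
  "points \<nu> = {x \<in> space \<nu>. emeasure \<nu> {x} \<noteq> 0}"

text \<open>The Poisson weights are written out because \<^const>\<open>poisson_pmf\<close> is only meaningful for
  positive rates, whereas the rate is \<open>0\<close> on null sets (here \<open>0 ^ 0 = 1\<close> gives the right value).\<close>

definition poisson_process :: "'a measure \<Rightarrow> real \<Rightarrow> ('a \<Rightarrow> real measure) \<Rightarrow> bool" where
  "poisson_process M r X \<longleftrightarrow>
    prob_space M \<and>
    X \<in> measurable M spm_algebra \<and>
    (\<forall>A\<in>sets unit_borel. \<forall>k::nat.
       measure M {\<omega> \<in> space M. emeasure (X \<omega>) A = of_nat k} =
         (r * measure lborel A) ^ k / fact k * exp (- (r * measure lborel A))) \<and>
    (\<forall>(I :: nat set) A. finite I \<longrightarrow> A ` I \<subseteq> sets unit_borel \<longrightarrow> disjoint_family_on A I \<longrightarrow>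
       prob_space.indep_vars M (\<lambda>_. borel) (\<lambda>i \<omega>. emeasure (X \<omega>) (A i)) I)"

text \<open>HOL cannot quantify over the type of the sample space, so it is fixed to that of the canonical
  space of point configurations. Lemma \<open>poisson_thinning_any_space\<close> below shows that nothing is
  lost.\<close>

definition poisson_thinning :: "real \<Rightarrow> real \<Rightarrow> (real measure \<Rightarrow> real measure) \<Rightarrow> bool" where
  "poisson_thinning l m f \<longleftrightarrow>
    f \<in> measurable spm_algebra spm_algebra \<and>
    (\<forall>(M :: real measure measure) X. poisson_process M l X \<longrightarrow>
       poisson_process M m (\<lambda>\<omega>. f (X \<omega>)) \<and>
       (AE \<omega> in M. points (f (X \<omega>)) \<subseteq> points (X \<omega>)))"

lemma space_spm_algebra: "space spm_algebra = simple_point_measures"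
  by (auto simp: spm_algebra_def space_Sup_eq_UN)

lemma measurable_emeasure_spm_algebra:
  assumes "A \<in> sets unit_borel"
  shows "(\<lambda>\<nu>. emeasure \<nu> A) \<in> borel_measurable spm_algebra"
  unfolding spm_algebra_def
  by (rule measurable_Sup1[OF imageI[OF assms]]) (auto intro!: measurable_vimage_algebra1)

lemma poisson_process_distr:
  assumes M: "prob_space M" and X: "X \<in> measurable M spm_algebra"
    and f: "f \<in> measurable spm_algebra spm_algebra"
  shows "poisson_process (distr M spm_algebra X) r f \<longleftrightarrow> poisson_process M r (\<lambda>\<omega>. f (X \<omega>))"
proof -
  interpret prob_space M by (rule M)
  interpret D: prob_space "distr M spm_algebra X" by (rule prob_space_distr[OF X])
  note ev = measurable_compose[OF f measurable_emeasure_spm_algebra]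
  have "measure (distr M spm_algebra X) {\<nu> \<in> space (distr M spm_algebra X). emeasure (f \<nu>) A = of_nat k}
      = measure M {\<omega> \<in> space M. emeasure (f (X \<omega>)) A = of_nat k}"
    if A: "A \<in> sets unit_borel" for A and k :: nat
  proof -
    have "{\<nu> \<in> space spm_algebra. emeasure (f \<nu>) A = of_nat k} \<in> sets spm_algebra"
      using ev[OF A] by measurable
    then show ?thesis
      using measurable_space[OF X] by (auto simp: measure_distr[OF X] intro!: arg_cong[where f = "measure M"])
  qed
  moreover have "D.indep_vars (\<lambda>_. borel) (\<lambda>i \<nu>. emeasure (f \<nu>) (A i)) I \<longleftrightarrow>
      indep_vars (\<lambda>_. borel) (\<lambda>i \<omega>. emeasure (f (X \<omega>)) (A i)) I"
    if "finite I" "A ` I \<subseteq> sets unit_borel" for I :: "nat set" and A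
  proof (cases "I = {}")
    case True
    then show ?thesis
      by (simp add: indep_vars_def D.indep_vars_def indep_sets_def D.indep_sets_def)
  next
    case False
    have m: "(\<lambda>\<nu>. emeasure (f \<nu>) (A i)) \<in> borel_measurable spm_algebra" if "i \<in> I" for i
      using ev \<open>A ` I \<subseteq> _\<close> that by auto
    have m': "(\<lambda>\<omega>. emeasure (f (X \<omega>)) (A i)) \<in> borel_measurable M" if "i \<in> I" for i
      using measurable_compose[OF X m[OF that]] .
    have "(\<lambda>\<nu>. \<lambda>i\<in>I. emeasure (f \<nu>) (A i)) \<in> measurable spm_algebra (Pi\<^sub>M I (\<lambda>_. borel))"
      using m by (rule measurable_restrict)
    then have 1: "distr (distr M spm_algebra X) (Pi\<^sub>M I (\<lambda>_. borel)) (\<lambda>\<nu>. \<lambda>i\<in>I. emeasure (f \<nu>) (A i))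
        = distr M (Pi\<^sub>M I (\<lambda>_. borel)) (\<lambda>\<omega>. \<lambda>i\<in>I. emeasure (f (X \<omega>)) (A i))"
      using X by (simp add: distr_distr comp_def)
    have 2: "Pi\<^sub>M I (\<lambda>i. distr (distr M spm_algebra X) borel (\<lambda>\<nu>. emeasure (f \<nu>) (A i)))
        = Pi\<^sub>M I (\<lambda>i. distr M borel (\<lambda>\<omega>. emeasure (f (X \<omega>)) (A i)))"
      using X m by (intro PiM_cong) (simp_all add: distr_distr comp_def)
    show ?thesis
      using False m m' 1 2 by (simp add: indep_vars_iff_distr_eq_PiM' D.indep_vars_iff_distr_eq_PiM')
  qed
  ultimately show ?thesis
    unfolding poisson_process_def
    using M D.prob_space_axioms f measurable_compose[OF X f] by auto
qed

lemma poisson_thinning_any_space: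
  fixes M :: "'a measure"
  assumes t: "poisson_thinning l m f" and X: "poisson_process M l X"
  shows "poisson_process M m (\<lambda>\<omega>. f (X \<omega>))"
    and "AE \<omega> in M. points (f (X \<omega>)) \<subseteq> points (X \<omega>)"
proof -
  have M: "prob_space M" and mX: "X \<in> measurable M spm_algebra"
    using X by (auto simp: poisson_process_def)
  have mf: "f \<in> measurable spm_algebra spm_algebra"
    using t by (auto simp: poisson_thinning_def)
  have "poisson_process (distr M spm_algebra X) l (\<lambda>\<nu>. \<nu>)"
    using X poisson_process_distr[OF M mX measurable_ident_sets[OF refl]] by simp
  then have *: "poisson_process (distr M spm_algebra X) m f"
      "AE \<nu> in distr M spm_algebra X. points (f \<nu>) \<subseteq> points \<nu>"
    using t unfolding poisson_thinning_def by blast+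
  show "poisson_process M m (\<lambda>\<omega>. f (X \<omega>))"
    using *(1) poisson_process_distr[OF M mX mf] by simp
  show "AE \<omega> in M. points (f (X \<omega>)) \<subseteq> points (X \<omega>)"
    using AE_distrD[OF mX *(2)] .
qed

end

theory Submission
  imports Defs "HOL-Combinatorics.Multiset_Permutations"
begin

text \<open>Write \<open>p(l, n)\<close> and \<open>F(l, n)\<close> for the weights and the distribution function of the Poisson law.
  A thinning from \<open>l\<close> to \<open>m\<close> exists iff \<open>F(l, j) \<le> F(m, j - 1)\<close> for every \<open>j\<close> with
  \<open>p(m, j) < p(l, j)\<close>, and both claims are inequalities for this condition.

  Necessity: given their numbers of points, source and target are uniform configurations, so for such
  a \<open>j\<close> a thinning almost surely never keeps all of exactly \<open>j\<close> points; hence at most \<open>j\<close> points in the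
  source force at most \<open>j - 1\<close> points in the target.

  Sufficiency: keep all \<open>n\<close> points if \<open>p(m, n) \<ge> p(l, n)\<close>; the condition says that the remaining masses
  admit a coupling in which the number of points strictly decreases. Such a coupling can be realized
  deterministically, because a configuration carries a uniform variable that is independent of any
  proper subfamily of its points. By Renyi's theorem only the avoidance probabilities of the image have to
  be computed.\<close>

section \<open>The intensity condition\<close>

text \<open>The definition of a Poisson process asks for Poisson counts and independence over
  disjoint sets, while Renyi's theorem sees only void probabilities. One explicit law,
  \<open>poisson_law\<close>, bridges the two: it is shown once to satisfy the whole definition,
  every process of its intensity is shown to have it, and from then on only laws of configurations
  are compared. Being a mixture of uniform configurations of n points, it splits into levels on
  which two intensities differ only by a scalar, so that thinning becomes a question about Poisson
  weights. The obstacle is that \<open>f\<close> has no randomness of its own: the coin for deleting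
  points must be extracted from the configuration without biasing the survivors, and this costs at
  least one point. The shift from \<open>Suc j\<close> to \<open>j\<close> in
  \<open>thinnable\<close> is that lost point. Claim (i) holds because x ^ n * exp (- x) is unimodal
  and the distribution function decreases in the intensity; for claim (ii) both intensities are
  multiplied by l' / l and the difference of the two sides is followed as a function of this
  factor.\<close>

definition pois :: "real \<Rightarrow> nat \<Rightarrow> real" where
  "pois l n = l ^ n / fact n * exp (- l)"

definition pois_cdf :: "real \<Rightarrow> nat \<Rightarrow> real" where
  "pois_cdf l j = (\<Sum>i\<le>j. pois l i)"

text \<open>Level 0 is left out because \<open>pois m 0\<close> exceeds \<open>pois l 0\<close>
  whenever m < l, so it never forces a loss; writing a level as \<open>Suc j\<close> gives it a
  genuine predecessor.\<close>

definition thinnable :: "real \<Rightarrow> real \<Rightarrow> bool" where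
  "thinnable l m \<longleftrightarrow> (\<forall>j. pois m (Suc j) < pois l (Suc j) \<longrightarrow> pois_cdf l (Suc j) \<le> pois_cdf m j)"

lemma pois_nonneg: "l \<ge> 0 \<Longrightarrow> pois l n \<ge> 0"
  by (simp add: pois_def)

lemma pois_pos: "l > 0 \<Longrightarrow> pois l n > 0"
  by (simp add: pois_def)

lemma pois_sums: "pois l sums 1"
proof -
  have "(\<lambda>n. l ^ n /\<^sub>R fact n * exp (- l)) sums (exp l * exp (- l))"
    by (intro sums_mult2 exp_converges)
  then show ?thesis
    by (simp add: pois_def[abs_def] field_simps exp_minus)
qed

text \<open>The derivative of x ^ n * exp (- x) has the sign of n - x, so the function rises up to n
  and falls afterwards: b beats a if b \<le> n, and beats c otherwise. It is applied with n a level,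
  and with n = 1 to the function \<open>\<phi>\<close> in \<open>thinnable_scale\<close>.\<close>

lemma power_exp_unimodal:
  fixes a b c :: real
  assumes "0 < a" "a < b" "b < c"
  shows "a ^ n * exp (- a) < b ^ n * exp (- b) \<or> c ^ n * exp (- c) < b ^ n * exp (- b)"
proof -
  have D: "((\<lambda>x. x ^ n * exp (- x)) has_real_derivative (real n - x) * x ^ n / x * exp (- x)) (at x)"
    if "x > 0" for x :: real
  proof -
    have "((\<lambda>x. x ^ n * exp (- x)) has_real_derivative real n * x ^ (n - 1) * exp (- x) - x ^ n * exp (- x)) (at x)"
      by (auto intro!: derivative_eq_intros)
    moreover have "real n * x ^ (n - 1) * exp (- x) - x ^ n * exp (- x) = (real n - x) * x ^ n / x * exp (- x)"
    proof (cases n)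
      case (Suc k)
      have "x ^ n / x = x ^ k"
        using that Suc by simp
      then have "(real n - x) * x ^ n / x = (real n - x) * x ^ k"
        by (metis times_divide_eq_right)
      then show ?thesis
        using Suc by (simp add: left_diff_distrib)
    qed (use that in simp)
    ultimately show ?thesis by simp
  qed
  show ?thesis
  proof (cases "b \<le> n")
    case True
    have "a ^ n * exp (- a) < b ^ n * exp (- b)"
    proof (rule DERIV_pos_imp_increasing_open[OF \<open>a < b\<close>])
      fix x assume "a < x" "x < b"
      then show "\<exists>y. ((\<lambda>x. x ^ n * exp (- x)) has_real_derivative y) (at x) \<and> 0 < y"
        using D[of x] assms True by (intro exI[of _ "(real n - x) * x ^ n / x * exp (- x)"]) auto
    qed (intro continuous_intros)
    then show ?thesis ..
  next
    case False
    have "c ^ n * exp (- c) < b ^ n * exp (- b)"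
    proof (rule DERIV_neg_imp_decreasing_open[OF \<open>b < c\<close>])
      fix x assume "b < x" "x < c"
      then show "\<exists>y. ((\<lambda>x. x ^ n * exp (- x)) has_real_derivative y) (at x) \<and> y < 0"
        using D[of x] assms False
        by (intro exI[of _ "(real n - x) * x ^ n / x * exp (- x)"]) (auto simp: field_simps)
    qed (intro continuous_intros)
    then show ?thesis ..
  qed
qed

text \<open>The derivative of \<open>pois l (Suc j)\<close> in l is
  \<open>pois l j - pois l (Suc j)\<close>, so the sum telescopes to its last term.\<close>

lemma pois_cdf_deriv:
  "((\<lambda>l. pois_cdf l j) has_real_derivative - pois l j) (at l)"
proof (induction j)
  case 0
  then show ?case
    by (auto simp: pois_cdf_def pois_def intro!: derivative_eq_intros)
next
  case (Suc j)
  have "((\<lambda>l. pois l (Suc j)) has_real_derivative pois l j - pois l (Suc j)) (at l)"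
    unfolding pois_def
    by (rule derivative_eq_intros refl | simp)+
  from DERIV_add[OF Suc this] show ?case
    by (simp add: pois_cdf_def)
qed

lemma pois_cdf_antimono:
  assumes "0 \<le> l" "l \<le> l'"
  shows "pois_cdf l' j \<le> pois_cdf l j"
proof (rule DERIV_nonpos_imp_nonincreasing[OF assms(2)])
  fix x assume "l \<le> x" "x \<le> l'"
  then show "\<exists>y. ((\<lambda>l. pois_cdf l j) has_real_derivative y) (at x) \<and> y \<le> 0"
    using pois_cdf_deriv[of j x] pois_nonneg[of x j] assms by fastforce
qed

text \<open>Since l lies between m and l', unimodality shows that a level at which l' outweighs m is
  one at which l outweighs m, so no new level becomes relevant. At the old ones the left side only
  drops when l grows to l'.\<close>

lemma thinnable_mono:
  assumes "0 < m" "m < l" "l < l'" and t: "thinnable l m"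
  shows "thinnable l' m"
  unfolding thinnable_def
proof (intro allI impI)
  fix j assume *: "pois m (Suc j) < pois l' (Suc j)"
  have "pois m (Suc j) < pois l (Suc j)"
    using power_exp_unimodal[OF assms(1-3), of "Suc j"] *
    by (auto simp: pois_def divide_simps)
  then have "pois_cdf l (Suc j) \<le> pois_cdf m j"
    using t by (auto simp: thinnable_def)
  then show "pois_cdf l' (Suc j) \<le> pois_cdf m j"
    using pois_cdf_antimono[of l l' "Suc j"] assms by simp
qed

text \<open>Take the logarithm of the likelihood ratio. For fixed j the condition is an upper bound
  on c, so the relevant scale factors form an interval starting at 0.\<close>

lemma pois_less_iff:
  assumes "0 < m" "m < l" "c > 0"
  shows "pois (c * m) j < pois (c * l) j \<longleftrightarrow> c * (l - m) < j * ln (l / m)"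
proof -
  have "pois (c * m) j < pois (c * l) j \<longleftrightarrow> m ^ j * exp (- (c * m)) < l ^ j * exp (- (c * l))"
    using assms by (simp add: pois_def power_mult_distrib divide_simps)
  also have "\<dots> \<longleftrightarrow> exp (c * (l - m)) < (l / m) ^ j"
    using assms by (simp add: exp_minus exp_diff right_diff_distrib divide_simps mult.commute)
  also have "(l / m) ^ j = exp (j * ln (l / m))"
    using assms by (simp add: exp_of_nat_mult)
  finally show ?thesis by simp
qed

text \<open>The function \<open>h\<close> below vanishes at \<open>0\<close>, and the sign of its derivative is that of
  \<open>\<phi> - 1\<close> with \<open>\<phi>\<close> unimodal. Since \<open>\<phi> \<ge> 1\<close> at the end of the range of relevant \<open>c\<close>,
  \<open>h\<close> first decreases and then increases there, so it stays nonnegative once it is.\<close>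

lemma thinnable_scale:
  assumes "0 < m" "m < l" "1 < c" and t: "thinnable l m"
  shows "thinnable (c * l) (c * m)"
  unfolding thinnable_def
proof (intro allI impI)
  fix i assume *: "pois (c * m) (Suc i) < pois (c * l) (Suc i)"
  define j where "j = Suc i"
  define h where "h = (\<lambda>x. pois_cdf (x * m) i - pois_cdf (x * l) j)"
  define d where "d = l - m"
  \<comment> \<open>\<open>\<phi> x\<close> is the quotient of \<open>l * pois (x * l) j\<close> by
    \<open>m * pois (x * m) i\<close>, the two terms of the derivative of \<open>h\<close>. The
    factor d is inserted and divided out again so that x enters only through (x * d) * exp (- (x *
    d)).\<close>
  define \<phi> where "\<phi> = (\<lambda>x. (x * d) * exp (- (x * d)) * (l ^ Suc j / (d * j * m ^ j)))"
  \<comment> \<open>The end of the interval of relevant factors given by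
    \<open>pois_less_iff\<close>.\<close>
  define e where "e = j * ln (l / m) / d"
  have d: "d > 0" using assms by (simp add: d_def)
  have "c * d < j * ln (l / m)"
    using * assms pois_less_iff[of m l c j] by (simp add: j_def d_def)
  then have ce: "c < e"
    using d by (simp add: e_def field_simps)
  have "1 * (l - m) < c * (l - m)"
    using assms by (intro mult_strict_right_mono) auto
  then have "1 * (l - m) < j * ln (l / m)"
    using \<open>c * d < _\<close> unfolding d_def by linarith
  then have "pois m j < pois l j"
    using assms pois_less_iff[of m l 1 j] by simp
  then have h1: "h 1 \<ge> 0"
    using t by (auto simp: thinnable_def h_def j_def)
  have "pois_cdf 0 n = 1" for n
    by (induction n) (auto simp: pois_cdf_def pois_def)
  then have h0: "h 0 = 0"
    by (simp add: h_def)
  have hD: "(h has_real_derivative (\<phi> x - 1) * (m * pois (x * m) i)) (at x)" if "x > 0" for x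
  proof -
    have "(h has_real_derivative (- pois (x * m) i * m - (- pois (x * l) j * l))) (at x)"
      unfolding h_def
      by (rule derivative_eq_intros DERIV_chain2[OF pois_cdf_deriv] refl | simp)+
    moreover have "l * pois (x * l) j = \<phi> x * (m * pois (x * m) i)"
    proof -
      have "exp (- (x * d)) * exp (- (x * m)) = exp (- (x * l))"
        by (simp add: d_def algebra_simps flip: exp_add)
      then have "\<phi> x * (m * pois (x * m) i) =
          x * d * (l ^ Suc j / (d * j * m ^ j)) * (m * ((x * m) ^ i / fact i)) * exp (- (x * l))"
        by (simp add: \<phi>_def pois_def)
      also have "\<dots> = l * pois (x * l) j"
        using d that assms by (simp add: j_def pois_def power_mult_distrib divide_simps)
      finally show ?thesis ..
    qed
    ultimately show ?thesis
      by (simp add: algebra_simps)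
  qed
  have hc: "continuous_on {0..} h"
    unfolding h_def pois_cdf_def pois_def by (intro continuous_intros) auto
  have mp: "m * pois (x * m) i > 0" if "x > 0" for x
    using that assms by (simp add: pois_pos)
  show "pois_cdf (c * l) (Suc i) \<le> pois_cdf (c * m) i"
  proof (rule ccontr)
    assume "\<not> ?thesis"
    then have hc0: "h c < 0" by (simp add: h_def j_def)
    have hdiff: "h differentiable (at x)" if "x > 0" for x
      using hD[OF that] real_differentiable_def by blast
    have "continuous_on {0..1} h" "continuous_on {1..c} h"
      using \<open>1 < c\<close> by (auto intro: continuous_on_subset[OF hc])
    \<comment> \<open>The mean value theorem on [0, 1] gives a \<xi> with
      \<open>\<phi> \<xi>\<close> \<ge> 1, as \<open>h\<close> goes from 0 to a nonnegative value;
      on [1, c] it gives an \<eta> with \<open>\<phi> \<eta>\<close> < 1. Together with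
      \<open>\<phi> e\<close> \<ge> 1 and \<xi> < \<eta> < e this would be a valley of a unimodal
      function.\<close>
    obtain \<xi> D where \<xi>: "0 < \<xi>" "\<xi> < 1" "(h has_real_derivative D) (at \<xi>)" "h 1 - h 0 = (1 - 0) * D"
    proof -
      from MVT[of 0 1 h, OF zero_less_one \<open>continuous_on {0..1} h\<close>] hdiff
      have "\<exists>D z. 0 < z \<and> z < 1 \<and> (h has_real_derivative D) (at z) \<and> h 1 - h 0 = (1 - 0) * D"
        by simp
      then show ?thesis by (elim exE conjE) (rule that)
    qed
    have "D = (\<phi> \<xi> - 1) * (m * pois (\<xi> * m) i)"
      by (rule DERIV_unique[OF \<xi>(3) hD[OF \<xi>(1)]])
    then have \<phi>\<xi>: "\<phi> \<xi> \<ge> 1"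
      using \<xi> h0 h1 mp[of \<xi>] by (simp add: zero_le_mult_iff)
    obtain \<eta> D where \<eta>: "1 < \<eta>" "\<eta> < c" "(h has_real_derivative D) (at \<eta>)" "h c - h 1 = (c - 1) * D"
    proof -
      have "h differentiable (at x)" if "1 < x" for x
        using hdiff[of x] that by simp
      from MVT[OF \<open>1 < c\<close> \<open>continuous_on {1..c} h\<close> this]
      have "\<exists>D z. 1 < z \<and> z < c \<and> (h has_real_derivative D) (at z) \<and> h c - h 1 = (c - 1) * D"
        by simp
      then show ?thesis by (elim exE conjE) (rule that)
    qed
    have "D = (\<phi> \<eta> - 1) * (m * pois (\<eta> * m) i)"
      using \<eta>(1) by (intro DERIV_unique[OF \<eta>(3) hD]) simp
    moreover have "D < 0"
    proof -
      have "(c - 1) * D < 0" using \<eta> hc0 h1 by linarith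
      then show ?thesis using \<open>1 < c\<close> by (simp add: mult_less_0_iff)
    qed
    ultimately have \<phi>\<eta>: "\<phi> \<eta> < 1"
      using \<eta>(1) assms pois_pos[of "\<eta> * m" i] by (auto simp: mult_less_0_iff)
    \<comment> \<open>At e the exponential becomes a power of m / l and \<open>\<phi> e\<close>
      collapses to l * ln (l / m) / (l - m), so the claim is ln (l / m) \<ge> 1 - m / l.\<close>
    have "\<phi> e \<ge> 1"
    proof -
      have ed: "e * d = j * ln (l / m)"
        using d by (simp add: e_def)
      then have "exp (- (e * d)) = (m / l) ^ j"
        using assms by (simp add: exp_minus exp_of_nat_mult power_divide)
      then have "\<phi> e = j * ln (l / m) * (m / l) ^ j * (l ^ Suc j / (d * j * m ^ j))"
        by (simp only: \<phi>_def ed)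
      moreover have "j * L * (m / l) ^ j * (l ^ Suc j / (d * j * m ^ j)) = l * L / d" for L :: real
        using assms d by (simp add: power_divide j_def divide_simps del: of_nat_Suc)
      ultimately have "\<phi> e = l * ln (l / m) / d"
        by simp
      moreover have "ln (m / l) \<le> m / l - 1"
        using assms by (intro ln_le_minus_one) auto
      then have "ln (l / m) \<ge> 1 - m / l"
        using assms by (simp add: ln_div)
      then have "l * ln (l / m) \<ge> l * (1 - m / l)"
        using assms by (intro mult_left_mono) auto
      moreover have "l * (1 - m / l) = d"
        using assms by (simp add: d_def right_diff_distrib)
      ultimately show ?thesis
        using d by simp
    qed
    have "(\<xi> * d) ^ 1 * exp (- (\<xi> * d)) < (\<eta> * d) ^ 1 * exp (- (\<eta> * d)) \<or>
        (e * d) ^ 1 * exp (- (e * d)) < (\<eta> * d) ^ 1 * exp (- (\<eta> * d))"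
      using d \<xi> \<eta> ce by (intro power_exp_unimodal) auto
    moreover have "l ^ Suc j / (d * j * m ^ j) > 0"
      using d assms by (simp add: j_def)
    ultimately have "\<phi> \<xi> < \<phi> \<eta> \<or> \<phi> e < \<phi> \<eta>"
      unfolding \<phi>_def by (metis mult_strict_right_mono power_one_right)
    then show False
      using \<phi>\<xi> \<phi>\<eta> \<open>\<phi> e \<ge> 1\<close> by linarith
  qed
qed

section \<open>Simple point measures and avoidance probabilities\<close>

lemma sets_unit_borel_iff: "A \<in> sets unit_borel \<longleftrightarrow> A \<in> sets borel \<and> A \<subseteq> {0..1}"
  by (subst sets_restrict_space_iff) auto

lemma unit_borel_top [simp]: "{0..1} \<in> sets unit_borel"
  by (simp add: sets_unit_borel_iff)

text \<open>The counting measure on F. As a push-forward it has the space and the \<sigma>-algebra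
  demanded by \<open>simple_point_measures\<close> by construction; on finite subsets of the unit
  interval it is the inverse of \<open>points\<close>.\<close>

definition pm :: "real set \<Rightarrow> real measure" where
  "pm F = distr (count_space F) unit_borel (\<lambda>x. x)"

lemma space_pm [simp]: "space (pm F) = {0..1}"
  by (simp add: pm_def space_restrict_space)

lemma sets_pm [simp]: "sets (pm F) = sets unit_borel"
  by (simp add: pm_def)

lemma emeasure_pm:
  assumes "finite F" "F \<subseteq> {0..1}" "A \<in> sets unit_borel"
  shows "emeasure (pm F) A = of_nat (card (F \<inter> A))"
proof -
  have "(\<lambda>x. x) \<in> count_space F \<rightarrow>\<^sub>M unit_borel"
    using assms by (auto simp: space_restrict_space)
  then show ?thesis
    using assms by (simp add: pm_def emeasure_distr emeasure_count_space Int_commute)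
qed

lemma pm_in_simple_point_measures:
  assumes "finite F" "F \<subseteq> {0..1}"
  shows "pm F \<in> simple_point_measures"
proof -
  have "card (F \<inter> {x}) \<le> 1" for x
    using card_mono[of "{x}" "F \<inter> {x}"] by simp
  then have "emeasure (pm F) {x} \<le> 1" if "x \<in> {0..1}" for x
    using that assms by (subst emeasure_pm) (auto simp: sets_unit_borel_iff)
  then show ?thesis
    using assms by (auto simp: simple_point_measures_def emeasure_pm)
qed

lemma points_pm:
  assumes "finite F" "F \<subseteq> {0..1}"
  shows "points (pm F) = F"
proof -
  have "emeasure (pm F) {x} = of_nat (card (F \<inter> {x}))" if "x \<in> {0..1}" for x
    using that assms by (intro emeasure_pm) (auto simp: sets_unit_borel_iff)
  then show ?thesis
    using assms by (auto simp: points_def)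
qed

lemma simple_point_measures_D:
  assumes "\<nu> \<in> simple_point_measures"
  shows "space \<nu> = {0..1}" "sets \<nu> = sets unit_borel"
    and "A \<in> sets unit_borel \<Longrightarrow> \<exists>n::nat. emeasure \<nu> A = of_nat n"
    and "x \<in> {0..1} \<Longrightarrow> emeasure \<nu> {x} \<le> 1"
  using assms by (auto simp: simple_point_measures_def)

text \<open>An atom has nonzero integer mass, hence mass at least 1, so the integer total mass
  bounds the number of atoms.\<close>

lemma finite_points:
  assumes \<nu>: "\<nu> \<in> simple_point_measures"
  shows "finite (points \<nu>)"
proof (rule ccontr)
  note D = simple_point_measures_D[OF \<nu>]
  assume inf: "infinite (points \<nu>)"
  obtain n :: nat where n: "emeasure \<nu> {0..1} = of_nat n"
    using D(3)[of "{0..1}"] by auto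
  obtain F where F: "F \<subseteq> points \<nu>" "finite F" "card F = Suc n"
    using infinite_arbitrarily_large[OF inf] by blast
  have sub: "F \<subseteq> {0..1}"
    using F(1) D(1) by (auto simp: points_def)
  have sing: "{x} \<in> sets \<nu>" if "x \<in> F" for x
    using sub that by (auto simp: D(2) sets_unit_borel_iff)
  have "1 \<le> emeasure \<nu> {x}" if x: "x \<in> F" for x
  proof -
    obtain k :: nat where "emeasure \<nu> {x} = of_nat k"
      using D(2) D(3)[of "{x}"] sing[OF x] by auto
    moreover have "emeasure \<nu> {x} \<noteq> 0"
      using F(1) that by (auto simp: points_def)
    ultimately show ?thesis
      by (cases k) auto
  qed
  then have "(\<Sum>x\<in>F. 1) \<le> (\<Sum>x\<in>F. emeasure \<nu> {x})"
    by (intro sum_mono) auto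
  also have "\<dots> = emeasure \<nu> F"
    using F sing by (intro emeasure_eq_sum_singleton[symmetric]) auto
  also have "\<dots> \<le> emeasure \<nu> {0..1}"
    using sub D by (intro emeasure_mono) auto
  finally have "(of_nat (Suc n) :: ennreal) \<le> of_nat n"
    using F n by simp
  then show False
    by (simp only: of_nat_le_iff)
qed

lemma points_subset: "\<nu> \<in> simple_point_measures \<Longrightarrow> points \<nu> \<subseteq> {0..1}"
  using simple_point_measures_D(1) by (auto simp: points_def)

text \<open>An integer-valued measure vanishes near each point that carries no mass, so by the
  Lindelof property it vanishes on any set without atoms.\<close>

lemma emeasure_eq_0_no_points:
  assumes \<nu>: "\<nu> \<in> simple_point_measures" and A: "A \<in> sets unit_borel" "A \<inter> points \<nu> = {}"
  shows "emeasure \<nu> A = 0"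
proof -
  note D = simple_point_measures_D[OF \<nu>]
  have A01: "A \<subseteq> {0..1}"
    using A by (simp add: sets_unit_borel_iff)
  have cell: "{0..1} \<inter> B \<in> sets \<nu>" if "B \<in> sets borel" for B
    using that by (simp add: D(2) sets_unit_borel_iff)
  have "\<exists>e>0. emeasure \<nu> ({0..1} \<inter> ball x e) = 0" if x: "x \<in> A" for x
  proof -
    define B where "B = (\<lambda>n. {0..1} \<inter> ball x (1 / real (Suc n)))"
    have fin: "emeasure \<nu> (B n) \<noteq> \<infinity>" for n
    proof -
      obtain k :: nat where "emeasure \<nu> (B n) = of_nat k"
        using D(2) D(3)[of "B n"] cell by (auto simp: B_def)
      then show ?thesis by simp
    qed
    have "decseq B"
      unfolding decseq_def B_def
      by (intro allI impI Int_mono order_refl subset_ball) (simp add: frac_le)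
    moreover have "range B \<subseteq> sets \<nu>"
      using cell by (auto simp: B_def)
    \<comment> \<open>Continuity from above: the balls shrink to a point of mass 0, and an integer
      mass below 1 is 0.\<close>
    ultimately have lim: "(\<lambda>n. emeasure \<nu> (B n)) \<longlonglongrightarrow> emeasure \<nu> (\<Inter>n. B n)"
      using fin by (intro Lim_emeasure_decseq) auto
    have "(\<Inter>n. B n) = {x}"
    proof -
      have "y = x" if "\<And>n. y \<in> B n" for y
      proof (rule ccontr)
        assume "y \<noteq> x"
        then obtain n where "1 / real (Suc n) < dist x y"
          using nat_approx_posE[of "dist x y"] by auto
        then show False
          using that[of n] by (simp add: B_def)
      qed
      then show ?thesis
        using x A01 by (auto simp: B_def)
    qed
    moreover have "emeasure \<nu> {x} = 0"
      using A x A01 D(1) by (auto simp: points_def disjoint_iff)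
    ultimately have "\<forall>\<^sub>F n in sequentially. emeasure \<nu> (B n) < 1"
      using lim by (intro order_tendstoD(2)) auto
    then obtain n where n: "emeasure \<nu> (B n) < 1"
      by (auto simp: eventually_sequentially)
    obtain k :: nat where "emeasure \<nu> (B n) = of_nat k"
      using D(2) D(3)[of "B n"] cell by (auto simp: B_def)
    then have "emeasure \<nu> (B n) = 0"
      using n by (cases k) auto
    then show ?thesis
      by (intro exI[of _ "1 / real (Suc n)"]) (auto simp: B_def)
  qed
  then obtain e where e: "\<And>x. x \<in> A \<Longrightarrow> e x > 0" "\<And>x. x \<in> A \<Longrightarrow> emeasure \<nu> ({0..1} \<inter> ball x (e x)) = 0"
    by metis
  obtain F' where F': "F' \<subseteq> (\<lambda>x. ball x (e x)) ` A" "countable F'" "\<Union>F' = (\<Union>x\<in>A. ball x (e x))"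
    by (rule Lindelof[of "(\<lambda>x. ball x (e x)) ` A"]) auto
  have "(\<Union>B\<in>F'. {0..1} \<inter> B) \<in> null_sets \<nu>"
    using F'(1,2) e cell by (intro null_sets_UN') (auto simp: null_sets_def)
  moreover have "A \<subseteq> (\<Union>B\<in>F'. {0..1} \<inter> B)"
    using F'(3) e(1) A01 by fastforce
  ultimately show ?thesis
    using A(1) D(2) null_sets_subset[of _ \<nu> A] null_setsD1[of A \<nu>] by metis
qed

text \<open>Atoms have mass exactly 1 by simplicity, and the rest of A is null by
  \<open>emeasure_eq_0_no_points\<close>. From here on a simple point measure can be handled as its
  finite set of points.\<close>

lemma emeasure_eq_card_points:
  assumes \<nu>: "\<nu> \<in> simple_point_measures" and A: "A \<in> sets unit_borel"
  shows "emeasure \<nu> A = of_nat (card (points \<nu> \<inter> A))"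
proof -
  note D = simple_point_measures_D[OF \<nu>] and fin = finite_points[OF \<nu>]
  have sing: "{x} \<in> sets \<nu>" if "x \<in> points \<nu>" for x
    using points_subset[OF \<nu>] that by (auto simp: D(2) sets_unit_borel_iff)
  have one: "emeasure \<nu> {x} = 1" if x: "x \<in> points \<nu>" for x
  proof -
    obtain k :: nat where k: "emeasure \<nu> {x} = of_nat k"
      using D(2) D(3)[of "{x}"] sing[OF x] by auto
    have "emeasure \<nu> {x} \<le> 1"
      using D(4)[of x] points_subset[OF \<nu>] that by auto
    moreover have "emeasure \<nu> {x} \<noteq> 0"
      using that by (auto simp: points_def)
    ultimately show ?thesis
      using k of_nat_le_iff[of k 1, where 'a = ennreal] by (cases "k = 0") auto
  qed
  have m: "points \<nu> \<inter> A \<in> sets \<nu>" "A - points \<nu> \<in> sets \<nu>" "A \<in> sets \<nu>"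
  proof -
    have "points \<nu> \<in> sets borel"
      using fin by (simp add: finite_imp_closed)
    then show "points \<nu> \<inter> A \<in> sets \<nu>" "A - points \<nu> \<in> sets \<nu>" "A \<in> sets \<nu>"
      using A by (auto simp: D(2) sets_unit_borel_iff)
  qed
  have "emeasure \<nu> A = emeasure \<nu> (points \<nu> \<inter> A) + emeasure \<nu> (A - points \<nu>)"
    using m by (subst plus_emeasure) (auto intro!: arg_cong[where f = "emeasure \<nu>"])
  also have "emeasure \<nu> (A - points \<nu>) = 0"
    using m D(2) by (intro emeasure_eq_0_no_points[OF \<nu>]) auto
  also have "emeasure \<nu> (points \<nu> \<inter> A) = (\<Sum>x\<in>points \<nu> \<inter> A. emeasure \<nu> {x})"
    using fin sing by (intro emeasure_eq_sum_singleton) auto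
  also have "\<dots> = of_nat (card (points \<nu> \<inter> A))"
    using one by simp
  finally show ?thesis by simp
qed

lemma pm_points:
  assumes \<nu>: "\<nu> \<in> simple_point_measures"
  shows "pm (points \<nu>) = \<nu>"
  using simple_point_measures_D[OF \<nu>] finite_points[OF \<nu>] points_subset[OF \<nu>]
  by (intro measure_eqI) (simp_all add: emeasure_pm emeasure_eq_card_points[OF \<nu>])

lemma measurable_spm_algebraI:
  assumes "\<And>x. x \<in> space M \<Longrightarrow> g x \<in> simple_point_measures"
    and "\<And>A. A \<in> sets unit_borel \<Longrightarrow> (\<lambda>x. emeasure (g x) A) \<in> borel_measurable M"
  shows "g \<in> measurable M spm_algebra"
  unfolding spm_algebra_def
  using assms by (intro measurable_SUP2 measurable_vimage_algebra2) auto

section \<open>Void events and Renyi's theorem\<close>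

abbreviation void_event :: "real set \<Rightarrow> real measure set" where
  "void_event A \<equiv> {\<nu> \<in> simple_point_measures. emeasure \<nu> A = 0}"

text \<open>Two reals at distance \<delta> lie in different cells once 2 ^ k > 1 / \<delta>, and F
  has only finitely many pairs. This yields both the convergence of the dyadic counts and the
  existence of the minimum in \<open>sep_level\<close>.\<close>

lemma finite_dyadic_separation:
  fixes F :: "real set"
  assumes "finite F"
  shows "\<exists>k0::nat. \<forall>k\<ge>k0. inj_on (\<lambda>x. \<lfloor>2 ^ k * x\<rfloor>) F"
proof -
  have *: "\<forall>\<^sub>F k in sequentially. \<lfloor>2 ^ k * x\<rfloor> \<noteq> \<lfloor>2 ^ k * y\<rfloor>" if "x < y" for x y :: real
  proof -
    obtain k0 where k0: "1 / (y - x) < 2 ^ k0"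
      using real_arch_pow[of 2 "1 / (y - x)"] by auto
    have "\<lfloor>2 ^ k * x\<rfloor> \<noteq> \<lfloor>2 ^ k * y\<rfloor>" if "k \<ge> k0" for k
    proof
      assume eq: "\<lfloor>2 ^ k * x\<rfloor> = \<lfloor>2 ^ k * y\<rfloor>"
      have "2 ^ k * y - 2 ^ k * x < 1"
        using eq floor_correct[of "2 ^ k * x"] floor_correct[of "2 ^ k * y"] by linarith
      moreover have "1 / (y - x) < (2::real) ^ k"
        using k0 that power_increasing[of k0 k "2::real"] by linarith
      ultimately show False
        using \<open>x < y\<close> by (simp add: field_simps)
    qed
    then show ?thesis
      by (auto simp: eventually_sequentially)
  qed
  have "\<forall>\<^sub>F k in sequentially. x \<noteq> y \<longrightarrow> \<lfloor>2 ^ k * x\<rfloor> \<noteq> \<lfloor>2 ^ k * y\<rfloor>" for x y :: real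
    using *[of x y] *[of y x] by (cases x y rule: linorder_cases) (auto elim!: eventually_mono)
  then have "\<forall>\<^sub>F k in sequentially. \<forall>x\<in>F. \<forall>y\<in>F. x \<noteq> y \<longrightarrow> \<lfloor>2 ^ k * x\<rfloor> \<noteq> \<lfloor>2 ^ k * y\<rfloor>"
    by (intro eventually_ball_finite assms ballI)
  then show ?thesis
    by (auto simp: eventually_sequentially inj_on_def)
qed

text \<open>For a simple point measure the number of dyadic cells meeting \<open>A\<close> with positive mass
  increases to the mass of \<open>A\<close>.\<close>

lemma sets_spm_algebra:
  "sets spm_algebra = sigma_sets simple_point_measures (void_event ` sets unit_borel)" (is "_ = ?S")
proof
  have void: "void_event A \<in> sets spm_algebra" if "A \<in> sets unit_borel" for A
    using measurable_sets[OF measurable_emeasure_spm_algebra[OF that], of "{0}"]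
    by (simp add: vimage_def space_spm_algebra Int_def conj_commute)
  show "?S \<subseteq> sets spm_algebra"
    using void by (intro sets.sigma_sets_subset') (auto simp flip: space_spm_algebra)
next
  let ?\<Sigma> = "sigma simple_point_measures (void_event ` sets unit_borel)"
  have sets: "sets ?\<Sigma> = ?S" and space: "space ?\<Sigma> = simple_point_measures"
    by (auto intro!: sets_measure_of space_measure_of)
  have "(\<lambda>\<nu>. \<nu>) \<in> measurable ?\<Sigma> spm_algebra"
  proof (rule measurable_spm_algebraI)
    fix A assume A: "A \<in> sets unit_borel"
    define c where "c = (\<lambda>k i. {x \<in> A. \<lfloor>2 ^ k * x\<rfloor> = i})"
    have c: "c k i \<in> sets unit_borel" for k :: nat and i
    proof -
      have "(\<lambda>x. \<lfloor>2 ^ k * x\<rfloor>) -` {i} \<inter> space borel \<in> sets (borel :: real measure)"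
        by (intro measurable_sets[of _ _ "count_space UNIV"]) auto
      then have "A \<inter> {x. \<lfloor>2 ^ k * x\<rfloor> = i} \<in> sets borel"
        using A by (intro sets.Int) (auto simp: sets_unit_borel_iff vimage_def)
      then show ?thesis
        using A by (auto simp: sets_unit_borel_iff c_def Int_def)
    qed
    \<comment> \<open>The index 2 ^ k is included because the point 1 has that cell to
      itself.\<close>
    define h where "h = (\<lambda>k \<nu>. \<Sum>i\<in>{0..2 ^ k}. indicator (- void_event (c k i)) \<nu> :: ennreal)"
    have hm: "h k \<in> borel_measurable ?\<Sigma>" for k
    proof -
      have "- void_event (c k i) \<inter> space ?\<Sigma> \<in> sets ?\<Sigma>" for i
      proof -
        have "space ?\<Sigma> - void_event (c k i) \<in> sets ?\<Sigma>"
          using c by (intro sets.compl_sets) (auto simp: sets)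
        then show ?thesis
          by (simp add: Diff_eq Int_commute)
      qed
      then show ?thesis
        unfolding h_def by (intro borel_measurable_sum borel_measurable_indicator_iff[THEN iffD2])
    qed
    have "emeasure \<nu> A = (SUP k. h k \<nu>)" if \<nu>: "\<nu> \<in> simple_point_measures" for \<nu>
    proof -
      define F where "F = points \<nu> \<inter> A"
      have fin: "finite F"
        using finite_points[OF \<nu>] by (simp add: F_def)
      have F01: "F \<subseteq> {0..1}"
        using points_subset[OF \<nu>] by (auto simp: F_def)
      have h: "h k \<nu> = of_nat (card ((\<lambda>x. \<lfloor>2 ^ k * x\<rfloor>) ` F))" for k
      proof -
        have "\<nu> \<in> - void_event (c k i) \<longleftrightarrow> i \<in> (\<lambda>x. \<lfloor>2 ^ k * x\<rfloor>) ` F" for i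
        proof -
          have "emeasure \<nu> (c k i) \<noteq> 0 \<longleftrightarrow> points \<nu> \<inter> c k i \<noteq> {}"
            using finite_points[OF \<nu>] by (simp add: emeasure_eq_card_points[OF \<nu> c])
          then show ?thesis
            using \<nu> by (auto simp: c_def F_def)
        qed
        then have "h k \<nu> = (\<Sum>i\<in>{0..2 ^ k}. indicator ((\<lambda>x. \<lfloor>2 ^ k * x\<rfloor>) ` F) i)"
          unfolding h_def by (intro sum.cong) (auto simp: indicator_def)
        also have "\<dots> = of_nat (card ({0..2 ^ k} \<inter> (\<lambda>x. \<lfloor>2 ^ k * x\<rfloor>) ` F))"
          by (simp add: indicator_def sum.If_cases Int_def)
        also have "{0..2 ^ k} \<inter> (\<lambda>x. \<lfloor>2 ^ k * x\<rfloor>) ` F = (\<lambda>x. \<lfloor>2 ^ k * x\<rfloor>) ` F"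
        proof -
          have "0 \<le> \<lfloor>2 ^ k * x\<rfloor>" "\<lfloor>2 ^ k * x\<rfloor> \<le> 2 ^ k" if "x \<in> F" for x
          proof -
            have "0 \<le> x" "x \<le> 1" using F01 that by auto
            then show "0 \<le> \<lfloor>2 ^ k * x\<rfloor>" by simp
            have "2 ^ k * x \<le> 2 ^ k * 1" using \<open>x \<le> 1\<close> by (intro mult_left_mono) auto
            then have "\<lfloor>2 ^ k * x\<rfloor> \<le> \<lfloor>2 ^ k :: real\<rfloor>" by (intro floor_mono) simp
            also have "\<lfloor>2 ^ k :: real\<rfloor> = 2 ^ k" by (metis floor_of_int of_int_numeral of_int_power)
            finally show "\<lfloor>2 ^ k * x\<rfloor> \<le> 2 ^ k" .
          qed
          then show ?thesis by auto
        qed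
        finally show ?thesis .
      qed
      have em: "emeasure \<nu> A = of_nat (card F)"
        by (simp add: emeasure_eq_card_points[OF \<nu> A] F_def)
      obtain k where "inj_on (\<lambda>x. \<lfloor>2 ^ k * x\<rfloor>) F"
        using finite_dyadic_separation[OF fin] by blast
      then have "emeasure \<nu> A = h k \<nu>"
        by (simp add: em h card_image)
      moreover have "h k \<nu> \<le> emeasure \<nu> A" for k
        using card_image_le[OF fin] by (simp add: em h)
      ultimately show ?thesis
        by (intro antisym SUP_least) (auto intro: SUP_upper2)
    qed
    then show "(\<lambda>\<nu>. emeasure \<nu> A) \<in> borel_measurable ?\<Sigma>"
      using hm by (subst measurable_cong[where g = "\<lambda>\<nu>. SUP k. h k \<nu>"]) (auto simp: space)
  qed (auto simp: space)
  then have "id -` A \<inter> space ?\<Sigma> \<in> sets ?\<Sigma>" if "A \<in> sets spm_algebra" for A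
    using that by (auto simp: measurable_def id_def)
  then show "sets spm_algebra \<subseteq> ?S"
    using sets.sets_into_space[of _ spm_algebra]
    by (force simp: sets space space_spm_algebra Int_absorb2)
qed

text \<open>Avoiding both A and B means avoiding A \<union> B, so the void events form a
  \<pi>-system; they generate \<open>spm_algebra\<close>, and the uniqueness theorem for measures
  applies.\<close>

lemma renyi_avoidance:
  assumes "sets P = sets spm_algebra" "sets Q = sets spm_algebra" "finite_measure P"
    and eq: "\<And>A. A \<in> sets unit_borel \<Longrightarrow> emeasure P (void_event A) = emeasure Q (void_event A)"
  shows "P = Q"
proof (rule measure_eqI_generator_eq[where E = "void_event ` sets unit_borel"
      and \<Omega> = simple_point_measures and A = "\<lambda>_. simple_point_measures"])
  have "void_event A \<inter> void_event B = void_event (A \<union> B)"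
    if "A \<in> sets unit_borel" "B \<in> sets unit_borel" for A B
  proof -
    have "emeasure \<nu> (A \<union> B) = 0 \<longleftrightarrow> emeasure \<nu> A = 0 \<and> emeasure \<nu> B = 0"
      if "\<nu> \<in> simple_point_measures" for \<nu>
      using that \<open>A \<in> _\<close> \<open>B \<in> _\<close> finite_points[OF that]
      by (auto simp: emeasure_eq_card_points)
    then show ?thesis by auto
  qed
  note Int = this
  show "Int_stable (void_event ` sets unit_borel)"
  proof (rule Int_stableI)
    fix S T assume "S \<in> void_event ` sets unit_borel" "T \<in> void_event ` sets unit_borel"
    then obtain A B where AB: "A \<in> sets unit_borel" "S = void_event A" "B \<in> sets unit_borel" "T = void_event B"
      by (elim imageE)
    show "S \<inter> T \<in> void_event ` sets unit_borel"
      unfolding AB(2,4) Int[OF AB(1,3)] by (intro imageI sets.Un AB)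
  qed
  \<comment> \<open>The empty set is avoided by every configuration, so the whole space is itself a
    void event.\<close>
  show "range (\<lambda>_. simple_point_measures) \<subseteq> void_event ` sets unit_borel"
    by (auto intro!: image_eqI[of _ _ "{}"])
  show "emeasure P simple_point_measures \<noteq> \<infinity>" for i :: nat
    using assms(3) by (simp add: finite_measure.emeasure_finite)
qed (use assms sets_spm_algebra in auto)

section \<open>Binomial and Poisson processes\<close>

text \<open>Half-open, so that dyadic cells tile the space exactly and \<open>frac\<close> takes its
  values there; the missing end point 1 of the unit interval is null.\<close>

definition uni :: "real measure" where
  "uni = restrict_space lborel {0..<1}"

abbreviation cube :: "nat \<Rightarrow> (nat \<Rightarrow> real) measure" where
  "cube n \<equiv> PiM {..<n} (\<lambda>_. uni)"

lemma space_uni: "space uni = {0..<1}"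
  by (simp add: uni_def space_restrict_space)

lemma sets_uni_iff: "A \<in> sets uni \<longleftrightarrow> A \<in> sets borel \<and> A \<subseteq> {0..<1}"
  unfolding uni_def by (subst sets_restrict_space_iff) auto

lemma emeasure_uni: "A \<subseteq> {0..<1} \<Longrightarrow> emeasure uni A = emeasure lborel A"
  unfolding uni_def by (subst emeasure_restrict_space) auto

lemma prob_space_uni: "prob_space uni"
  by (intro prob_spaceI) (simp add: space_uni emeasure_uni)

interpretation uni: prob_space uni
  by (rule prob_space_uni)

interpretation unis: product_prob_space "\<lambda>_. uni" I for I :: "nat set"
  by unfold_locales

lemma prob_space_cube: "prob_space (cube n)"
  by (rule prob_space_PiM) (rule prob_space_uni)

lemma measurable_uni_borel [measurable]: "(\<lambda>x. x) \<in> measurable uni borel"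
  unfolding uni_def by (intro measurable_restrict_space1) simp

lemma cube_component [measurable]: "i \<in> I \<Longrightarrow> (\<lambda>x. x i) \<in> borel_measurable (PiM I (\<lambda>_. uni))"
  by (rule measurable_compose[OF measurable_component_singleton[of i I] measurable_uni_borel])

lemma space_cubeD: "x \<in> space (cube n) \<Longrightarrow> i < n \<Longrightarrow> x i \<in> {0..<1}"
  by (auto simp: space_PiM space_uni PiE_def Pi_def)

lemma emeasure_uni_unit:
  assumes "A \<in> sets unit_borel"
  shows "emeasure uni ({0..<1} \<inter> A) = ennreal (measure lborel A)"
    and "{0..<1} \<inter> A \<in> sets uni"
proof -
  have A: "A \<in> sets borel" "A \<subseteq> {0..1}"
    using assms by (auto simp: sets_unit_borel_iff)
  show "{0..<1} \<inter> A \<in> sets uni"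
    using A by (auto simp: sets_uni_iff)
  have "emeasure lborel A \<le> emeasure lborel {0..1::real}"
    using A by (intro emeasure_mono) auto
  then have fin: "emeasure lborel A \<noteq> \<infinity>"
    by (auto simp: top_unique)
  have "AE x in lborel. x \<in> {0..<1} \<inter> A \<longleftrightarrow> x \<in> A"
    using AE_lborel_singleton[of "1::real"] by eventually_elim (use A in force)
  then have "emeasure lborel ({0..<1} \<inter> A) = emeasure lborel A"
    using A by (intro emeasure_eq_AE) auto
  then have "emeasure uni ({0..<1} \<inter> A) = emeasure lborel A"
    by (subst emeasure_uni) auto
  also have "\<dots> = ennreal (measure lborel A)"
    using fin by (intro emeasure_eq_ennreal_measure) auto
  finally show "emeasure uni ({0..<1} \<inter> A) = ennreal (measure lborel A)" .
qed

lemma measure_unit_le_1: "A \<in> sets unit_borel \<Longrightarrow> measure lborel A \<le> 1"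
  using emeasure_uni_unit(1)[of A] uni.emeasure_le_1[of "{0..<1} \<inter> A"] by simp

lemma emeasure_PiM_uni_box:
  fixes I :: "nat set"
  assumes "finite I" "\<And>i. i \<in> I \<Longrightarrow> A i \<in> sets uni"
  shows "emeasure (PiM I (\<lambda>_. uni)) (PiE I A) = (\<Prod>i\<in>I. emeasure uni (A i))"
  using assms by (rule unis.emeasure_PiM)

text \<open>Fubini in a single coordinate: fix all the others and measure the section.\<close>

lemma emeasure_cube_section:
  fixes I :: "nat set"
  assumes "finite I" "i \<in> I" and E: "E \<in> sets (PiM I (\<lambda>_. uni))"
  shows "emeasure (PiM I (\<lambda>_. uni)) E =
    (\<integral>\<^sup>+ y. emeasure uni {t \<in> space uni. y(i := t) \<in> E} \<partial>PiM (I - {i}) (\<lambda>_. uni))"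
proof -
  have I: "insert i (I - {i}) = I" using assms by auto
  have "emeasure (PiM I (\<lambda>_. uni)) E = (\<integral>\<^sup>+ x. indicator E x \<partial>PiM (insert i (I - {i})) (\<lambda>_. uni))"
    using E unfolding I by (rule nn_integral_indicator[symmetric])
  also have "\<dots> = (\<integral>\<^sup>+ y. \<integral>\<^sup>+ t. indicator E (y(i := t)) \<partial>uni \<partial>PiM (I - {i}) (\<lambda>_. uni))"
    using assms by (intro unis.product_nn_integral_insert) (auto simp: insert_absorb)
  also have "\<dots> = (\<integral>\<^sup>+ y. emeasure uni {t \<in> space uni. y(i := t) \<in> E} \<partial>PiM (I - {i}) (\<lambda>_. uni))"
  proof (intro nn_integral_cong)
    fix y assume y: "y \<in> space (PiM (I - {i}) (\<lambda>_. uni))"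
    have "(\<lambda>t. y(i := t)) \<in> measurable uni (PiM (insert i (I - {i})) (\<lambda>_. uni))"
      using y by (intro measurable_fun_upd[where J = "I - {i}"]) auto
    then have "(\<lambda>t. y(i := t)) -` E \<inter> space uni \<in> sets uni"
      using E by (intro measurable_sets) (auto simp: insert_absorb assms(2))
    then have "{t \<in> space uni. y(i := t) \<in> E} \<in> sets uni"
      by (simp add: vimage_def Int_def conj_commute)
    moreover have "(\<integral>\<^sup>+ t. indicator E (y(i := t)) \<partial>uni) = (\<integral>\<^sup>+ t. indicator {t \<in> space uni. y(i := t) \<in> E} t \<partial>uni)"
      by (intro nn_integral_cong) (auto simp: indicator_def)
    ultimately show "(\<integral>\<^sup>+ t. indicator E (y(i := t)) \<partial>uni) = emeasure uni {t \<in> space uni. y(i := t) \<in> E}"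
      by simp
  qed
  finally show ?thesis .
qed

text \<open>With all coordinates but the i-th fixed, a coincidence with the j-th leaves at most one
  value for x i, so each of the finitely many coincidence events is null.\<close>

lemma AE_cube_inj: "AE x in cube n. inj_on x {..<n}"
proof -
  have "AE x in cube n. x i \<noteq> x j" if "i < n" "j < n" "i \<noteq> j" for i j
  proof -
    let ?E = "{x \<in> space (cube n). x i = x j}"
    have E: "?E \<in> sets (cube n)"
      using that by (intro borel_measurable_eq cube_component) auto
    have "emeasure (cube n) ?E = (\<integral>\<^sup>+ y. emeasure uni {t \<in> space uni. y(i := t) \<in> ?E} \<partial>PiM ({..<n} - {i}) (\<lambda>_. uni))"
      using that E by (intro emeasure_cube_section) auto
    also have "\<dots> = (\<integral>\<^sup>+ y. 0 \<partial>PiM ({..<n} - {i}) (\<lambda>_. uni))"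
    proof (intro nn_integral_cong)
      fix y :: "nat \<Rightarrow> real"
      let ?S = "{t \<in> space uni. y(i := t) \<in> ?E}"
      have "emeasure uni ?S = emeasure lborel ?S"
        by (intro emeasure_uni) (auto simp: space_uni)
      also have "\<dots> \<le> emeasure lborel {y j}"
        using that by (intro emeasure_mono) auto
      finally show "emeasure uni ?S = 0"
        by simp
    qed
    finally have "emeasure (cube n) ?E = 0"
      by simp
    then show ?thesis
      using E by (rule AE_I[rotated]) blast
  qed
  then have "AE x in cube n. \<forall>i\<in>{..<n}. \<forall>j\<in>{..<n}. i \<noteq> j \<longrightarrow> x i \<noteq> x j"
    by (intro AE_finite_allI) auto
  then show ?thesis
    by eventually_elim (auto simp: inj_on_def)
qed

text \<open>Forgets the labels. Coinciding coordinates collapse to one point, so the result is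
  simple for every x in the cube and has n points for almost every x.\<close>

definition conf :: "nat \<Rightarrow> (nat \<Rightarrow> real) \<Rightarrow> real measure" where
  "conf n x = pm (x ` {..<n})"

lemma conf_facts:
  assumes "x \<in> space (cube n)"
  shows "finite (x ` {..<n})" "x ` {..<n} \<subseteq> {0..1}"
  using space_cubeD[OF assms] by fastforce+

lemma conf_in_simple_point_measures: "x \<in> space (cube n) \<Longrightarrow> conf n x \<in> simple_point_measures"
  unfolding conf_def by (intro pm_in_simple_point_measures conf_facts)

lemma points_conf: "x \<in> space (cube n) \<Longrightarrow> points (conf n x) = x ` {..<n}"
  unfolding conf_def by (intro points_pm conf_facts)

lemma emeasure_conf:
  "x \<in> space (cube n) \<Longrightarrow> A \<in> sets unit_borel \<Longrightarrow> emeasure (conf n x) A = of_nat (card (x ` {..<n} \<inter> A))"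
  unfolding conf_def by (intro emeasure_pm conf_facts)

lemma measurable_conf [measurable]: "conf n \<in> measurable (cube n) spm_algebra"
proof (rule measurable_spm_algebraI)
  fix A assume A: "A \<in> sets unit_borel"
  have A': "A \<in> sets borel"
    using A by (simp add: sets_unit_borel_iff)
  \<comment> \<open>A point is counted at its first label only; this gives the count for every x,
    ties included, as a sum of measurable indicators.\<close>
  have "card (x ` {..<k} \<inter> A) = (\<Sum>i<k. if x i \<in> A \<and> (\<forall>j\<in>{..<i}. x j \<noteq> x i) then 1 else 0)" for x :: "nat \<Rightarrow> real" and k
  proof (induction k)
    case (Suc k)
    have "x ` {..<Suc k} \<inter> A = (if x k \<in> A then insert (x k) (x ` {..<k} \<inter> A) else x ` {..<k} \<inter> A)"
      by (auto simp: lessThan_Suc)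
    moreover have "x k \<in> x ` {..<k} \<longleftrightarrow> \<not> (\<forall>j\<in>{..<k}. x j \<noteq> x k)"
      by (auto simp: image_iff eq_commute)
    ultimately show ?case
      using Suc by (auto simp: card_insert_if)
  qed simp
  then have 1: "emeasure (conf n x) A = (\<Sum>i<n. if x i \<in> A \<and> (\<forall>j\<in>{..<i}. x j \<noteq> x i) then 1 else 0)"
    if "x \<in> space (cube n)" for x
    using that A by (simp add: emeasure_conf if_distrib[of of_nat] cong: if_cong)
  have 2: "(\<lambda>x. \<Sum>i<n. if x i \<in> A \<and> (\<forall>j\<in>{..<i}. x j \<noteq> x i) then 1 else 0 :: ennreal) \<in> borel_measurable (cube n)"
  proof -
    have "{x \<in> space (cube n). x i \<in> A \<and> (\<forall>j\<in>{..<i}. x j \<noteq> x i)} \<in> sets (cube n)" if "i < n" for i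
    proof (intro sets.sets_Collect_conj sets.sets_Collect_finite_All)
      have "(\<lambda>x. x i) -` A \<inter> space (cube n) \<in> sets (cube n)"
        using A' that by (intro measurable_sets[OF cube_component]) auto
      then show "{x \<in> space (cube n). x i \<in> A} \<in> sets (cube n)"
        by (simp add: vimage_def Int_def conj_commute)
      show "{x \<in> space (cube n). x j \<noteq> x i} \<in> sets (cube n)" if "j \<in> {..<i}" for j
        using that \<open>i < n\<close> by (intro borel_measurable_neq cube_component) auto
    qed auto
    then show ?thesis
      by (intro borel_measurable_sum measurable_If) auto
  qed
  show "(\<lambda>x. emeasure (conf n x) A) \<in> borel_measurable (cube n)"
    by (rule measurable_cong[THEN iffD2, OF 1 2])
qed (rule conf_in_simple_point_measures)

definition binomial_process :: "nat \<Rightarrow> real measure measure" where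
  "binomial_process n = distr (cube n) spm_algebra (conf n)"

lemma sets_binomial_process [simp, measurable_cong]: "sets (binomial_process n) = sets spm_algebra"
  by (simp add: binomial_process_def)

lemma prob_space_binomial_process: "prob_space (binomial_process n)"
  unfolding binomial_process_def
  by (intro prob_space.prob_space_distr prob_space_cube measurable_conf)

lemma emeasure_binomial_process:
  assumes "E \<in> sets spm_algebra"
  shows "emeasure (binomial_process n) E = emeasure (cube n) {x \<in> space (cube n). conf n x \<in> E}"
  unfolding binomial_process_def using assms
  by (subst emeasure_distr) (auto intro!: arg_cong[where f = "emeasure (cube n)"])

text \<open>The event is a box in which each label of T contributes the factor 1 - |A|. The full
  index set gives the void probabilities of \<open>binomial_process\<close>; proper subsets enter in
  \<open>sum_avoid_ranks\<close>.\<close>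

lemma emeasure_cube_avoid:
  assumes A: "A \<in> sets unit_borel" and T: "T \<subseteq> {..<n}"
  shows "emeasure (cube n) {x \<in> space (cube n). \<forall>i\<in>T. x i \<notin> A} = ennreal ((1 - measure lborel A) ^ card T)"
proof -
  let ?B = "\<lambda>i. if i \<in> T then space uni - {0..<1} \<inter> A else space uni"
  have fin: "finite T" using T finite_subset by auto
  have "{x \<in> space (cube n). \<forall>i\<in>T. x i \<notin> A} = PiE {..<n} ?B"
    using T by (auto simp: space_PiM PiE_def Pi_def space_uni split: if_splits)
  then have "emeasure (cube n) {x \<in> space (cube n). \<forall>i\<in>T. x i \<notin> A} = (\<Prod>i<n. emeasure uni (?B i))"
    using emeasure_uni_unit(2)[OF A] by (simp only:) (intro emeasure_PiM_uni_box, auto)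
  also have "\<dots> = (\<Prod>i<n. if i \<in> T then ennreal (1 - measure lborel A) else 1)"
  proof (intro prod.cong refl)
    fix i
    have "emeasure uni (space uni - {0..<1} \<inter> A) = emeasure uni (space uni) - emeasure uni ({0..<1} \<inter> A)"
      using emeasure_uni_unit(2)[OF A] by (intro emeasure_compl) auto
    then show "emeasure uni (?B i) = (if i \<in> T then ennreal (1 - measure lborel A) else 1)"
      by (simp add: uni.emeasure_space_1 emeasure_uni_unit(1)[OF A] ennreal_minus flip: ennreal_1)
  qed
  also have "\<dots> = ennreal (1 - measure lborel A) ^ card T"
    using T by (simp add: prod.If_cases Int_absorb1)
  finally show ?thesis
    using measure_unit_le_1[OF A] by (simp add: ennreal_power)
qed

lemma void_event_sets: "A \<in> sets unit_borel \<Longrightarrow> void_event A \<in> sets spm_algebra"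
  by (auto simp: sets_spm_algebra)

lemma conf_void_iff:
  "x \<in> space (cube n) \<Longrightarrow> A \<in> sets unit_borel \<Longrightarrow> conf n x \<in> void_event A \<longleftrightarrow> (\<forall>i<n. x i \<notin> A)"
  by (auto simp: conf_in_simple_point_measures emeasure_conf)

lemma binomial_process_void:
  assumes A: "A \<in> sets unit_borel"
  shows "emeasure (binomial_process n) (void_event A) = ennreal ((1 - measure lborel A) ^ n)"
proof -
  have "emeasure (binomial_process n) (void_event A) =
      emeasure (cube n) {x \<in> space (cube n). \<forall>i\<in>{..<n}. x i \<notin> A}"
    unfolding emeasure_binomial_process[OF void_event_sets[OF A]]
    using A by (intro arg_cong[where f = "emeasure (cube n)"] Collect_cong conj_cong refl) (simp only: conf_void_iff, auto)
  then show ?thesis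
    using emeasure_cube_avoid[OF A, of "{..<n}" n] by simp
qed

text \<open>The mixed binomial construction of the Poisson process: a Poisson number of independent
  uniform points. Conditioning on the number of points is thus built in.\<close>

definition poisson_law :: "real \<Rightarrow> real measure measure" where
  "poisson_law l = measure_pmf (poisson_pmf l) \<bind> binomial_process"

lemma measurable_binomial_process:
  "binomial_process \<in> measurable (measure_pmf p) (subprob_algebra spm_algebra)"
  using prob_space_binomial_process
  by (auto simp: space_subprob_algebra prob_space_imp_subprob_space)

lemma sets_poisson_law [simp, measurable_cong]: "sets (poisson_law l) = sets spm_algebra"
  unfolding poisson_law_def by (rule sets_bind) auto

lemma emeasure_poisson_law:
  assumes "l > 0" "E \<in> sets spm_algebra"
  shows "emeasure (poisson_law l) E = (\<Sum>n. ennreal (pois l n) * emeasure (binomial_process n) E)"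
  unfolding poisson_law_def using assms
  by (simp add: emeasure_bind[OF _ measurable_binomial_process] nn_integral_measure_pmf
      nn_integral_count_space_nat pois_def)

lemma prob_space_poisson_law: "prob_space (poisson_law l)"
  unfolding poisson_law_def
  by (rule prob_space.prob_space_bind[OF prob_space_measure_pmf _ measurable_binomial_process])
    (simp add: prob_space_binomial_process)

text \<open>This is the generating function of the Poisson weights at 1 - a, where a is the measure
  of A: the exponent is l * (1 - a) - l = - l * a.\<close>

lemma poisson_law_void:
  assumes "l > 0" and A: "A \<in> sets unit_borel"
  shows "emeasure (poisson_law l) (void_event A) = ennreal (exp (- (l * measure lborel A)))"
proof -
  have nn: "0 \<le> pois l n * (1 - measure lborel A) ^ n" for n
    using measure_unit_le_1[OF A] assms(1) by (simp add: pois_nonneg)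
  have "(\<lambda>n. pois l n * (1 - measure lborel A) ^ n) sums (exp (- l * measure lborel A))"
  proof -
    have "(\<lambda>n. (l * (1 - measure lborel A)) ^ n /\<^sub>R fact n * exp (- l)) sums (exp (l * (1 - measure lborel A)) * exp (- l))"
      by (intro sums_mult2 exp_converges)
    moreover have "exp (l * (1 - measure lborel A)) * exp (- l) = exp (- l * measure lborel A)"
      by (simp add: algebra_simps flip: exp_add)
    moreover have "(l * (1 - measure lborel A)) ^ n /\<^sub>R fact n * exp (- l) = pois l n * (1 - measure lborel A) ^ n" for n
      by (simp add: pois_def power_mult_distrib divide_inverse)
    ultimately show ?thesis
      by (simp only:)
  qed
  then have "(\<Sum>n. ennreal (pois l n * (1 - measure lborel A) ^ n)) = ennreal (exp (- l * measure lborel A))"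
    using nn by (intro suminf_ennreal_eq)
  then show ?thesis
    using measure_unit_le_1[OF A] assms
    by (simp add: emeasure_poisson_law void_event_sets binomial_process_void ennreal_mult pois_nonneg)
qed

section \<open>Joint counts and the Poisson property of \<open>poisson_law\<close>\<close>

definition cnt :: "real set \<Rightarrow> real measure \<Rightarrow> nat" where
  "cnt A \<nu> = card (points \<nu> \<inter> A)"

lemma emeasure_eq_cnt:
  "\<nu> \<in> simple_point_measures \<Longrightarrow> A \<in> sets unit_borel \<Longrightarrow> emeasure \<nu> A = of_nat (cnt A \<nu>)"
  unfolding cnt_def by (rule emeasure_eq_card_points)

lemma measurable_cnt:
  assumes A: "A \<in> sets unit_borel"
  shows "cnt A \<in> measurable spm_algebra (count_space UNIV)"
proof (subst measurable_count_space_eq2_countable, intro conjI ballI)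
  fix k :: nat
  have "(\<lambda>\<nu>. emeasure \<nu> A) -` {of_nat k} \<inter> space spm_algebra \<in> sets spm_algebra"
    by (intro measurable_sets[OF measurable_emeasure_spm_algebra[OF A]]) auto
  moreover have "(\<lambda>\<nu>. emeasure \<nu> A) -` {of_nat k} \<inter> space spm_algebra = cnt A -` {k} \<inter> space spm_algebra"
    using A by (auto simp: space_spm_algebra emeasure_eq_cnt)
  ultimately show "cnt A -` {k} \<inter> space spm_algebra \<in> sets spm_algebra"
    by simp
qed auto

lemma cnt_sets: "A \<in> sets unit_borel \<Longrightarrow> {\<nu> \<in> simple_point_measures. P (cnt A \<nu>)} \<in> sets spm_algebra"
  using measurable_sets[OF measurable_cnt, of A "{k. P k}"]
  by (simp add: vimage_def Int_def conj_commute space_spm_algebra)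

lemma counts_sets:
  assumes "finite I" "\<And>i. i \<in> I \<Longrightarrow> A i \<in> sets unit_borel"
  shows "{\<nu> \<in> simple_point_measures. \<forall>i\<in>I. cnt (A i) \<nu> = k i} \<in> sets spm_algebra"
proof -
  have "{\<nu> \<in> space spm_algebra. \<forall>i\<in>I. cnt (A i) \<nu> = k i} \<in> sets spm_algebra"
    using assms cnt_sets by (intro sets.sets_Collect_finite_All) (auto simp: space_spm_algebra)
  then show ?thesis
    by (simp add: space_spm_algebra)
qed

text \<open>A configuration of labelled points is sorted by the word recording which cell each point
  falls into; words with prescribed letter counts are the permutations of a multiset.\<close>

lemma emeasure_cube_counts:
  fixes A :: "nat \<Rightarrow> real set"
  assumes I: "finite I" and disj: "disjoint_family_on A I" and A: "\<And>i. i \<in> I \<Longrightarrow> A i \<in> sets uni"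
    and cover: "(\<Union>i\<in>I. A i) = {0..<1}"
  shows "emeasure (cube n) {x \<in> space (cube n). \<forall>i\<in>I. card {j. j < n \<and> x j \<in> A i} = k i} =
    (if n = (\<Sum>i\<in>I. k i) then ennreal (fact n / (\<Prod>i\<in>I. fact (k i)) * (\<Prod>i\<in>I. measure uni (A i) ^ k i)) else 0)"
    (is "emeasure _ ?E = _")
proof -
  have uniq: "i = i'" if "i \<in> I" "i' \<in> I" "t \<in> A i" "t \<in> A i'" for i i' t
    using disj that by (auto simp: disjoint_family_on_def)
  have colour: "\<exists>i\<in>I. x j \<in> A i" if "x \<in> space (cube n)" "j < n" for x j
    using space_cubeD[OF that] cover by auto
  have sum: "(\<Sum>i\<in>I. card {j. j < n \<and> x j \<in> A i}) = n" if x: "x \<in> space (cube n)" for x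
  proof -
    have "(\<Sum>i\<in>I. card {j. j < n \<and> x j \<in> A i}) = card (\<Union>i\<in>I. {j. j < n \<and> x j \<in> A i})"
      using I uniq by (intro card_UN_disjoint[symmetric]) auto
    also have "(\<Union>i\<in>I. {j. j < n \<and> x j \<in> A i}) = {..<n}"
      using colour[OF x] by auto
    finally show ?thesis by simp
  qed
  show ?thesis
  proof (cases "n = (\<Sum>i\<in>I. k i)")
    case False
    have empty: "?E = {}"
    proof (intro equals0I)
      fix x assume "x \<in> ?E"
      then show False
        using False sum[of x] sum.cong[of I I "\<lambda>i. card {j. j < n \<and> x j \<in> A i}" k] by auto
    qed
    show ?thesis
      unfolding empty using False by simp
  next
    case True
    define M where "M = (\<Sum>i\<in>I. replicate_mset (k i) i)"
    have count_M: "count M i = (if i \<in> I then k i else 0)" for i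
      using I by (simp add: M_def count_sum)
    have size_M: "size M = n"
      by (simp add: M_def True size_multiset_sum)
    define W where "W = permutations_of_multiset M"
    have finW: "finite W"
      by (simp add: W_def)
    have W: "length xs = n" "j < n \<Longrightarrow> xs ! j \<in> I" "i \<in> I \<Longrightarrow> card {j. j < n \<and> xs ! j = i} = k i"
      if "xs \<in> W" for xs i j
    proof -
      have xs: "mset xs = M"
        using that by (simp add: W_def permutations_of_multiset_def)
      show len: "length xs = n"
        using size_M by (simp flip: xs)
      show "xs ! j \<in> I" if "j < n"
      proof -
        have "xs ! j \<in># M"
          using that len by (simp flip: xs)
        then show ?thesis
          using count_M[of "xs ! j"] by (metis count_eq_zero_iff)
      qed
      show "card {j. j < n \<and> xs ! j = i} = k i" if "i \<in> I"
      proof -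
        have "card {j. j < n \<and> xs ! j = i} = count (mset xs) i"
          unfolding count_mset count_list_eq_length_filter length_filter_conv_card len
          by (rule arg_cong[where f = card]) auto
        then show ?thesis
          using that by (simp add: xs count_M)
      qed
    qed
    define B where "B = (\<lambda>xs. PiE {..<n} (\<lambda>j. A (xs ! j)))"
    have B_sets: "B xs \<in> sets (cube n)" if "xs \<in> W" for xs
      unfolding B_def using that W A by (intro sets_PiM_I_finite) auto
    have "?E = (\<Union>xs\<in>W. B xs)"
    proof (intro set_eqI iffI)
      fix x assume "x \<in> ?E"
      then have x: "x \<in> space (cube n)" and c: "\<And>i. i \<in> I \<Longrightarrow> card {j. j < n \<and> x j \<in> A i} = k i"
        by auto
      obtain g where g: "\<And>j. j < n \<Longrightarrow> g j \<in> I \<and> x j \<in> A (g j)"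
        using colour[OF x] by metis
      define xs where "xs = map g [0..<n]"
      have "count (mset xs) i = count M i" for i
      proof -
        have "count (mset xs) i = card {j. j < n \<and> g j = i}"
          unfolding count_mset count_list_eq_length_filter length_filter_conv_card
          by (rule arg_cong[where f = card]) (auto simp: xs_def)
        also have "\<dots> = (if i \<in> I then card {j. j < n \<and> x j \<in> A i} else 0)"
          using g uniq by (auto intro!: arg_cong[where f = card])
        finally show ?thesis
          using c by (simp add: count_M)
      qed
      then have "xs \<in> W"
        by (simp add: W_def permutations_of_multiset_def multiset_eq_iff)
      moreover have "x \<in> B xs"
        using x g by (auto simp: B_def xs_def space_PiM PiE_def)
      ultimately show "x \<in> (\<Union>xs\<in>W. B xs)"
        by auto
    next
      fix x assume "x \<in> (\<Union>xs\<in>W. B xs)"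
      then obtain xs where xs: "xs \<in> W" "x \<in> B xs"
        by auto
      have x: "x \<in> space (cube n)"
        using sets.sets_into_space[OF B_sets[OF xs(1)]] xs(2) by auto
      have "{j. j < n \<and> x j \<in> A i} = {j. j < n \<and> xs ! j = i}" if "i \<in> I" for i
        using xs(2) uniq that W[OF xs(1)] by (fastforce simp: B_def PiE_def Pi_def)
      then show "x \<in> ?E"
        using x W[OF xs(1)] by simp
    qed
    also have "emeasure (cube n) (\<Union>xs\<in>W. B xs) = (\<Sum>xs\<in>W. emeasure (cube n) (B xs))"
    proof (rule sum_emeasure[symmetric, OF _ _ finW])
      show "disjoint_family_on B W"
        unfolding disjoint_family_on_def
      proof (intro ballI impI)
        fix xs ys assume xy: "xs \<in> W" "ys \<in> W" "xs \<noteq> ys"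
        then obtain j where "j < n" "xs ! j \<noteq> ys ! j"
          using W(1) nth_equalityI[of xs ys] by metis
        then show "B xs \<inter> B ys = {}"
          using uniq W(2)[OF xy(1)] W(2)[OF xy(2)] by (force simp: B_def PiE_def Pi_def)
      qed
    qed (use B_sets in auto)
    also have "\<dots> = (\<Sum>xs\<in>W. ennreal (\<Prod>i\<in>I. measure uni (A i) ^ k i))"
    proof (intro sum.cong refl)
      fix xs assume xs: "xs \<in> W"
      have "emeasure (cube n) (B xs) = (\<Prod>j<n. emeasure uni (A (xs ! j)))"
        unfolding B_def using W[OF xs] A by (intro emeasure_PiM_uni_box) auto
      also have "\<dots> = ennreal (\<Prod>j<n. measure uni (A (xs ! j)))"
        by (simp add: uni.emeasure_eq_measure prod_ennreal)
      also have "(\<Prod>j<n. measure uni (A (xs ! j))) =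
          (\<Prod>i\<in>I. \<Prod>j\<in>{j. j \<in> {..<n} \<and> xs ! j = i}. measure uni (A (xs ! j)))"
        using I W(2)[OF xs] by (intro prod.group[symmetric]) auto
      also have "\<dots> = (\<Prod>i\<in>I. measure uni (A i) ^ k i)"
        using W(3)[OF xs] by (intro prod.cong refl) simp
      finally show "emeasure (cube n) (B xs) = ennreal (\<Prod>i\<in>I. measure uni (A i) ^ k i)" .
    qed
    also have "\<dots> = ennreal (real (card W) * (\<Prod>i\<in>I. measure uni (A i) ^ k i))"
      by (simp add: ennreal_mult prod_nonneg ennreal_of_nat_eq_real_of_nat)
    also have "real (card W) = fact n / (\<Prod>i\<in>I. fact (k i))"
    proof -
      have "(\<Prod>i\<in>set_mset M. fact (count M i)) = (\<Prod>i\<in>I. fact (k i) :: nat)"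
        using I by (intro prod.mono_neutral_cong_left)
          (auto simp: count_M set_mset_def split: if_splits intro!: gr0I)
      then have "card W * (\<Prod>i\<in>I. fact (k i)) = fact n"
        using card_permutations_of_multiset_aux[of M] by (simp add: W_def size_M)
      then have "real (card W) * real (\<Prod>i\<in>I. fact (k i)) = fact n"
        by (metis of_nat_fact of_nat_mult)
      then show ?thesis
        using I by (simp add: nonzero_eq_divide_eq)
    qed
    finally show ?thesis
      using True by simp
  qed
qed

text \<open>Without ties, points correspond to labels. The exceptional null set is the same for all
  A.\<close>

lemma AE_conf_cnt:
  "AE x in cube n. \<forall>A\<in>sets unit_borel. cnt A (conf n x) = card {j. j < n \<and> x j \<in> {0..<1} \<inter> A}"
  using AE_cube_inj AE_space
proof eventually_elim
  case (elim x)
  have "cnt A (conf n x) = card (x ` {j. j < n \<and> x j \<in> {0..<1} \<inter> A})" for A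
    using space_cubeD[OF elim(2)] by (auto simp: cnt_def points_conf[OF elim(2)] intro!: arg_cong[where f = card])
  also have "\<dots> A = card {j. j < n \<and> x j \<in> {0..<1} \<inter> A}" for A
    by (intro card_image inj_on_subset[OF elim(1)]) auto
  finally show ?case by simp
qed

text \<open>As the cells cover the interval, the counts fix the number N of points and a single term
  of the mixture survives. Its N! cancels against the multinomial coefficient, and exp (- l) factors
  over the cells because their measures add up to 1.\<close>

lemma poisson_law_counts_partition:
  fixes A :: "nat \<Rightarrow> real set"
  assumes l: "l > 0" and I: "finite I" and disj: "disjoint_family_on A I"
    and A: "\<And>i. i \<in> I \<Longrightarrow> A i \<in> sets unit_borel" and cover: "(\<Union>i\<in>I. A i) = {0..1}"
  shows "emeasure (poisson_law l) {\<nu> \<in> simple_point_measures. \<forall>i\<in>I. cnt (A i) \<nu> = k i} =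
    ennreal (\<Prod>i\<in>I. pois (l * measure lborel (A i)) (k i))"
proof -
  let ?E = "{\<nu> \<in> simple_point_measures. \<forall>i\<in>I. cnt (A i) \<nu> = k i}"
  define a where "a = (\<lambda>i. measure lborel (A i))"
  define B where "B = (\<lambda>i. {0..<1} \<inter> A i)"
  define N where "N = (\<Sum>i\<in>I. k i)"
  have E: "?E \<in> sets spm_algebra"
    using I A by (rule counts_sets)
  have B: "B i \<in> sets uni" "measure uni (B i) = a i" if "i \<in> I" for i
    using emeasure_uni_unit[OF A[OF that]] by (auto simp: B_def a_def measure_def)
  have disjB: "disjoint_family_on B I"
    using disj by (auto simp: disjoint_family_on_def B_def)
  have coverB: "(\<Union>i\<in>I. B i) = {0..<1}"
    using cover by (auto simp: B_def)
  have bin: "emeasure (binomial_process n) ?E =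
      (if n = N then ennreal (fact n / (\<Prod>i\<in>I. fact (k i)) * (\<Prod>i\<in>I. a i ^ k i)) else 0)" for n
  proof -
    have "emeasure (binomial_process n) ?E = emeasure (cube n) {x \<in> space (cube n). conf n x \<in> ?E}"
      using E by (rule emeasure_binomial_process)
    also have "\<dots> = emeasure (cube n) {x \<in> space (cube n). \<forall>i\<in>I. card {j. j < n \<and> x j \<in> B i} = k i}"
    proof (rule emeasure_eq_AE)
      show "AE x in cube n. x \<in> {x \<in> space (cube n). conf n x \<in> ?E} \<longleftrightarrow>
          x \<in> {x \<in> space (cube n). \<forall>i\<in>I. card {j. j < n \<and> x j \<in> B i} = k i}"
        using AE_conf_cnt AE_space
        by eventually_elim (use A in \<open>simp add: conf_in_simple_point_measures B_def\<close>)
      show "{x \<in> space (cube n). conf n x \<in> ?E} \<in> sets (cube n)"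
        using measurable_sets[OF measurable_conf E] by (simp add: vimage_def Int_def conj_commute)
      have cm: "(\<lambda>x. card {j. j < n \<and> x j \<in> B i}) \<in> measurable (cube n) (count_space UNIV)" if "i \<in> I" for i
      proof -
        have "card {j. j < n \<and> x j \<in> B i} = (\<Sum>j<n. if x j \<in> B i then 1 else 0)" for x :: "nat \<Rightarrow> real"
          by (simp add: sum.If_cases Int_def)
        moreover have "{x \<in> space (cube n). x j \<in> B i} \<in> sets (cube n)" if "j \<in> {..<n}" for j
          using measurable_sets[OF measurable_component_singleton[of j "{..<n}" "\<lambda>_. uni"] B(1)[OF \<open>i \<in> I\<close>]] that
          by (simp add: vimage_def Int_def conj_commute)
        ultimately show ?thesis
          by (simp only:) (intro measurable_sum_nat measurable_If, auto)
      qed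
      have "{x \<in> space (cube n). card {j. j < n \<and> x j \<in> B i} = k i} \<in> sets (cube n)" if "i \<in> I" for i
      proof -
        have "(\<lambda>x. card {j. j < n \<and> x j \<in> B i}) -` {k i} \<inter> space (cube n) \<in> sets (cube n)"
          by (rule measurable_sets[OF cm[OF that]]) simp
        then show ?thesis
          by (simp only: vimage_def Int_def mem_Collect_eq singleton_iff conj_commute)
      qed
      then show "{x \<in> space (cube n). \<forall>i\<in>I. card {j. j < n \<and> x j \<in> B i} = k i} \<in> sets (cube n)"
        using I by (intro sets.sets_Collect_finite_All)
    qed
    also have "\<dots> = (if n = N then ennreal (fact n / (\<Prod>i\<in>I. fact (k i)) * (\<Prod>i\<in>I. a i ^ k i)) else 0)"
      using emeasure_cube_counts[OF I disjB B(1) coverB, of n k] B(2) by (simp add: N_def cong: prod.cong)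
    finally show ?thesis .
  qed
  have a_nonneg: "a i \<ge> 0" for i
    by (simp add: a_def)
  have a_sum: "(\<Sum>i\<in>I. a i) = 1"
  proof -
    have "(\<Sum>i\<in>I. measure uni (B i)) = measure uni (\<Union>i\<in>I. B i)"
      using I B(1) disjB by (intro uni.finite_measure_finite_Union[symmetric]) auto
    then show ?thesis
      using B(2) uni.prob_space by (simp add: coverB space_uni)
  qed
  have "emeasure (poisson_law l) ?E = (\<Sum>n. ennreal (pois l n) * emeasure (binomial_process n) ?E)"
    using l E by (rule emeasure_poisson_law)
  also have "\<dots> = (\<Sum>n\<in>{N}. ennreal (pois l n) * emeasure (binomial_process n) ?E)"
    by (intro suminf_finite) (auto simp: bin)
  also have "\<dots> = ennreal (pois l N * (fact N / (\<Prod>i\<in>I. fact (k i)) * (\<Prod>i\<in>I. a i ^ k i)))"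
  proof -
    have "ennreal (pois l N) * ennreal X = ennreal (pois l N * X)" for X
      using l by (intro ennreal_mult'[symmetric] pois_nonneg) simp
    then show ?thesis
      unfolding bin by (simp only: sum.insert sum.empty finite.emptyI empty_iff simp_thms if_True add_0_right)
  qed
  also have "pois l N * (fact N / (\<Prod>i\<in>I. fact (k i)) * (\<Prod>i\<in>I. a i ^ k i)) =
      l ^ N * exp (- l) * (\<Prod>i\<in>I. a i ^ k i) / (\<Prod>i\<in>I. fact (k i))"
    by (simp add: pois_def)
  also have "\<dots> = (\<Prod>i\<in>I. pois (l * a i) (k i))"
  proof -
    have "(\<Prod>i\<in>I. exp (- (l * a i))) = exp (\<Sum>i\<in>I. - (l * a i))"
      using I by (simp add: exp_sum)
    also have "(\<Sum>i\<in>I. - (l * a i)) = - l"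
      using a_sum by (simp add: sum_negf flip: sum_distrib_left)
    finally show ?thesis
      by (simp add: pois_def prod.distrib prod_dividef power_mult_distrib N_def power_sum)
  qed
  finally show ?thesis
    by (simp add: a_def)
qed

text \<open>The complement joins the family as one more cell under a fresh index, and its count r is
  summed out; the weights of r add up to 1.\<close>

lemma poisson_law_counts:
  fixes A :: "nat \<Rightarrow> real set"
  assumes l: "l > 0" and I: "finite I" and disj: "disjoint_family_on A I"
    and A: "\<And>i. i \<in> I \<Longrightarrow> A i \<in> sets unit_borel"
  shows "emeasure (poisson_law l) {\<nu> \<in> simple_point_measures. \<forall>i\<in>I. cnt (A i) \<nu> = k i} =
    ennreal (\<Prod>i\<in>I. pois (l * measure lborel (A i)) (k i))"
proof -
  obtain i0 where i0: "i0 \<notin> I"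
    using ex_new_if_finite[OF infinite_UNIV_nat I] by auto
  define A' where "A' = A(i0 := {0..1} - (\<Union>i\<in>I. A i))"
  define b where "b = l * measure lborel (A' i0)"
  define c where "c = (\<Prod>i\<in>I. pois (l * measure lborel (A i)) (k i))"
  have A'I: "A' i = A i" if "i \<in> I" for i
    using that i0 by (auto simp: A'_def)
  have sub: "A i \<subseteq> {0..1}" if "i \<in> I" for i
    using A[OF that] by (simp add: sets_unit_borel_iff)
  have "A' i0 \<in> sets unit_borel"
    using A I unfolding A'_def fun_upd_same by (intro sets.Diff sets.finite_UN) auto
  then have A': "A' i \<in> sets unit_borel" if "i \<in> insert i0 I" for i
    using that A A'I by auto
  have disj': "disjoint_family_on A' (insert i0 I)"
    using disj i0 A'I by (auto simp: disjoint_family_on_def) (auto simp: A'_def)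
  have cover: "(\<Union>i\<in>insert i0 I. A' i) = {0..1}"
  proof -
    have "(\<Union>i\<in>insert i0 I. A' i) = A' i0 \<union> (\<Union>i\<in>I. A i)"
      using A'I by simp
    also have "A' i0 = {0..1} - (\<Union>i\<in>I. A i)"
      by (simp add: A'_def)
    finally show ?thesis
      using sub by blast
  qed
  let ?E = "{\<nu> \<in> simple_point_measures. \<forall>i\<in>I. cnt (A i) \<nu> = k i}"
  let ?F = "\<lambda>r. {\<nu> \<in> simple_point_measures. \<forall>i\<in>insert i0 I. cnt (A' i) \<nu> = (k(i0 := r)) i}"
  have "?E = (\<Union>r. ?F r)"
    using i0 A'I by auto
  also have "emeasure (poisson_law l) (\<Union>r. ?F r) = (\<Sum>r. emeasure (poisson_law l) (?F r))"
  proof (rule suminf_emeasure[symmetric])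
    have "?F r \<in> sets (poisson_law l)" for r
      unfolding sets_poisson_law using I A' by (intro counts_sets) auto
    then show "range ?F \<subseteq> sets (poisson_law l)"
      by blast
    show "disjoint_family ?F"
      by (auto simp: disjoint_family_on_def)
  qed
  also have "\<dots> = (\<Sum>r. ennreal (pois b r * c))"
  proof (intro suminf_cong)
    fix r
    have "emeasure (poisson_law l) (?F r) = ennreal (\<Prod>i\<in>insert i0 I. pois (l * measure lborel (A' i)) ((k(i0 := r)) i))"
      using l I disj' A' cover by (intro poisson_law_counts_partition) auto
    also have "(\<Prod>i\<in>insert i0 I. pois (l * measure lborel (A' i)) ((k(i0 := r)) i)) =
        pois b r * (\<Prod>i\<in>I. pois (l * measure lborel (A' i)) ((k(i0 := r)) i))"
      using I i0 by (simp add: b_def)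
    also have "(\<Prod>i\<in>I. pois (l * measure lborel (A' i)) ((k(i0 := r)) i)) = c"
      unfolding c_def using i0 A'I by (intro prod.cong) auto
    finally show "emeasure (poisson_law l) (?F r) = ennreal (pois b r * c)" .
  qed
  also have "\<dots> = ennreal c"
  proof (rule suminf_ennreal_eq)
    have "b \<ge> 0" using l by (simp add: b_def)
    moreover have "c \<ge> 0" using l by (auto simp: c_def intro!: prod_nonneg pois_nonneg)
    ultimately show "0 \<le> pois b r * c" for r
      by (simp add: pois_nonneg)
    show "(\<lambda>r. pois b r * c) sums c"
      using sums_mult2[OF pois_sums[of b], of c] by simp
  qed
  finally show ?thesis
    by (simp add: c_def)
qed

lemma poisson_process_poisson_law:
  assumes l: "l > 0"
  shows "poisson_process (poisson_law l) l (\<lambda>\<nu>. \<nu>)"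
proof -
  interpret P: prob_space "poisson_law l"
    by (rule prob_space_poisson_law)
  have space: "space (poisson_law l) = simple_point_measures"
    using sets_eq_imp_space_eq[OF sets_poisson_law] by (simp add: space_spm_algebra)
  have cnts: "P.prob {\<nu> \<in> simple_point_measures. \<forall>i\<in>I. cnt (A i) \<nu> = k i} =
      (\<Prod>i\<in>I. pois (l * measure lborel (A i)) (k i))"
    if "finite I" "disjoint_family_on A I" "\<And>i. i \<in> I \<Longrightarrow> A i \<in> sets unit_borel"
    for I :: "nat set" and A k
    using poisson_law_counts[OF l that, of k] l
    by (simp add: measure_def prod_nonneg pois_nonneg)
  have cnt1: "P.prob {\<nu> \<in> simple_point_measures. cnt A \<nu> = k} = pois (l * measure lborel A) k"
    if "A \<in> sets unit_borel" for A k
    using cnts[of "{0}" "\<lambda>_. A" "\<lambda>_. k"] that by (simp add: disjoint_family_on_def)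
  have meas: "(\<lambda>\<nu>. \<nu>) \<in> measurable (poisson_law l) spm_algebra"
    by (rule measurable_ident_sets) simp
  have one: "P.prob {\<nu> \<in> space (poisson_law l). emeasure \<nu> A = of_nat k} =
      (l * measure lborel A) ^ k / fact k * exp (- (l * measure lborel A))"
    if A: "A \<in> sets unit_borel" for A k
  proof -
    have "{\<nu> \<in> space (poisson_law l). emeasure \<nu> A = of_nat k} = {\<nu> \<in> simple_point_measures. cnt A \<nu> = k}"
      using A by (auto simp: space emeasure_eq_cnt)
    then show ?thesis
      using cnt1[OF A] by (simp add: pois_def)
  qed
  have indep: "P.indep_vars (\<lambda>_. borel) (\<lambda>i \<nu>. emeasure \<nu> (A i)) I"
    if I: "finite I" and A: "A ` I \<subseteq> sets unit_borel" and disj: "disjoint_family_on A I"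
    for I :: "nat set" and A
  proof (cases "I = {}")
    case True
    then show ?thesis
      by (simp add: P.indep_vars_def P.indep_sets_def)
  next
    case False
    \<comment> \<open>A generator on which independence is a statement about joint counts: a
      singleton fixes a count, \<open>UNIV\<close> leaves it free, and the empty set makes the
      family stable under intersection.\<close>
    let ?E = "insert UNIV (insert {} (range (\<lambda>k::nat. {k})))"
    have cm: "cnt (A i) \<in> measurable (poisson_law l) (count_space UNIV)" if "i \<in> I" for i
      using measurable_cnt A that by (intro measurable_compose[OF meas]) auto
    have "P.indep_vars (\<lambda>_. count_space UNIV) (\<lambda>i. cnt (A i)) I"
    proof (subst P.indep_vars_finite[OF False I, where E = "\<lambda>_. ?E"])
      show "sets (count_space UNIV) = sigma_sets (space (count_space UNIV)) ?E"
      proof -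
        have "sigma_sets UNIV ?E = UNIV"
        proof (intro set_eqI iffI UNIV_I)
          fix S :: "nat set"
          have "(\<Union>k\<in>S. {k}) \<in> sigma_sets UNIV ?E"
            by (intro sigma_sets_UNION) (auto intro: sigma_sets.Basic)
          then show "S \<in> sigma_sets UNIV ?E" by simp
        qed
        then show ?thesis by simp
      qed
      show "Int_stable ?E"
        by (auto simp: Int_stable_def)
      show "\<forall>S\<in>I \<rightarrow> ?E. P.prob (\<Inter>j\<in>I. cnt (A j) -` S j \<inter> space (poisson_law l)) =
          (\<Prod>j\<in>I. P.prob (cnt (A j) -` S j \<inter> space (poisson_law l)))"
      proof
        fix S assume S: "S \<in> I \<rightarrow> ?E"
        show "P.prob (\<Inter>j\<in>I. cnt (A j) -` S j \<inter> space (poisson_law l)) =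
          (\<Prod>j\<in>I. P.prob (cnt (A j) -` S j \<inter> space (poisson_law l)))"
        proof (cases "\<exists>j\<in>I. S j = {}")
          case True
          then obtain j where j: "j \<in> I" "S j = {}"
            by auto
          then have "(\<Inter>j\<in>I. cnt (A j) -` S j \<inter> space (poisson_law l)) = {}"
            by auto
          moreover have "(\<Prod>j\<in>I. P.prob (cnt (A j) -` S j \<inter> space (poisson_law l))) = 0"
            using I j by (intro prod_zero bexI[of _ j]) auto
          ultimately show ?thesis by simp
        next
          case ne: False
          \<comment> \<open>Only the indices with a singleton impose a constraint; the others
            contribute the factor 1.\<close>
          define J where "J = {j \<in> I. S j \<noteq> UNIV}"
          have "\<exists>k. S j = {k}" if "j \<in> J" for j
            using that S ne by (auto simp: J_def Pi_def)
          then obtain k where k: "\<And>j. j \<in> J \<Longrightarrow> S j = {k j}"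
            by metis
          have J: "finite J" "J \<subseteq> I"
            using I by (auto simp: J_def)
          have UN: "S j = UNIV" if "j \<in> I - J" for j
            using that by (auto simp: J_def)
          have "(\<Inter>j\<in>I. cnt (A j) -` S j \<inter> space (poisson_law l)) =
              {\<nu> \<in> simple_point_measures. \<forall>j\<in>J. cnt (A j) \<nu> = k j}"
          proof (intro set_eqI iffI)
            fix \<nu> assume "\<nu> \<in> (\<Inter>j\<in>I. cnt (A j) -` S j \<inter> space (poisson_law l))"
            then show "\<nu> \<in> {\<nu> \<in> simple_point_measures. \<forall>j\<in>J. cnt (A j) \<nu> = k j}"
              using False J k by (fastforce simp: space)
          next
            fix \<nu> assume *: "\<nu> \<in> {\<nu> \<in> simple_point_measures. \<forall>j\<in>J. cnt (A j) \<nu> = k j}"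
            have "cnt (A j) \<nu> \<in> S j" if "j \<in> I" for j
              using * k[of j] UN[of j] that by (cases "j \<in> J") auto
            then show "\<nu> \<in> (\<Inter>j\<in>I. cnt (A j) -` S j \<inter> space (poisson_law l))"
              using * by (auto simp: space)
          qed
          moreover have "A j \<in> sets unit_borel" if "j \<in> J" for j
            using that A J by auto
          ultimately have "P.prob (\<Inter>j\<in>I. cnt (A j) -` S j \<inter> space (poisson_law l)) =
              (\<Prod>j\<in>J. pois (l * measure lborel (A j)) (k j))"
            using cnts[OF J(1) disjoint_family_on_mono[OF J(2) disj], of k] by (simp only:)
          also have "\<dots> = (\<Prod>j\<in>J. P.prob (cnt (A j) -` S j \<inter> space (poisson_law l)))"
          proof (intro prod.cong refl)
            fix j assume "j \<in> J"
            then have "cnt (A j) -` S j \<inter> space (poisson_law l) = {\<nu> \<in> simple_point_measures. cnt (A j) \<nu> = k j}"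
              using k by (auto simp: space)
            then show "pois (l * measure lborel (A j)) (k j) = P.prob (cnt (A j) -` S j \<inter> space (poisson_law l))"
              using cnt1[of "A j" "k j"] \<open>j \<in> J\<close> J A by auto
          qed
          also have "\<dots> = (\<Prod>j\<in>I. P.prob (cnt (A j) -` S j \<inter> space (poisson_law l)))"
            using J I UN P.prob_space by (intro prod.mono_neutral_left) auto
          finally show ?thesis .
        qed
      qed
    qed (use cm in auto)
    \<comment> \<open>\<open>of_nat\<close> carries independence from natural counts to the extended
      reals used in \<open>poisson_process\<close>.\<close>
    then have "P.indep_vars (\<lambda>_. borel) (\<lambda>i. (of_nat :: nat \<Rightarrow> ennreal) \<circ> cnt (A i)) I"
      by (rule P.indep_vars_compose) auto
    moreover have "(\<lambda>\<nu>. emeasure \<nu> (A i)) -` S \<inter> space (poisson_law l) =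
        ((of_nat :: nat \<Rightarrow> ennreal) \<circ> cnt (A i)) -` S \<inter> space (poisson_law l)" if "i \<in> I" for i S
      using that A by (auto simp: space emeasure_eq_cnt)
    moreover have "(\<lambda>\<nu>. emeasure \<nu> (A i)) \<in> borel_measurable (poisson_law l)" if "i \<in> I" for i
      using A that by (intro measurable_compose[OF meas measurable_emeasure_spm_algebra]) auto
    ultimately show ?thesis
      unfolding P.indep_vars_def2 by (simp cong: P.indep_sets_cong)
  qed
  show ?thesis
    unfolding poisson_process_def
    using P.prob_space_axioms meas one indep by blast
qed

section \<open>Necessity of the condition\<close>

text \<open>The case k = 0 of the count condition is the void probability exp (- l * |A|), and void
  probabilities determine the law by \<open>renyi_avoidance\<close>.\<close>

lemma poisson_process_distr_eq:
  assumes l: "l > 0" and X: "poisson_process M l X"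
  shows "distr M spm_algebra X = poisson_law l"
proof (rule renyi_avoidance)
  have M: "prob_space M" and mX: "X \<in> measurable M spm_algebra"
    using X by (auto simp: poisson_process_def)
  interpret prob_space M by (rule M)
  show "finite_measure (distr M spm_algebra X)"
    using prob_space_distr[OF mX] by (rule prob_space.finite_measure)
  fix A assume A: "A \<in> sets unit_borel"
  have "emeasure (distr M spm_algebra X) (void_event A) = emeasure M (X -` void_event A \<inter> space M)"
    using A by (intro emeasure_distr mX void_event_sets)
  also have "X -` void_event A \<inter> space M = {\<omega> \<in> space M. emeasure (X \<omega>) A = of_nat 0}"
    using measurable_space[OF mX] by (auto simp: space_spm_algebra)
  also have "emeasure M \<dots> = ennreal ((l * measure lborel A) ^ 0 / fact 0 * exp (- (l * measure lborel A)))"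
    using X A unfolding poisson_process_def by (simp only: emeasure_eq_measure)
  finally show "emeasure (distr M spm_algebra X) (void_event A) = emeasure (poisson_law l) (void_event A)"
    using l A by (simp add: poisson_law_void)
qed auto

abbreviation npoints :: "real measure \<Rightarrow> nat" where
  "npoints \<equiv> cnt {0..1}"

lemma npoints_eq: "\<nu> \<in> simple_point_measures \<Longrightarrow> npoints \<nu> = card (points \<nu>)"
  using points_subset[of \<nu>] by (simp add: cnt_def Int_absorb2)

text \<open>Almost surely no two labels coincide. Leaving Q arbitrary serves both a single level and
  all levels up to j.\<close>

lemma emeasure_binomial_process_npoints:
  "emeasure (binomial_process n) {\<nu> \<in> simple_point_measures. Q (npoints \<nu>)} = (if Q n then 1 else 0)"
proof -
  have S: "{\<nu> \<in> simple_point_measures. Q (npoints \<nu>)} \<in> sets spm_algebra"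
    by (rule cnt_sets) simp
  have "AE x in cube n. npoints (conf n x) = n"
    using AE_cube_inj AE_space
  proof eventually_elim
    case (elim x)
    then show ?case
      by (simp add: npoints_eq conf_in_simple_point_measures points_conf card_image)
  qed
  then have "AE x in cube n. x \<in> {x \<in> space (cube n). conf n x \<in> {\<nu> \<in> simple_point_measures. Q (npoints \<nu>)}}
      \<longleftrightarrow> x \<in> {x \<in> space (cube n). Q n}"
    using AE_space by eventually_elim (auto simp: conf_in_simple_point_measures)
  moreover have "{x \<in> space (cube n). conf n x \<in> {\<nu> \<in> simple_point_measures. Q (npoints \<nu>)}} \<in> sets (cube n)"
    using measurable_sets[OF measurable_conf S] by (simp add: vimage_def Int_def conj_commute)
  ultimately have "emeasure (binomial_process n) {\<nu> \<in> simple_point_measures. Q (npoints \<nu>)} =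
      emeasure (cube n) {x \<in> space (cube n). Q n}"
    unfolding emeasure_binomial_process[OF S] by (intro emeasure_eq_AE) auto
  then show ?thesis
    by (simp add: prob_space.emeasure_space_1[OF prob_space_cube])
qed

text \<open>Only the j-th term of the mixture charges such an event, so its mass depends on the
  intensity through the scalar \<open>pois l j\<close> alone. This makes two intensities
  comparable.\<close>

lemma emeasure_poisson_law_level:
  assumes "l > 0" and E: "E \<in> sets spm_algebra" "E \<subseteq> {\<nu> \<in> simple_point_measures. npoints \<nu> = j}"
  shows "emeasure (poisson_law l) E = ennreal (pois l j) * emeasure (binomial_process j) E"
proof -
  have "emeasure (binomial_process n) E = 0" if "n \<noteq> j" for n
  proof -
    have "emeasure (binomial_process n) E \<le> emeasure (binomial_process n) {\<nu> \<in> simple_point_measures. npoints \<nu> = j}"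
      using E(2) cnt_sets[of "{0..1}" "\<lambda>n. n = j"] by (intro emeasure_mono) auto
    then show ?thesis
      using that emeasure_binomial_process_npoints[of n "\<lambda>n. n = j"] by simp
  qed
  then have "(\<Sum>n. ennreal (pois l n) * emeasure (binomial_process n) E) =
      (\<Sum>n\<in>{j}. ennreal (pois l n) * emeasure (binomial_process n) E)"
    by (intro suminf_finite) auto
  then show ?thesis
    using assms by (simp add: emeasure_poisson_law)
qed

lemma poisson_law_cdf:
  assumes l: "l > 0"
  shows "emeasure (poisson_law l) {\<nu> \<in> simple_point_measures. npoints \<nu> \<le> j} = ennreal (pois_cdf l j)"
proof -
  let ?S = "{\<nu> \<in> simple_point_measures. npoints \<nu> \<le> j}"
  have S: "?S \<in> sets spm_algebra"
    by (rule cnt_sets) simp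
  have bin: "emeasure (binomial_process n) ?S = (if n \<le> j then 1 else 0)" for n
    by (rule emeasure_binomial_process_npoints)
  have "emeasure (poisson_law l) ?S = (\<Sum>n. ennreal (pois l n) * (if n \<le> j then 1 else 0))"
    by (simp only: emeasure_poisson_law[OF l S] bin)
  also have "\<dots> = (\<Sum>n\<le>j. ennreal (pois l n) * (if n \<le> j then 1 else 0))"
    by (intro suminf_finite) auto
  also have "\<dots> = (\<Sum>n\<le>j. ennreal (pois l n))"
    by (intro sum.cong) auto
  also have "\<dots> = ennreal (pois_cdf l j)"
    unfolding pois_cdf_def using l by (intro sum_ennreal pois_nonneg) auto
  finally show ?thesis .
qed

text \<open>On the event \<open>A\<close> that source and target both have \<open>j\<close> points the thinning fixes its argument, so the
  law of the target gives \<open>A\<close> at least the mass that the law of the source does. But these masses are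
  \<open>pois m j * b\<close> and \<open>pois l j * b\<close>, where \<open>b\<close> is the common conditional probability given \<open>j\<close> points.\<close>

lemma poisson_thinning_imp_thinnable:
  assumes "0 < m" "m < l" and f: "poisson_thinning l m f"
  shows "thinnable l m"
  unfolding thinnable_def
proof (intro allI impI)
  fix i assume less: "pois m (Suc i) < pois l (Suc i)"
  define j where "j = Suc i"
  have l: "l > 0" using assms by simp
  let ?P = "poisson_law l"
  interpret P: prob_space ?P by (rule prob_space_poisson_law)
  have space: "space ?P = simple_point_measures"
    using sets_eq_imp_space_eq[OF sets_poisson_law] by (simp add: space_spm_algebra)
  have mf: "f \<in> measurable spm_algebra spm_algebra"
    using f by (simp add: poisson_thinning_def)
  then have mfP: "f \<in> measurable ?P spm_algebra"
    by (simp cong: measurable_cong_sets)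
  have fspm: "f \<nu> \<in> simple_point_measures" if "\<nu> \<in> simple_point_measures" for \<nu>
    using measurable_space[OF mf] that by (simp add: space_spm_algebra)
  have pp: "poisson_process ?P m (\<lambda>\<nu>. f \<nu>)" and sub: "AE \<nu> in ?P. points (f \<nu>) \<subseteq> points \<nu>"
    using poisson_thinning_any_space[OF f poisson_process_poisson_law[OF l]] by auto
  have D: "distr ?P spm_algebra f = poisson_law m"
    by (rule poisson_process_distr_eq[OF \<open>0 < m\<close> pp])
  have law: "emeasure ?P {\<nu> \<in> simple_point_measures. f \<nu> \<in> E} = emeasure (poisson_law m) E"
    if "E \<in> sets spm_algebra" for E
    using that mfP by (simp add: emeasure_distr space vimage_def Int_def conj_commute flip: D)
  let ?A = "{\<nu> \<in> simple_point_measures. npoints \<nu> = j} \<inter> {\<nu> \<in> simple_point_measures. f \<nu> \<in> {\<nu> \<in> simple_point_measures. npoints \<nu> = j}}"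
  have pre: "{\<nu> \<in> simple_point_measures. f \<nu> \<in> E} \<in> sets spm_algebra" if "E \<in> sets spm_algebra" for E
    using measurable_sets[OF mf that] by (simp add: space_spm_algebra vimage_def Int_def conj_commute)
  have A: "?A \<in> sets spm_algebra"
    by (intro sets.Int pre cnt_sets unit_borel_top)
  have sub': "AE \<nu> in ?P. \<nu> \<in> simple_point_measures \<and> f \<nu> \<in> simple_point_measures \<and> points (f \<nu>) \<subseteq> points \<nu>"
    using sub AE_space by eventually_elim (auto simp: space fspm)
  have null: "emeasure ?P ?A = 0"
  proof -
    have "emeasure ?P ?A \<le> emeasure ?P {\<nu> \<in> simple_point_measures. f \<nu> \<in> ?A}"
    proof (rule emeasure_mono_AE)
      show "AE \<nu> in ?P. \<nu> \<in> ?A \<longrightarrow> \<nu> \<in> {\<nu> \<in> simple_point_measures. f \<nu> \<in> ?A}"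
        using sub'
      proof eventually_elim
        case (elim \<nu>)
        show ?case
        proof
          assume \<nu>: "\<nu> \<in> ?A"
          then have "points (f \<nu>) = points \<nu>"
            using elim by (intro card_subset_eq finite_points) (auto simp: npoints_eq)
          then have "f \<nu> = \<nu>"
            using elim pm_points by metis
          then show "\<nu> \<in> {\<nu> \<in> simple_point_measures. f \<nu> \<in> ?A}"
            using \<nu> by auto
        qed
      qed
      show "{\<nu> \<in> simple_point_measures. f \<nu> \<in> ?A} \<in> sets ?P"
        using pre[OF A] by simp
    qed
    also have "\<dots> = emeasure (poisson_law m) ?A"
      by (rule law[OF A])
    finally have le: "emeasure ?P ?A \<le> emeasure (poisson_law m) ?A" .
    interpret B: prob_space "binomial_process j" by (rule prob_space_binomial_process)
    define b where "b = B.prob ?A"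
    have lev: "emeasure (poisson_law r) ?A = ennreal (pois r j * b)" if "r > 0" for r
    proof -
      have "emeasure (poisson_law r) ?A = ennreal (pois r j) * emeasure (binomial_process j) ?A"
        using that A by (intro emeasure_poisson_law_level) auto
      then show ?thesis
        using that unfolding B.emeasure_eq_measure b_def by (simp only: ennreal_mult'[OF pois_nonneg] less_imp_le)
    qed
    \<comment> \<open>As the weight of the source is strictly larger at j, this forces b =
      0.\<close>
    have "pois l j * b \<le> pois m j * b"
      using le lev[OF l] lev[OF \<open>0 < m\<close>] \<open>0 < m\<close> by (simp add: b_def pois_nonneg)
    moreover have "b \<ge> 0"
      by (simp add: b_def)
    ultimately have "b = 0"
      using less by (cases "b = 0") (auto simp: j_def)
    then show ?thesis
      using lev[OF l] by simp
  qed
  \<comment> \<open>Outside the null event \<open>?A\<close> a source of exactly j =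
    \<open>Suc i\<close> points loses at least one, and a source of fewer points has at most i from
    the start.\<close>
  have "emeasure ?P {\<nu> \<in> simple_point_measures. npoints \<nu> \<le> j} \<le>
      emeasure ?P {\<nu> \<in> simple_point_measures. f \<nu> \<in> {\<nu> \<in> simple_point_measures. npoints \<nu> \<le> i}}"
  proof (rule emeasure_mono_AE)
    have "AE \<nu> in ?P. \<nu> \<notin> ?A"
      using null A by (intro AE_not_in) (auto simp: null_sets_def)
    then show "AE \<nu> in ?P. \<nu> \<in> {\<nu> \<in> simple_point_measures. npoints \<nu> \<le> j} \<longrightarrow>
        \<nu> \<in> {\<nu> \<in> simple_point_measures. f \<nu> \<in> {\<nu> \<in> simple_point_measures. npoints \<nu> \<le> i}}"
      using sub'
    proof eventually_elim
      case (elim \<nu>)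
      have "npoints (f \<nu>) \<le> npoints \<nu>"
        using elim(2) by (simp add: npoints_eq card_mono finite_points)
      then show ?case
        using elim by (auto simp: j_def)
    qed
    show "{\<nu> \<in> simple_point_measures. f \<nu> \<in> {\<nu> \<in> simple_point_measures. npoints \<nu> \<le> i}} \<in> sets ?P"
      unfolding sets_poisson_law by (intro pre cnt_sets unit_borel_top)
  qed
  moreover have "{\<nu> \<in> simple_point_measures. npoints \<nu> \<le> i} \<in> sets spm_algebra"
    by (rule cnt_sets) simp
  note law[OF this]
  ultimately have "ennreal (pois_cdf l j) \<le> ennreal (pois_cdf m i)"
    by (simp only: poisson_law_cdf[OF l] poisson_law_cdf[OF \<open>0 < m\<close>])
  moreover have "pois_cdf m i \<ge> 0"
    unfolding pois_cdf_def using \<open>0 < m\<close> by (intro sum_nonneg pois_nonneg) auto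
  ultimately show "pois_cdf l (Suc i) \<le> pois_cdf m i"
    by (simp add: j_def)
qed

section \<open>Independent randomness inside a configuration\<close>

lemma emeasure_lborel_affine:
  fixes B :: "real set"
  assumes "B \<in> sets borel" "c > 0"
  shows "ennreal c * emeasure lborel {x. t + c * x \<in> B} = emeasure lborel B"
proof -
  have "emeasure lborel B = emeasure (density (distr lborel borel (\<lambda>x. t + c * x)) (\<lambda>_. ennreal \<bar>c\<bar>)) B"
    using assms by (subst lborel_real_affine[of c t]) auto
  also have "\<dots> = ennreal c * emeasure lborel {x. t + c * x \<in> B}"
    using assms by (simp add: emeasure_density_const emeasure_distr vimage_def)
  finally show ?thesis ..
qed

text \<open>On one cell u = 2 ^ k * t runs through an interval of unit length, so frac (u + s) is a
  rotation of the circle applied to u and preserves Lebesgue measure; 2 ^ k accounts for the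
  scaling.\<close>

lemma emeasure_frac_cell:
  fixes W :: "real set" and c :: int
  assumes W: "W \<in> sets borel" "W \<subseteq> {0..<1}"
  shows "ennreal (2 ^ k) * emeasure lborel {t. \<lfloor>2 ^ k * t\<rfloor> = c \<and> frac (2 ^ k * t + s) \<in> W} = emeasure lborel W"
proof -
  define r where "r = frac s"
  have r: "0 \<le> r" "r < 1"
    by (auto simp: r_def frac_lt_1)
  have fr: "frac (u + s) = (if r - c + u < 1 then r - c + u else r - c - 1 + u)" if "c \<le> u" "u < c + 1" for u :: real
  proof -
    have "s - r \<in> \<int>"
      by (simp add: r_def frac_def)
    then have "s - r + c \<in> \<int>" "s - r + c + 1 \<in> \<int>"
      by auto
    moreover have "u + s - (r - c + u) = s - r + c" "u + s - (r - c - 1 + u) = s - r + c + 1"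
      by auto
    ultimately have "u + s - (r - c + u) \<in> \<int>" "u + s - (r - c - 1 + u) \<in> \<int>"
      by (simp_all only:)
    then show ?thesis
      using that r by (auto simp: frac_unique_iff)
  qed
  \<comment> \<open>The parts of the cell before and after the rotation wraps around: the first is
    mapped into [r, 1), the second into [0, r).\<close>
  let ?S1 = "{t. (r - c) + 2 ^ k * t \<in> W \<inter> {r..<1}}"
  let ?S2 = "{t. (r - c - 1) + 2 ^ k * t \<in> W \<inter> {0..<r}}"
  have "{t. \<lfloor>2 ^ k * t\<rfloor> = c \<and> frac (2 ^ k * t + s) \<in> W} = ?S1 \<union> ?S2"
  proof (intro set_eqI)
    fix t :: real
    define u where "u = 2 ^ k * t"
    have "\<lfloor>u\<rfloor> = c \<and> frac (u + s) \<in> W \<longleftrightarrow>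
        r - c + u \<in> W \<inter> {r..<1} \<or> r - c - 1 + u \<in> W \<inter> {0..<r}"
      using fr[of u] W(2) r by (auto simp: floor_eq_iff split: if_splits)
    then show "t \<in> {t. \<lfloor>2 ^ k * t\<rfloor> = c \<and> frac (2 ^ k * t + s) \<in> W} \<longleftrightarrow> t \<in> ?S1 \<union> ?S2"
      by (simp add: u_def)
  qed
  moreover have "emeasure lborel (?S1 \<union> ?S2) = emeasure lborel ?S1 + emeasure lborel ?S2"
  proof (rule plus_emeasure[symmetric])
    have "(\<lambda>t. a + 2 ^ k * t) -` B \<inter> space lborel \<in> sets lborel" if "B \<in> sets borel" for a :: real and B
      using that by (intro measurable_sets[of _ lborel borel]) auto
    then show "?S1 \<in> sets lborel" "?S2 \<in> sets lborel"
      using W(1) by (auto simp: vimage_def)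
    show "?S1 \<inter> ?S2 = {}"
      by auto
  qed
  moreover have "ennreal (2 ^ k) * emeasure lborel ?S1 = emeasure lborel (W \<inter> {r..<1})"
    using W(1) by (intro emeasure_lborel_affine) auto
  moreover have "ennreal (2 ^ k) * emeasure lborel ?S2 = emeasure lborel (W \<inter> {0..<r})"
    using W(1) by (intro emeasure_lborel_affine) auto
  moreover have "emeasure lborel (W \<inter> {r..<1}) + emeasure lborel (W \<inter> {0..<r}) = emeasure lborel W"
    using W r by (subst plus_emeasure) (auto intro!: arg_cong[where f = "emeasure lborel"])
  ultimately show ?thesis
    by (simp only: distrib_left)
qed

text \<open>A dyadic cell lies in [0, 1) or misses it. In the first case, comparison with {0..<1} in
  place of W eliminates the factor 2 ^ k; in the second both sides vanish.\<close>

lemma emeasure_uni_frac_cell: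
  fixes W :: "real set" and c :: int
  assumes W: "W \<in> sets borel" "W \<subseteq> {0..<1}"
  shows "emeasure uni {t \<in> space uni. \<lfloor>2 ^ k * t\<rfloor> = c \<and> frac (2 ^ k * t + s) \<in> W} =
    emeasure lborel W * emeasure uni {t \<in> space uni. \<lfloor>2 ^ k * t\<rfloor> = c}"
proof (cases "\<exists>t\<in>space uni. \<lfloor>2 ^ k * t\<rfloor> = c")
  case True
  then obtain t0 :: real where t0: "0 \<le> t0" "t0 < 1" "\<lfloor>2 ^ k * t0\<rfloor> = c"
    by (auto simp: space_uni)
  have "2 ^ k * t0 < 2 ^ k * 1"
    using t0 by (intro mult_strict_left_mono) auto
  then have "\<lfloor>2 ^ k * t0\<rfloor> < (2 ^ k :: int)"
    by (simp add: floor_less_iff)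
  then have c: "0 \<le> c" "c + 1 \<le> 2 ^ k"
    using t0 by auto
  then have "real_of_int (c + 1) \<le> real_of_int (2 ^ k)"
    by (simp only: of_int_le_iff)
  then have c': "real_of_int c + 1 \<le> 2 ^ k"
    by simp
  have sub: "{t. \<lfloor>2 ^ k * t\<rfloor> = c} \<subseteq> {0..<1::real}"
  proof
    fix t :: real assume "t \<in> {t. \<lfloor>2 ^ k * t\<rfloor> = c}"
    then have t: "c \<le> 2 ^ k * t" "2 ^ k * t < c + 1"
      by (auto simp: floor_eq_iff)
    have "0 \<le> real_of_int c"
      using c by simp
    then have "0 \<le> 2 ^ k * t" "2 ^ k * t < 2 ^ k * 1"
      using t c' by linarith+
    then show "t \<in> {0..<1}"
      using mult_le_cancel_left_pos[of "2 ^ k" 0 t] mult_less_cancel_left_pos[of "2 ^ k" t 1] by simp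
  qed
  let ?E = "emeasure lborel {t. \<lfloor>2 ^ k * t\<rfloor> = c \<and> frac (2 ^ k * t + s) \<in> W}"
  let ?C = "emeasure lborel {t::real. \<lfloor>2 ^ k * t\<rfloor> = c}"
  have E: "emeasure uni {t \<in> space uni. \<lfloor>2 ^ k * t\<rfloor> = c \<and> frac (2 ^ k * t + s) \<in> W} = ?E"
    using sub by (subst emeasure_uni) (auto simp: space_uni intro!: arg_cong[where f = "emeasure lborel"])
  have C: "emeasure uni {t \<in> space uni. \<lfloor>2 ^ k * t\<rfloor> = c} = ?C"
    using sub by (subst emeasure_uni) (auto simp: space_uni intro!: arg_cong[where f = "emeasure lborel"])
  have "ennreal (2 ^ k) * ?E = emeasure lborel W"
    using W by (rule emeasure_frac_cell)
  moreover have "ennreal (2 ^ k) * ?C = 1"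
    using emeasure_frac_cell[of "{0..<1}" k c 0] by (simp add: frac_lt_1)
  ultimately have "ennreal (2 ^ k) * ?E = ennreal (2 ^ k) * (emeasure lborel W * ?C)"
    by (metis mult.left_commute mult.right_neutral)
  then have "?E = emeasure lborel W * ?C"
    by (subst (asm) ennreal_mult_cancel_left) auto
  then show ?thesis
    by (simp only: E C)
next
  case False
  then have e: "{t \<in> space uni. \<lfloor>2 ^ k * t\<rfloor> = c \<and> frac (2 ^ k * t + s) \<in> W} = {}"
    "{t \<in> space uni. \<lfloor>2 ^ k * t\<rfloor> = c} = {}"
    by auto
  show ?thesis
    unfolding e by simp
qed

lemma borel_measurable_frac: "(frac :: real \<Rightarrow> real) \<in> borel_measurable borel"
proof -
  have "(\<lambda>x::real. x - real_of_int \<lfloor>x\<rfloor>) \<in> borel_measurable borel"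
    by (intro borel_measurable_diff borel_measurable_real_floor measurable_ident_sets refl)
  then show ?thesis
    unfolding frac_def[abs_def] .
qed

text \<open>Integrate over x i first. By \<open>cell\<close> and \<open>inv\<close> the section of D
  in this coordinate is empty or one full cell, while the other coordinates only shift the sum by a
  constant. So the factor is the same whatever the others are.\<close>

lemma emeasure_cube_frac_indep:
  fixes W :: "real set" and c :: int
  assumes W: "W \<in> sets borel" "W \<subseteq> {0..<1}" and i: "i < n" and D: "D \<in> sets (cube n)"
    and cell: "\<And>x. x \<in> D \<Longrightarrow> \<lfloor>2 ^ k * x i\<rfloor> = c"
    and inv: "\<And>x t. x \<in> D \<Longrightarrow> t \<in> {0..<1} \<Longrightarrow> \<lfloor>2 ^ k * t\<rfloor> = c \<Longrightarrow> x(i := t) \<in> D"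
  shows "{x \<in> D. frac (2 ^ k * (\<Sum>j<n. x j)) \<in> W} \<in> sets (cube n)"
    and "emeasure (cube n) {x \<in> D. frac (2 ^ k * (\<Sum>j<n. x j)) \<in> W} = emeasure lborel W * emeasure (cube n) D"
proof -
  let ?E = "{x \<in> D. frac (2 ^ k * (\<Sum>j<n. x j)) \<in> W}"
  have "(\<lambda>x. frac (2 ^ k * (\<Sum>j<n. x j))) \<in> borel_measurable (cube n)"
    by (intro measurable_compose[OF _ borel_measurable_frac] borel_measurable_times borel_measurable_sum cube_component) auto
  then have "(\<lambda>x. frac (2 ^ k * (\<Sum>j<n. x j))) -` W \<inter> space (cube n) \<in> sets (cube n)"
    using W(1) by (rule measurable_sets)
  then have "D \<inter> ((\<lambda>x. frac (2 ^ k * (\<Sum>j<n. x j))) -` W \<inter> space (cube n)) \<in> sets (cube n)"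
    using D by (rule sets.Int[rotated])
  also have "D \<inter> ((\<lambda>x. frac (2 ^ k * (\<Sum>j<n. x j))) -` W \<inter> space (cube n)) = ?E"
    using sets.sets_into_space[OF D] by auto
  finally show E: "?E \<in> sets (cube n)" .
  have "emeasure (cube n) ?E = (\<integral>\<^sup>+ y. emeasure uni {t \<in> space uni. y(i := t) \<in> ?E} \<partial>PiM ({..<n} - {i}) (\<lambda>_. uni))"
    using i E by (intro emeasure_cube_section) auto
  also have "\<dots> = (\<integral>\<^sup>+ y. emeasure lborel W * emeasure uni {t \<in> space uni. y(i := t) \<in> D} \<partial>PiM ({..<n} - {i}) (\<lambda>_. uni))"
  proof (intro nn_integral_cong)
    fix y :: "nat \<Rightarrow> real"
    define s where "s = 2 ^ k * (\<Sum>j\<in>{..<n} - {i}. y j)"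
    have sum: "2 ^ k * (\<Sum>j<n. (y(i := t)) j) = 2 ^ k * t + s" for t
    proof -
      have "(\<Sum>j<n. (y(i := t)) j) = (y(i := t)) i + (\<Sum>j\<in>{..<n} - {i}. (y(i := t)) j)"
        using i by (intro sum.remove) auto
      also have "(\<Sum>j\<in>{..<n} - {i}. (y(i := t)) j) = (\<Sum>j\<in>{..<n} - {i}. y j)"
        by (intro sum.cong) auto
      finally show ?thesis
        by (simp add: s_def distrib_left)
    qed
    show "emeasure uni {t \<in> space uni. y(i := t) \<in> ?E} = emeasure lborel W * emeasure uni {t \<in> space uni. y(i := t) \<in> D}"
    proof (cases "\<exists>t\<in>space uni. y(i := t) \<in> D")
      case True
      then obtain t0 where t0: "y(i := t0) \<in> D"
        by auto
      have iff: "y(i := t) \<in> D \<longleftrightarrow> \<lfloor>2 ^ k * t\<rfloor> = c" if "t \<in> space uni" for t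
        using inv[OF t0, of t] cell[of "y(i := t)"] that by (auto simp: space_uni)
      have 1: "{t \<in> space uni. y(i := t) \<in> D} = {t \<in> space uni. \<lfloor>2 ^ k * t\<rfloor> = c}"
        using iff by auto
      have 2: "{t \<in> space uni. y(i := t) \<in> ?E} = {t \<in> space uni. \<lfloor>2 ^ k * t\<rfloor> = c \<and> frac (2 ^ k * t + s) \<in> W}"
        using iff unfolding mem_Collect_eq sum by auto
      show ?thesis
        unfolding 1 2 using W by (rule emeasure_uni_frac_cell)
    next
      case False
      then have e: "{t \<in> space uni. y(i := t) \<in> ?E} = {}" "{t \<in> space uni. y(i := t) \<in> D} = {}"
        by auto
      show ?thesis unfolding e by simp
    qed
  qed
  also have "\<dots> = emeasure lborel W * (\<integral>\<^sup>+ y. emeasure uni {t \<in> space uni. y(i := t) \<in> D} \<partial>PiM ({..<n} - {i}) (\<lambda>_. uni))"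
  proof (rule nn_integral_cmult)
    let ?M = "PiM ({..<n} - {i}) (\<lambda>_. uni)"
    have "(\<lambda>(y, t). y(i := t)) \<in> measurable (?M \<Otimes>\<^sub>M uni) (PiM (insert i ({..<n} - {i})) (\<lambda>_. uni))"
      by (rule measurable_add_dim)
    then have "(\<lambda>(y, t). y(i := t)) -` D \<inter> space (?M \<Otimes>\<^sub>M uni) \<in> sets (?M \<Otimes>\<^sub>M uni)"
      using D i by (intro measurable_sets) (auto simp: insert_absorb)
    then have "(\<lambda>y. emeasure uni (Pair y -` ((\<lambda>(y, t). y(i := t)) -` D \<inter> space (?M \<Otimes>\<^sub>M uni)))) \<in> borel_measurable ?M"
      by (rule uni.measurable_emeasure_Pair)
    then show "(\<lambda>y. emeasure uni {t \<in> space uni. y(i := t) \<in> D}) \<in> borel_measurable ?M"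
      by (rule measurable_cong[THEN iffD1, rotated])
        (auto simp: space_pair_measure intro!: arg_cong[where f = "emeasure uni"])
  qed
  also have "(\<integral>\<^sup>+ y. emeasure uni {t \<in> space uni. y(i := t) \<in> D} \<partial>PiM ({..<n} - {i}) (\<lambda>_. uni)) = emeasure (cube n) D"
    using i D by (intro emeasure_cube_section[symmetric]) auto
  finally show "emeasure (cube n) ?E = emeasure lborel W * emeasure (cube n) D" .
qed

section \<open>Ranks, the separation level and the lottery\<close>

definition rk :: "real set \<Rightarrow> real \<Rightarrow> nat" where
  "rk F y = card {z \<in> F. z < y}"

text \<open>The coarsest scale at which dyadic cells tell the points apart. It can be read off from
  those cells, so it stays fixed while points move inside them.\<close>

definition sep_level :: "real set \<Rightarrow> nat" where
  "sep_level F = (LEAST k. inj_on (\<lambda>x. \<lfloor>2 ^ k * x\<rfloor>) F)"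

text \<open>A uniform variable which reveals nothing about the configuration with one point removed: given
  the dyadic cells of the points, the positions inside the cells are independent and uniform, and their
  sum modulo one is independent of any proper subfamily.\<close>

definition lottery :: "real set \<Rightarrow> real" where
  "lottery F = frac (2 ^ sep_level F * \<Sum>F)"

text \<open>The sets of smaller elements are strictly nested, so the ranks are distinct; all lying
  below the cardinality, they exhaust the numbers below it.\<close>

lemma bij_betw_rank:
  fixes g :: "'b \<Rightarrow> 'a :: linorder"
  assumes "finite I" "inj_on g I"
  shows "bij_betw (\<lambda>j. card {i \<in> I. g i < g j}) I {..<card I}"
proof -
  have less: "card {i \<in> I. g i < g j} < card {i \<in> I. g i < g j'}" if "g j < g j'" "j \<in> I" for j j'
    using that assms(1) by (intro psubset_card_mono) auto
  have inj: "inj_on (\<lambda>j. card {i \<in> I. g i < g j}) I"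
  proof (rule inj_onI)
    fix j j' assume *: "j \<in> I" "j' \<in> I" "card {i \<in> I. g i < g j} = card {i \<in> I. g i < g j'}"
    then have "g j = g j'"
      using less[of j j'] less[of j' j] by (cases "g j" "g j'" rule: linorder_cases) auto
    then show "j = j'"
      using assms * by (auto dest: inj_onD)
  qed
  have "card {i \<in> I. g i < g j} < card I" if "j \<in> I" for j
    using that assms(1) by (intro psubset_card_mono) auto
  then have "(\<lambda>j. card {i \<in> I. g i < g j}) ` I \<subseteq> {..<card I}"
    by auto
  then have "(\<lambda>j. card {i \<in> I. g i < g j}) ` I = {..<card I}"
    by (rule card_subset_eq[rotated]) (simp_all add: card_image[OF inj])
  then show ?thesis
    using inj by (simp add: bij_betw_def)
qed

lemma rk_image:
  assumes "inj_on x {..<n}"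
  shows "rk (x ` {..<n}) (x j) = card {i. i < n \<and> x i < x j}"
proof -
  have "{z \<in> x ` {..<n}. z < x j} = x ` {i. i < n \<and> x i < x j}"
    by auto
  then show ?thesis
    using assms by (simp add: rk_def) (intro card_image inj_on_subset[OF assms], auto)
qed

text \<open>Coarser cells are functions of finer ones, so the cell pattern at a level decides
  whether that level is the first to separate.\<close>

lemma floor_dyadic:
  assumes "k' \<le> k"
  shows "\<lfloor>2 ^ k' * x\<rfloor> = \<lfloor>2 ^ k * (x::real)\<rfloor> div 2 ^ (k - k')"
proof -
  have "(2::real) ^ k = 2 ^ k' * 2 ^ (k - k')"
    using assms by (simp flip: power_add)
  then have "2 ^ k' * x = 2 ^ k * x / real_of_int (2 ^ (k - k'))"
    by simp
  then show ?thesis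
    using floor_divide_real_eq_div[of "2 ^ (k - k')" "2 ^ k * x"] by simp
qed

text \<open>The event that the thinned configuration misses A when T is the set of ranks kept.
  Injectivity is included because only then do the ranks number the labels bijectively.\<close>

definition avoid_ranks :: "nat \<Rightarrow> nat set \<Rightarrow> real set \<Rightarrow> (nat \<Rightarrow> real) set" where
  "avoid_ranks n T A = {x \<in> space (cube n). inj_on x {..<n} \<and> (\<forall>j<n. rk (x ` {..<n}) (x j) \<in> T \<longrightarrow> x j \<notin> A)}"

text \<open>Split by the separation level k and the pattern of level-k cells, which are countably
  many cases. In each of them level and ranks are constant, and some label has a rank outside T.
  That label may move freely in its cell, as \<open>emeasure_cube_frac_indep\<close>
  demands.\<close>

lemma lottery_indep:
  assumes A: "A \<in> sets borel" and T: "T \<subset> {..<n}" and W: "W \<in> sets borel" "W \<subseteq> {0..<1}"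
  shows "avoid_ranks n T A \<in> sets (cube n)"
    and "{x \<in> avoid_ranks n T A. lottery (x ` {..<n}) \<in> W} \<in> sets (cube n)"
    and "emeasure (cube n) {x \<in> avoid_ranks n T A. lottery (x ` {..<n}) \<in> W} =
      emeasure lborel W * emeasure (cube n) (avoid_ranks n T A)"
proof -
  \<comment> \<open>The rank of a label as read off from a cell pattern; it is the true rank when
    the cells are distinct.\<close>
  define gr where "gr = (\<lambda>\<gamma> :: int list. \<lambda>j. card {i. i < n \<and> \<gamma> ! i < \<gamma> ! j})"
  \<comment> \<open>The patterns for which k is exactly the separation level: distinct cells at
    level k, a collision at every coarser level.\<close>
  define G where "G = {(k :: nat, \<gamma> :: int list). length \<gamma> = n \<and> distinct \<gamma> \<and>
      (\<forall>k'<k. \<not> distinct (map (\<lambda>c. c div 2 ^ (k - k')) \<gamma>))}"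
  define D where "D = (\<lambda>(k :: nat, \<gamma> :: int list). {x \<in> space (cube n).
      \<forall>j\<in>{..<n}. \<lfloor>2 ^ k * x j\<rfloor> = \<gamma> ! j \<and> (gr \<gamma> j \<in> T \<longrightarrow> x j \<notin> A)})"
  define fl where "fl = (\<lambda>k x. map (\<lambda>j. \<lfloor>2 ^ k * (x j :: real)\<rfloor>) [0..<n])"
  have len: "length (fl k x) = n" for k x
    by (simp add: fl_def)
  have inj_fl: "inj_on (\<lambda>y. \<lfloor>2 ^ k * y\<rfloor>) (x ` {..<n}) \<longleftrightarrow> distinct (fl k x)"
    if "inj_on x {..<n}" for k x
    using comp_inj_on_iff[OF that, of "\<lambda>y. \<lfloor>2 ^ k * y\<rfloor>"]
    by (simp add: fl_def distinct_map atLeast0LessThan comp_def)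
  have fl_div: "fl k' x = map (\<lambda>c. c div 2 ^ (k - k')) (fl k x)" if "k' \<le> k" for k' k x
    using floor_dyadic[OF that] by (simp add: fl_def)
  have D_iff: "x \<in> D (k, \<gamma>) \<longleftrightarrow> x \<in> space (cube n) \<and> \<gamma> = fl k x \<and> (\<forall>j<n. gr \<gamma> j \<in> T \<longrightarrow> x j \<notin> A)"
    if "length \<gamma> = n" for x k \<gamma>
    using that by (auto simp: D_def fl_def list_eq_iff_nth_eq)
  have gr_rk: "gr (fl k x) j = rk (x ` {..<n}) (x j)" if "inj_on x {..<n}" "distinct (fl k x)" "j < n" for k x j
  proof -
    have "\<lfloor>2 ^ k * x i\<rfloor> < \<lfloor>2 ^ k * x j\<rfloor> \<longleftrightarrow> x i < x j" if "i < n" for i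
    proof
      assume "\<lfloor>2 ^ k * x i\<rfloor> < \<lfloor>2 ^ k * x j\<rfloor>"
      then have "\<not> \<lfloor>2 ^ k * x j\<rfloor> \<le> \<lfloor>2 ^ k * x i\<rfloor>" by simp
      then have "\<not> 2 ^ k * x j \<le> 2 ^ k * x i" using floor_mono by blast
      then show "x i < x j" by simp
    next
      assume less: "x i < x j"
      then have "\<lfloor>2 ^ k * x i\<rfloor> \<le> \<lfloor>2 ^ k * x j\<rfloor>"
        by (intro floor_mono) simp
      moreover have "\<lfloor>2 ^ k * x i\<rfloor> \<noteq> \<lfloor>2 ^ k * x j\<rfloor>"
      proof
        assume "\<lfloor>2 ^ k * x i\<rfloor> = \<lfloor>2 ^ k * x j\<rfloor>"
        then have "fl k x ! i = fl k x ! j"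
          using \<open>i < n\<close> \<open>j < n\<close> by (simp add: fl_def)
        moreover have "length (fl k x) = n"
          by (simp add: fl_def)
        ultimately have "i = j"
          using \<open>distinct (fl k x)\<close> \<open>i < n\<close> \<open>j < n\<close> by (simp add: nth_eq_iff_index_eq)
        then show False using less by simp
      qed
      ultimately show "\<lfloor>2 ^ k * x i\<rfloor> < \<lfloor>2 ^ k * x j\<rfloor>" by simp
    qed
    then show ?thesis
      unfolding rk_image[OF that(1)] gr_def using \<open>j < n\<close>
      by (intro arg_cong[where f = card]) (auto simp: fl_def)
  qed
  have inj_of: "inj_on x {..<n}" if "distinct (fl k x)" for k x
    using that by (auto simp: fl_def distinct_map atLeast0LessThan inj_on_def)
  have level: "sep_level (x ` {..<n}) = k" if "(k, fl k x) \<in> G" for x k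
    unfolding sep_level_def
  proof (rule Least_equality)
    have inj: "inj_on x {..<n}"
      using that inj_of by (auto simp: G_def)
    then show "inj_on (\<lambda>y. \<lfloor>2 ^ k * y\<rfloor>) (x ` {..<n})"
      using that inj_fl by (auto simp: G_def)
    fix k' assume k': "inj_on (\<lambda>y. \<lfloor>2 ^ k' * y\<rfloor>) (x ` {..<n})"
    show "k \<le> k'"
    proof (rule ccontr)
      assume "\<not> k \<le> k'"
      then show False
        using k' that inj_fl[OF inj, of k'] fl_div[of k' k x] by (auto simp: G_def)
    qed
  qed
  have av: "avoid_ranks n T A = (\<Union>p\<in>G. D p)"
  proof (intro set_eqI iffI)
    fix x assume x: "x \<in> avoid_ranks n T A"
    then have inj: "inj_on x {..<n}" and sp: "x \<in> space (cube n)"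
      by (auto simp: avoid_ranks_def)
    define k where "k = sep_level (x ` {..<n})"
    have "\<exists>k. inj_on (\<lambda>y. \<lfloor>2 ^ k * y\<rfloor>) (x ` {..<n})"
      using finite_dyadic_separation[of "x ` {..<n}"] by auto
    then have "inj_on (\<lambda>y. \<lfloor>2 ^ k * y\<rfloor>) (x ` {..<n})"
      unfolding k_def sep_level_def by (rule LeastI_ex)
    then have dist: "distinct (fl k x)"
      using inj_fl[OF inj] by simp
    have nd: "\<not> distinct (fl k' x)" if "k' < k" for k'
      using not_less_Least[of k' "\<lambda>k. inj_on (\<lambda>y. \<lfloor>2 ^ k * y\<rfloor>) (x ` {..<n})"] that inj_fl[OF inj]
      by (simp add: k_def sep_level_def)
    have "\<not> distinct (map (\<lambda>c. c div 2 ^ (k - k')) (fl k x))" if "k' < k" for k'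
      using nd[OF that] fl_div[of k' k x] that by simp
    then have "(k, fl k x) \<in> G"
      using dist by (simp add: G_def len)
    moreover have "x \<in> D (k, fl k x)"
      using x sp gr_rk[OF inj dist] by (subst D_iff) (auto simp: avoid_ranks_def fl_def)
    ultimately show "x \<in> (\<Union>p\<in>G. D p)"
      by blast
  next
    fix x assume "x \<in> (\<Union>p\<in>G. D p)"
    then obtain k \<gamma> where g: "(k, \<gamma>) \<in> G" "x \<in> D (k, \<gamma>)"
      by auto
    then have "length \<gamma> = n" "distinct \<gamma>"
      by (auto simp: G_def)
    then have *: "x \<in> space (cube n)" "\<gamma> = fl k x" "\<forall>j<n. gr \<gamma> j \<in> T \<longrightarrow> x j \<notin> A"
      using g(2) D_iff by auto
    then show "x \<in> avoid_ranks n T A"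
      using inj_of[of k x] gr_rk[of x k] \<open>distinct \<gamma>\<close> by (auto simp: avoid_ranks_def)
  qed
  have D_lev: "k = sep_level (x ` {..<n}) \<and> \<gamma> = fl k x" if "(k, \<gamma>) \<in> G" "x \<in> D (k, \<gamma>)" for k \<gamma> x
  proof -
    have "\<gamma> = fl k x"
      using that D_iff by (auto simp: G_def)
    then show ?thesis
      using level that(1) by simp
  qed
  have D_sets: "D p \<in> sets (cube n)" if "p \<in> G" for p
  proof -
    obtain k \<gamma> where p: "p = (k, \<gamma>)" by (cases p)
    have "{x \<in> space (cube n). \<lfloor>2 ^ k * x j\<rfloor> = \<gamma> ! j \<and> (gr \<gamma> j \<in> T \<longrightarrow> x j \<notin> A)} \<in> sets (cube n)" if "j \<in> {..<n}" for j
    proof -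
      have m: "(\<lambda>x. x j) \<in> borel_measurable (cube n)"
        using that by (rule cube_component)
      have 1: "{y :: real. \<lfloor>2 ^ k * y\<rfloor> = \<gamma> ! j \<and> (gr \<gamma> j \<in> T \<longrightarrow> y \<notin> A)} \<in> sets borel"
      proof -
        have "(\<lambda>y::real. \<lfloor>2 ^ k * y\<rfloor>) -` {\<gamma> ! j} \<inter> space borel \<in> sets borel"
          by (intro measurable_sets[of _ _ "count_space UNIV"]) auto
        then have "(\<lambda>y::real. \<lfloor>2 ^ k * y\<rfloor>) -` {\<gamma> ! j} \<inter> (if gr \<gamma> j \<in> T then - A else UNIV) \<in> sets borel"
          using A by (intro sets.Int) auto
        also have "(\<lambda>y::real. \<lfloor>2 ^ k * y\<rfloor>) -` {\<gamma> ! j} \<inter> (if gr \<gamma> j \<in> T then - A else UNIV) =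
            {y :: real. \<lfloor>2 ^ k * y\<rfloor> = \<gamma> ! j \<and> (gr \<gamma> j \<in> T \<longrightarrow> y \<notin> A)}"
          by auto
        finally show ?thesis .
      qed
      show ?thesis
        using measurable_sets[OF m 1] by (simp add: vimage_def Int_def conj_commute)
    qed
    then show ?thesis
      unfolding D_def p prod.case by (rule sets.sets_Collect_finite_All[OF _ finite_lessThan])
  qed
  have disj: "disjoint_family_on D G"
    unfolding disjoint_family_on_def
  proof (intro ballI impI equals0I)
    fix p q x assume "p \<in> G" "q \<in> G" "p \<noteq> q" "x \<in> D p \<inter> D q"
    then show False
      using D_lev[of "fst p" "snd p" x] D_lev[of "fst q" "snd q" x] by (auto simp: prod_eq_iff)
  qed
  define E where "E = (\<lambda>p. {x \<in> D p. frac (2 ^ fst p * (\<Sum>j<n. x j)) \<in> W})"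
  have E: "E p \<in> sets (cube n) \<and> emeasure (cube n) (E p) = emeasure lborel W * emeasure (cube n) (D p)"
    if p: "p \<in> G" for p
  proof -
    obtain k \<gamma> where kg: "p = (k, \<gamma>)" by (cases p)
    have \<gamma>: "length \<gamma> = n" "distinct \<gamma>"
      using p by (auto simp: G_def kg)
    then have "bij_betw (gr \<gamma>) {..<n} {..<n}"
      using bij_betw_rank[of "{..<n}" "(!) \<gamma>"] by (simp add: gr_def inj_on_def nth_eq_iff_index_eq)
    \<comment> \<open>Here T being proper enters: the label of rank r is the coordinate that is
      integrated out.\<close>
    moreover obtain r where "r < n" "r \<notin> T"
      using T by auto
    ultimately obtain i where i: "i < n" "gr \<gamma> i \<notin> T"
      by (metis bij_betw_iff_bijections lessThan_iff)
    have "x(i := t) \<in> D p" if "x \<in> D p" "t \<in> {0..<1}" "\<lfloor>2 ^ k * t\<rfloor> = \<gamma> ! i" for x t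
    proof -
      have "x(i := t) \<in> space (cube n)"
        using that i by (auto simp: D_def kg space_PiM space_uni PiE_def Pi_def extensional_def)
      then show ?thesis
        using that i by (auto simp: D_def kg)
    qed
    moreover have "\<lfloor>2 ^ k * x i\<rfloor> = \<gamma> ! i" if "x \<in> D p" for x
      using that i by (auto simp: D_def kg)
    ultimately show ?thesis
      using emeasure_cube_frac_indep[OF W i(1) D_sets[OF p], of k "\<gamma> ! i"] by (simp add: E_def kg)
  qed
  have lot: "{x \<in> avoid_ranks n T A. lottery (x ` {..<n}) \<in> W} = (\<Union>p\<in>G. E p)"
  proof -
    have "lottery (x ` {..<n}) = frac (2 ^ fst p * (\<Sum>j<n. x j))" if "p \<in> G" "x \<in> D p" for x p
    proof -
      have lev: "fst p = sep_level (x ` {..<n})" and "x \<in> avoid_ranks n T A"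
        using D_lev[of "fst p" "snd p" x] that av by auto
      then have "(\<Sum>(x ` {..<n})) = (\<Sum>j<n. x j)"
        by (subst sum.reindex) (auto simp: avoid_ranks_def)
      then show ?thesis
        by (simp add: lottery_def lev)
    qed
    then show ?thesis
      unfolding av E_def by auto
  qed
  have disjE: "disjoint_family_on E G"
    using disj unfolding disjoint_family_on_def E_def by blast
  show "avoid_ranks n T A \<in> sets (cube n)"
    unfolding av using D_sets by (intro sets.countable_UN') auto
  show "{x \<in> avoid_ranks n T A. lottery (x ` {..<n}) \<in> W} \<in> sets (cube n)"
    unfolding lot using E by (intro sets.countable_UN') auto
  have "emeasure (cube n) (\<Union>p\<in>G. E p) = (\<integral>\<^sup>+ p. emeasure (cube n) (E p) \<partial>count_space G)"
    using E disjE by (intro emeasure_UN_countable) auto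
  also have "\<dots> = (\<integral>\<^sup>+ p. emeasure lborel W * emeasure (cube n) (D p) \<partial>count_space G)"
    using E by (intro nn_integral_cong) auto
  also have "\<dots> = emeasure lborel W * (\<integral>\<^sup>+ p. emeasure (cube n) (D p) \<partial>count_space G)"
    by (intro nn_integral_cmult) auto
  also have "(\<integral>\<^sup>+ p. emeasure (cube n) (D p) \<partial>count_space G) = emeasure (cube n) (\<Union>p\<in>G. D p)"
    using D_sets disj by (intro emeasure_UN_countable[symmetric]) auto
  finally show "emeasure (cube n) {x \<in> avoid_ranks n T A. lottery (x ` {..<n}) \<in> W} =
      emeasure lborel W * emeasure (cube n) (avoid_ranks n T A)"
    unfolding lot unfolding av .
qed

text \<open>For a single T this is an event about order statistics, whose probability is never
  computed. But for x without ties the rank map permutes the m-element index sets, so summing over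
  all rank sets amounts to summing over all label sets, and labels are independent.\<close>

lemma sum_avoid_ranks:
  assumes A: "A \<in> sets unit_borel" and m: "m < n"
  shows "(\<Sum>T\<in>{T. T \<subseteq> {..<n} \<and> card T = m}. emeasure (cube n) (avoid_ranks n T A)) =
    ennreal (real (n choose m) * (1 - measure lborel A) ^ m)"
proof -
  let ?\<T> = "{T. T \<subseteq> {..<n} \<and> card T = m}"
  have A': "A \<in> sets borel"
    using A by (simp add: sets_unit_borel_iff)
  have fin: "finite ?\<T>" by simp
  have sub: "T \<subset> {..<n}" if "T \<in> ?\<T>" for T
    using that m by auto
  have set1: "avoid_ranks n T A \<in> sets (cube n)" if "T \<in> ?\<T>" for T
    using lottery_indep(1)[OF A' sub[OF that], of "{}"] by simp
  define V where "V = (\<lambda>S. {x \<in> space (cube n). \<forall>i\<in>S. x i \<notin> A})"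
  have set2: "V S \<in> sets (cube n)" if "S \<in> ?\<T>" for S
  proof -
    have "{x \<in> space (cube n). x i \<notin> A} \<in> sets (cube n)" if "i < n" for i
    proof -
      have "(\<lambda>x. x i) -` (- A) \<inter> space (cube n) \<in> sets (cube n)"
        using that A' by (intro measurable_sets[OF cube_component]) auto
      then show ?thesis
        by (simp add: vimage_def Int_def conj_commute)
    qed
    then show ?thesis
      unfolding V_def using that finite_subset[of S "{..<n}"]
      by (intro sets.sets_Collect_finite_All) auto
  qed
  have "(\<Sum>T\<in>?\<T>. emeasure (cube n) (avoid_ranks n T A)) =
      (\<Sum>T\<in>?\<T>. \<integral>\<^sup>+ x. indicator (avoid_ranks n T A) x \<partial>cube n)"
    using set1 by (intro sum.cong) auto
  also have "\<dots> = (\<integral>\<^sup>+ x. (\<Sum>T\<in>?\<T>. indicator (avoid_ranks n T A) x) \<partial>cube n)"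
    using set1 by (intro nn_integral_sum[symmetric]) auto
  also have "\<dots> = (\<integral>\<^sup>+ x. (\<Sum>S\<in>?\<T>. indicator (V S) x) \<partial>cube n)"
  proof (rule nn_integral_cong_AE)
    show "AE x in cube n. (\<Sum>T\<in>?\<T>. indicator (avoid_ranks n T A) x :: ennreal) = (\<Sum>S\<in>?\<T>. indicator (V S) x)"
      using AE_cube_inj AE_space
    proof eventually_elim
      case (elim x)
      define g where "g = (\<lambda>j. card {i. i < n \<and> x i < x j})"
      have g: "bij_betw g {..<n} {..<n}"
        using bij_betw_rank[OF finite_lessThan elim(1)] by (simp add: g_def)
      have bij: "bij_betw ((`) g) ?\<T> ?\<T>"
      proof -
        have inj: "inj_on ((`) g) ?\<T>"
        proof (rule inj_onI)
          fix S S' assume "S \<in> ?\<T>" "S' \<in> ?\<T>" "g ` S = g ` S'"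
          then show "S = S'"
            using inj_on_image_eq_iff[OF bij_betw_imp_inj_on[OF g], of S S'] by auto
        qed
        have "(`) g ` ?\<T> \<subseteq> ?\<T>"
        proof
          fix T assume "T \<in> (`) g ` ?\<T>"
          then obtain S where S: "T = g ` S" "S \<subseteq> {..<n}" "card S = m"
            by auto
          have "g ` S \<subseteq> {..<n}"
            using S(2) bij_betw_imp_surj_on[OF g] by auto
          moreover have "card (g ` S) = m"
            using S inj_on_subset[OF bij_betw_imp_inj_on[OF g] S(2)] by (simp add: card_image)
          ultimately show "T \<in> ?\<T>"
            using S by simp
        qed
        then show ?thesis
          using inj endo_inj_surj[OF fin] by (auto simp: bij_betw_def)
      qed
      have "indicator (avoid_ranks n (g ` S) A) x = (indicator (V S) x :: ennreal)" if S: "S \<in> ?\<T>" for S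
      proof -
        have mem: "g j \<in> g ` S \<longleftrightarrow> j \<in> S" if "j < n" for j
          using S that inj_on_image_mem_iff[OF bij_betw_imp_inj_on[OF g], of j S] by auto
        have "x \<in> avoid_ranks n (g ` S) A \<longleftrightarrow> (\<forall>j<n. g j \<in> g ` S \<longrightarrow> x j \<notin> A)"
          using elim by (simp add: avoid_ranks_def rk_image g_def)
        also have "\<dots> \<longleftrightarrow> x \<in> V S"
          using mem S elim by (auto simp: V_def)
        finally show ?thesis
          by (simp add: indicator_def)
      qed
      then have "(\<Sum>S\<in>?\<T>. indicator (avoid_ranks n (g ` S) A) x :: ennreal) = (\<Sum>S\<in>?\<T>. indicator (V S) x)"
        by (intro sum.cong) auto
      moreover have "(\<Sum>S\<in>?\<T>. indicator (avoid_ranks n (g ` S) A) x :: ennreal) = (\<Sum>T\<in>?\<T>. indicator (avoid_ranks n T A) x)"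
        by (rule sum.reindex_bij_betw[OF bij])
      ultimately show ?case by simp
    qed
  qed
  also have "\<dots> = (\<Sum>S\<in>?\<T>. \<integral>\<^sup>+ x. indicator (V S) x \<partial>cube n)"
    using set2 by (intro nn_integral_sum) auto
  also have "\<dots> = (\<Sum>S\<in>?\<T>. ennreal ((1 - measure lborel A) ^ m))"
  proof (intro sum.cong refl)
    fix S assume S: "S \<in> ?\<T>"
    then have "(\<integral>\<^sup>+ x. indicator (V S) x \<partial>cube n) = emeasure (cube n) (V S)"
      using set2 by simp
    also have "\<dots> = ennreal ((1 - measure lborel A) ^ m)"
      using emeasure_cube_avoid[OF A, of S n] S by (simp add: V_def)
    finally show "(\<integral>\<^sup>+ x. indicator (V S) x \<partial>cube n) = ennreal ((1 - measure lborel A) ^ m)" .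
  qed
  also have "\<dots> = ennreal (real (n choose m) * (1 - measure lborel A) ^ m)"
    using measure_unit_le_1[OF A] n_subsets[of "{..<n}" m]
    by (simp add: ennreal_mult ennreal_of_nat_eq_real_of_nat)
  finally show ?thesis .
qed

section \<open>Sufficiency of the condition\<close>

text \<open>Cut an interval into consecutive pieces of lengths \<open>a T\<close> and let S name the
  piece. Its length is \<open>sum a \<T>\<close> and not 1, so that the induction can append a
  piece.\<close>

lemma finite_selection:
  fixes a :: "'b \<Rightarrow> real"
  assumes "finite \<T>" "\<And>T. T \<in> \<T> \<Longrightarrow> a T \<ge> 0"
  shows "\<exists>S :: real \<Rightarrow> 'b. (\<forall>w\<in>{0..<sum a \<T>}. S w \<in> \<T>) \<and>
    (\<forall>T\<in>\<T>. {w \<in> {0..<sum a \<T>}. S w = T} \<in> sets borel \<and>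
      emeasure lborel {w \<in> {0..<sum a \<T>}. S w = T} = ennreal (a T))"
  using assms
proof (induction \<T>)
  case (insert T0 \<T>)
  from insert.IH[OF insert.prems[OF insertI2]]
  obtain S where S: "\<And>w. w \<in> {0..<sum a \<T>} \<Longrightarrow> S w \<in> \<T>"
    "\<And>T. T \<in> \<T> \<Longrightarrow> {w \<in> {0..<sum a \<T>}. S w = T} \<in> sets borel"
    "\<And>T. T \<in> \<T> \<Longrightarrow> emeasure lborel {w \<in> {0..<sum a \<T>}. S w = T} = ennreal (a T)"
    by blast
  define s where "s = sum a \<T>"
  have s: "s \<ge> 0" "a T0 \<ge> 0" "sum a (insert T0 \<T>) = s + a T0"
    using insert by (auto simp: s_def sum_nonneg)
  define S' where "S' = (\<lambda>w. if w < s then S w else T0)"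
  have old: "{w \<in> {0..<s + a T0}. S' w = T} = {w \<in> {0..<s}. S w = T}" if "T \<in> \<T>" for T
    using that insert.hyps s by (auto simp: S'_def)
  have new: "{w \<in> {0..<s + a T0}. S' w = T0} = {s..<s + a T0}"
    using S(1) insert.hyps s by (force simp: S'_def s_def)
  show ?case
    unfolding s(3)
  proof (intro exI[of _ S'] conjI ballI)
    show "S' w \<in> insert T0 \<T>" if "w \<in> {0..<s + a T0}" for w
      using S(1)[of w] that by (auto simp: S'_def s_def)
    fix T assume T: "T \<in> insert T0 \<T>"
    show "{w \<in> {0..<s + a T0}. S' w = T} \<in> sets borel"
    proof (cases "T = T0")
      case True
      show ?thesis unfolding True new by simp
    next
      case False
      then have "T \<in> \<T>" using T by blast
      then show ?thesis
        unfolding old[OF \<open>T \<in> \<T>\<close>] unfolding s_def by (rule S(2))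
    qed
    show "emeasure lborel {w \<in> {0..<s + a T0}. S' w = T} = ennreal (a T)"
    proof (cases "T = T0")
      case True
      show ?thesis unfolding True new using s by simp
    next
      case False
      then have "T \<in> \<T>" using T by blast
      then show ?thesis
        unfolding old[OF \<open>T \<in> \<T>\<close>] unfolding s_def by (rule S(3))
    qed
  qed
qed auto

text \<open>The monotone coupling: lay out the masses \<open>s n\<close> and \<open>t k\<close> as consecutive intervals and let
  \<open>J n k\<close> be the length of the overlap of the \<open>n\<close>-th and the \<open>k\<close>-th one.\<close>

lemma monotone_coupling:
  fixes s t :: "nat \<Rightarrow> real"
  assumes s: "\<And>n. s n \<ge> 0" "s sums R" and t: "\<And>n. t n \<ge> 0" "t sums R"
    and le: "\<And>n. s n \<noteq> 0 \<Longrightarrow> sum s {..<Suc n} \<le> sum t {..<n}"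
  shows "\<exists>J. (\<forall>n k. J n k \<ge> 0) \<and> (\<forall>n k. n \<le> k \<longrightarrow> J n k = 0) \<and>
    (\<forall>n. (\<Sum>k<n. J n k) = s n) \<and> (\<forall>k. (\<lambda>n. J n k) sums t k)"
proof -
  \<comment> \<open>\<open>G n x\<close> is the length of the part of the n-th source interval below
    x; an overlap is a difference of two such values.\<close>
  define G where "G = (\<lambda>n x. min x (sum s {..<Suc n}) - min x (sum s {..<n}))"
  define y where "y = (\<lambda>k. sum t {..<k})"
  define J where "J = (\<lambda>n k. G n (y (Suc k)) - G n (y k))"
  have y_mono: "y k \<le> y k'" if "k \<le> k'" for k k'
    unfolding y_def using that t(1) by (intro sum_mono2) auto
  have G_mono: "G n x \<le> G n x'" if "x \<le> x'" for n x x'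
    using that s(1)[of n] by (auto simp: G_def min_def)
  have G0: "G n x = 0" if "s n = 0" for n x
    using that by (simp add: G_def)
  \<comment> \<open>By \<open>le\<close> the n-th source interval ends no later than y n, where the
    n-th target interval starts. Hence all its mass goes to targets k < n.\<close>
  have Gtop: "G n (y k) = s n" if "s n \<noteq> 0" "n \<le> k" for n k
    using le[OF that(1)] y_mono[OF that(2)] s(1)[of n] by (simp add: G_def y_def min_def)
  have Gsums: "(\<lambda>n. G n x) sums x" if "0 \<le> x" "x \<le> R" for x
  proof -
    have "(\<Sum>n<N. G n x) = min x (sum s {..<N})" for N
      unfolding G_def using that(1) by (subst sum_lessThan_telescope) simp
    moreover have "(\<lambda>N. min x (sum s {..<N})) \<longlonglongrightarrow> min x R"
      using s(2) by (intro tendsto_min tendsto_const) (simp add: sums_def)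
    ultimately show ?thesis
      using that by (simp add: sums_def)
  qed
  have y_bound: "0 \<le> y k" "y k \<le> R" for k
  proof -
    show "0 \<le> y k"
      unfolding y_def using t(1) by (intro sum_nonneg)
    have "y k \<le> suminf t"
      unfolding y_def using t by (intro sum_le_suminf) (auto simp: sums_iff)
    then show "y k \<le> R"
      using t(2) by (simp add: sums_iff)
  qed
  show ?thesis
  proof (intro exI[of _ J] conjI allI impI)
    fix n k
    show "J n k \<ge> 0"
      using G_mono[OF y_mono[of k "Suc k"], of n] by (simp add: J_def)
    show "J n k = 0" if "n \<le> k"
      using that by (cases "s n = 0") (auto simp: J_def G0 Gtop)
    have "(\<Sum>k<n. J n k) = G n (y n) - G n (y 0)"
      unfolding J_def by (rule sum_lessThan_telescope)
    also have "\<dots> = s n"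
    proof (cases "s n = 0")
      case False
      have "G n 0 = 0"
        using s(1) by (simp add: G_def sum_nonneg add_nonneg_nonneg)
      then show ?thesis
        using Gtop[OF False, of n] by (simp add: y_def)
    qed (simp add: G0)
    finally show "(\<Sum>k<n. J n k) = s n" .
    have "(\<lambda>n. J n k) sums (y (Suc k) - y k)"
      unfolding J_def by (intro sums_diff Gsums y_bound)
    then show "(\<lambda>n. J n k) sums t k"
      by (simp add: y_def)
  qed
qed

lemma thinnable_coupling:
  assumes m: "0 < m" "m < l" and t: "thinnable l m"
  shows "\<exists>J. (\<forall>n k. J n k \<ge> 0) \<and>
    (\<forall>n k. pois l n \<le> pois m n \<longrightarrow> J n k = (if k = n then pois l n else 0)) \<and>
    (\<forall>n k. \<not> pois l n \<le> pois m n \<longrightarrow> n \<le> k \<longrightarrow> J n k = 0) \<and>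
    (\<forall>n. (\<Sum>k\<le>n. J n k) = pois l n) \<and> (\<forall>k. (\<lambda>n. J n k) sums pois m k)"
proof -
  \<comment> \<open>Not the pointwise minimum: where the source outweighs the target, a thinning
    cannot keep all points with positive probability, as seen in
    \<open>poisson_thinning_imp_thinnable\<close>, so nothing is reserved there.\<close>
  define c where "c = (\<lambda>n. if pois l n \<le> pois m n then pois l n else 0)"
  have pos: "pois l n > 0" "pois m n > 0" for n
    using m by (auto intro: pois_pos)
  have c: "0 \<le> c n" "c n \<le> pois l n" "c n \<le> pois m n" for n
    using pos[of n] by (auto simp: c_def)
  have "summable c"
    using c sums_summable[OF pois_sums[of l]] by (intro summable_comparison_test'[of "pois l" 0 c]) auto
  then have csums: "c sums suminf c"
    by (rule summable_sums)
  have "\<exists>J. (\<forall>n k. J n k \<ge> 0) \<and> (\<forall>n k. n \<le> k \<longrightarrow> J n k = 0) \<and>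
    (\<forall>n. (\<Sum>k<n. J n k) = pois l n - c n) \<and> (\<forall>k. (\<lambda>n. J n k) sums (pois m k - c k))"
  proof (rule monotone_coupling)
    show "(\<lambda>n. pois l n - c n) sums (1 - suminf c)" "(\<lambda>n. pois m n - c n) sums (1 - suminf c)"
      by (intro sums_diff pois_sums csums)+
    fix n assume "pois l n - c n \<noteq> 0"
    then have n: "pois m n < pois l n" "c n = 0"
      by (auto simp: c_def split: if_splits)
    \<comment> \<open>Level 0 is always kept, so a shrinking level has a predecessor.\<close>
    moreover have "pois l 0 \<le> pois m 0"
      using m by (simp add: pois_def)
    ultimately obtain j where j: "n = Suc j"
      by (cases n) auto
    have "pois_cdf l (Suc j) \<le> pois_cdf m j"
      using t n by (simp add: thinnable_def j)
    \<comment> \<open>Since c vanishes at n, both sides subtract the same sum of c and the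
      inequality of distribution functions remains.\<close>
    then show "(\<Sum>n<Suc n. pois l n - c n) \<le> (\<Sum>n<n. pois m n - c n)"
      using n by (simp add: pois_cdf_def sum_subtractf j lessThan_Suc_atMost)
  qed (use c in auto)
  then obtain J where J: "\<And>n k. J n k \<ge> 0" "\<And>n k. n \<le> k \<Longrightarrow> J n k = 0"
    "\<And>n. (\<Sum>k<n. J n k) = pois l n - c n" "\<And>k. (\<lambda>n. J n k) sums (pois m k - c k)"
    by auto
  define J' where "J' = (\<lambda>n k. J n k + (if n = k then c k else 0))"
  have "J n k = 0" if "pois l n \<le> pois m n" for n k
  proof -
    have "(\<Sum>k<n. J n k) = 0"
      using that by (simp add: J(3) c_def)
    then show ?thesis
      using J(1,2)[of n k] sum_nonneg_eq_0_iff[of "{..<n}" "J n"] by (cases "k < n") (auto simp: J(1))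
  qed
  then have "J' n k = (if k = n then pois l n else 0)" if "pois l n \<le> pois m n" for n k
    using that by (auto simp: J'_def c_def)
  moreover have "J' n k = 0" if "\<not> pois l n \<le> pois m n" "n \<le> k" for n k
    using that by (auto simp: J'_def J(2) c_def)
  moreover have "(\<Sum>k\<le>n. J' n k) = pois l n" for n
  proof -
    have "(\<Sum>k\<le>n. J' n k) = (\<Sum>k<n. J n k) + J n n + c n"
      by (simp add: J'_def sum.distrib flip: lessThan_Suc_atMost)
    then show ?thesis
      by (simp add: J)
  qed
  moreover have "(\<lambda>n. J' n k) sums pois m k" for k
    using sums_add[OF J(4)[of k] sums_single[of k "\<lambda>_. c k"]] by (simp add: J'_def eq_commute)
  moreover have "J' n k \<ge> 0" for n k
    using J(1) c by (simp add: J'_def)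
  ultimately show ?thesis
    by blast
qed

section \<open>The thinning map and its measurability\<close>

definition thin :: "(nat \<Rightarrow> real \<Rightarrow> nat set) \<Rightarrow> real set \<Rightarrow> real set" where
  "thin S F = {y \<in> F. rk F y \<in> S (card F) (lottery F)}"

lemma rk_bij:
  assumes "finite F"
  shows "bij_betw (rk F) F {..<card F}"
  using bij_betw_rank[OF assms, of "\<lambda>y. y"] by (simp add: rk_def[abs_def])

text \<open>Enumerating the points in increasing order, from rank 0, turns sums over the points into
  measurable functions; the value 0 at missing ranks is a filler.\<close>

definition pt :: "nat \<Rightarrow> real measure \<Rightarrow> real" where
  "pt r \<nu> = (if r < npoints \<nu> then inv_into (points \<nu>) (rk (points \<nu>)) r else 0)"

lemma pt_facts:
  assumes \<nu>: "\<nu> \<in> simple_point_measures" and r: "r < npoints \<nu>"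
  shows "pt r \<nu> \<in> points \<nu>" "rk (points \<nu>) (pt r \<nu>) = r"
  using rk_bij[OF finite_points[OF \<nu>]] r
  by (auto simp: pt_def npoints_eq[OF \<nu>] bij_betw_def intro!: inv_into_into f_inv_into_f)

lemma bij_betw_pt:
  assumes \<nu>: "\<nu> \<in> simple_point_measures"
  shows "bij_betw (\<lambda>r. pt r \<nu>) {..<npoints \<nu>} (points \<nu>)"
proof -
  have "bij_betw (inv_into (points \<nu>) (rk (points \<nu>))) {..<npoints \<nu>} (points \<nu>)"
    using rk_bij[OF finite_points[OF \<nu>]] by (simp add: npoints_eq[OF \<nu>] bij_betw_inv_into)
  then show ?thesis
    by (rule bij_betw_cong[THEN iffD1, rotated]) (simp add: pt_def)
qed

text \<open>The point of rank r is at most t iff more than r points lie in [0, t], which is a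
  condition on counts.\<close>

lemma measurable_pt: "pt r \<in> borel_measurable spm_algebra"
proof (rule borel_measurable_iff_le[THEN iffD2], rule allI)
  fix t :: real
  define B where "B = {0..1} \<inter> {..t}"
  have B: "B \<in> sets unit_borel"
    by (simp add: sets_unit_borel_iff B_def)
  have "pt r \<nu> \<le> t \<longleftrightarrow> (if r < npoints \<nu> then r < cnt B \<nu> else 0 \<le> t)"
    if \<nu>: "\<nu> \<in> simple_point_measures" for \<nu>
  proof (cases "r < npoints \<nu>")
    case True
    define F where "F = points \<nu>"
    define x where "x = pt r \<nu>"
    have fin: "finite F"
      using finite_points[OF \<nu>] by (simp add: F_def)
    have x: "x \<in> F" "card {z \<in> F. z < x} = r"
      using pt_facts[OF \<nu> True] by (auto simp: F_def x_def rk_def)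
    have cnt: "cnt B \<nu> = card {z \<in> F. z \<le> t}"
      unfolding cnt_def F_def B_def using points_subset[OF \<nu>] by (intro arg_cong[where f = card]) auto
    have "x \<le> t \<longleftrightarrow> r < card {z \<in> F. z \<le> t}"
    proof
      assume "x \<le> t"
      then have "{z \<in> F. z < x} \<subset> {z \<in> F. z \<le> t}"
        using x by auto
      then show "r < card {z \<in> F. z \<le> t}"
        using fin psubset_card_mono[of "{z \<in> F. z \<le> t}" "{z \<in> F. z < x}"] by (simp add: x)
    next
      assume *: "r < card {z \<in> F. z \<le> t}"
      show "x \<le> t"
      proof (rule ccontr)
        assume "\<not> x \<le> t"
        then have "card {z \<in> F. z \<le> t} \<le> card {z \<in> F. z < x}"
          using fin by (intro card_mono) auto
        then show False
          using * x by simp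
      qed
    qed
    then show ?thesis
      using True by (simp add: cnt x_def)
  qed (simp add: pt_def)
  then have "{\<nu> \<in> space spm_algebra. pt r \<nu> \<le> t} =
      {\<nu> \<in> simple_point_measures. r < npoints \<nu>} \<inter> {\<nu> \<in> simple_point_measures. r < cnt B \<nu>} \<union>
      {\<nu> \<in> simple_point_measures. \<not> r < npoints \<nu> \<and> 0 \<le> t}"
    by (auto simp: space_spm_algebra split: if_splits)
  also have "\<dots> \<in> sets spm_algebra"
    using cnt_sets[OF unit_borel_top, of "\<lambda>n. r < n"] cnt_sets[OF B, of "\<lambda>n. r < n"]
      cnt_sets[OF unit_borel_top, of "\<lambda>n. \<not> r < n \<and> 0 \<le> t"]
    by (intro sets.Un sets.Int)
  finally show "{\<nu> \<in> space spm_algebra. pt r \<nu> \<le> t} \<in> sets spm_algebra" .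
qed

text \<open>Separation at level k means that each of countably many cells holds at most one
  point.\<close>

lemma measurable_sep_level:
  "(\<lambda>\<nu>. sep_level (points \<nu>)) \<in> measurable spm_algebra (count_space UNIV)"
  unfolding sep_level_def
proof (rule measurable_Least)
  fix k :: nat
  define c where "c = (\<lambda>i. {x \<in> {0..1::real}. \<lfloor>2 ^ k * x\<rfloor> = i})"
  have c: "c i \<in> sets unit_borel" for i
  proof -
    have "(\<lambda>x::real. \<lfloor>2 ^ k * x\<rfloor>) -` {i} \<inter> space borel \<in> sets borel"
      by (intro measurable_sets[of _ _ "count_space UNIV"]) auto
    then have "{0..1} \<inter> ((\<lambda>x::real. \<lfloor>2 ^ k * x\<rfloor>) -` {i} \<inter> space borel) \<in> sets borel"
      by (intro sets.Int) auto
    also have "{0..1} \<inter> ((\<lambda>x::real. \<lfloor>2 ^ k * x\<rfloor>) -` {i} \<inter> space borel) = c i"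
      by (auto simp: c_def)
    finally show ?thesis
      by (auto simp: sets_unit_borel_iff c_def)
  qed
  have iff: "inj_on (\<lambda>x. \<lfloor>2 ^ k * x\<rfloor>) (points \<nu>) \<longleftrightarrow> (\<forall>i. cnt (c i) \<nu> \<le> 1)"
    if \<nu>: "\<nu> \<in> simple_point_measures" for \<nu>
  proof -
    have ci: "points \<nu> \<inter> c i = {x \<in> points \<nu>. \<lfloor>2 ^ k * x\<rfloor> = i}" for i
      using points_subset[OF \<nu>] by (auto simp: c_def)
    have "cnt (c i) \<nu> \<le> 1 \<longleftrightarrow> (\<forall>x\<in>points \<nu>. \<forall>y\<in>points \<nu>. \<lfloor>2 ^ k * x\<rfloor> = i \<and> \<lfloor>2 ^ k * y\<rfloor> = i \<longrightarrow> x = y)" for i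
      unfolding cnt_def ci using finite_points[OF \<nu>] by (subst card_le_Suc0_iff_eq[unfolded One_nat_def[symmetric]]) auto
    then show ?thesis
      by (auto simp: inj_on_def)
  qed
  have "{\<nu> \<in> space spm_algebra. \<forall>i. cnt (c i) \<nu> \<le> 1} \<in> sets spm_algebra"
    using cnt_sets[OF c, of "\<lambda>n. n \<le> 1"]
    by (intro sets.sets_Collect_countable_All) (simp add: space_spm_algebra)
  also have "{\<nu> \<in> space spm_algebra. \<forall>i. cnt (c i) \<nu> \<le> 1} =
      {\<nu> \<in> space spm_algebra. inj_on (\<lambda>x. \<lfloor>2 ^ k * x\<rfloor>) (points \<nu>)}"
    using iff by (auto simp: space_spm_algebra)
  finally show "Measurable.pred spm_algebra (\<lambda>\<nu>. inj_on (\<lambda>x. \<lfloor>2 ^ k * x\<rfloor>) (points \<nu>))"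
    by (simp add: pred_def)
qed

text \<open>For a fixed level and number of points this is a function of finitely many
  \<open>pt r\<close>; both parameters are measurable with countably many values.\<close>

lemma measurable_lottery: "(\<lambda>\<nu>. lottery (points \<nu>)) \<in> borel_measurable spm_algebra"
proof -
  have "(\<lambda>\<nu>. frac (2 ^ k * (\<Sum>r<n. pt r \<nu>))) \<in> borel_measurable spm_algebra" for k n :: nat
    by (intro measurable_compose[OF _ borel_measurable_frac] borel_measurable_times borel_measurable_sum measurable_pt) auto
  then have "(\<lambda>\<nu>. frac (2 ^ k * (\<Sum>r<npoints \<nu>. pt r \<nu>))) \<in> borel_measurable spm_algebra" for k :: nat
    by (rule measurable_compose_countable[OF _ measurable_cnt[OF unit_borel_top]])
  then have 1: "(\<lambda>\<nu>. frac (2 ^ sep_level (points \<nu>) * (\<Sum>r<npoints \<nu>. pt r \<nu>))) \<in> borel_measurable spm_algebra"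
    by (rule measurable_compose_countable[OF _ measurable_sep_level])
  have 2: "lottery (points \<nu>) = frac (2 ^ sep_level (points \<nu>) * (\<Sum>r<npoints \<nu>. pt r \<nu>))"
    if "\<nu> \<in> space spm_algebra" for \<nu>
    using sum.reindex_bij_betw[OF bij_betw_pt[of \<nu>], of "\<lambda>x. x"] that
    by (simp add: lottery_def space_spm_algebra)
  show ?thesis
    by (rule measurable_cong[THEN iffD2, OF 2 1])
qed

lemma lottery_range: "lottery F \<in> {0..<1}"
  by (simp add: lottery_def frac_lt_1)

lemma thin_facts:
  assumes \<nu>: "\<nu> \<in> simple_point_measures"
  shows "finite (thin S (points \<nu>))" "thin S (points \<nu>) \<subseteq> {0..1}"
  using finite_points[OF \<nu>] points_subset[OF \<nu>] by (auto simp: thin_def)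

text \<open>The mass of A is the number of ranks that are selected and whose point lies in A: a
  finite sum of measurable indicators once the number of points is fixed.\<close>

lemma measurable_thin:
  assumes S: "\<And>n r. {w \<in> {0..<1}. r \<in> S n w} \<in> sets borel"
  shows "(\<lambda>\<nu>. pm (thin S (points \<nu>))) \<in> measurable spm_algebra spm_algebra"
proof (rule measurable_spm_algebraI)
  fix A assume A: "A \<in> sets unit_borel"
  then have A': "A \<in> sets borel"
    by (simp add: sets_unit_borel_iff)
  define P where "P = (\<lambda>n r \<nu>. r \<in> S n (lottery (points \<nu>)) \<and> pt r \<nu> \<in> A)"
  have P: "{\<nu> \<in> space spm_algebra. P n r \<nu>} \<in> sets spm_algebra" for n r
  proof -
    have "(\<lambda>\<nu>. lottery (points \<nu>)) -` {w \<in> {0..<1}. r \<in> S n w} \<inter> space spm_algebra \<in> sets spm_algebra"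
      using measurable_lottery S by (rule measurable_sets)
    moreover have "pt r -` A \<inter> space spm_algebra \<in> sets spm_algebra"
      using measurable_pt A' by (rule measurable_sets)
    ultimately have "((\<lambda>\<nu>. lottery (points \<nu>)) -` {w \<in> {0..<1}. r \<in> S n w} \<inter> space spm_algebra) \<inter>
        (pt r -` A \<inter> space spm_algebra) \<in> sets spm_algebra"
      by (rule sets.Int)
    also have "((\<lambda>\<nu>. lottery (points \<nu>)) -` {w \<in> {0..<1}. r \<in> S n w} \<inter> space spm_algebra) \<inter>
        (pt r -` A \<inter> space spm_algebra) = {\<nu> \<in> space spm_algebra. P n r \<nu>}"
      using lottery_range by (auto simp: P_def)
    finally show ?thesis .
  qed
  have "(\<lambda>\<nu>. \<Sum>r<n. if P n r \<nu> then 1 else 0 :: ennreal) \<in> borel_measurable spm_algebra" for n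
    using P by (intro borel_measurable_sum measurable_If) auto
  then have 1: "(\<lambda>\<nu>. \<Sum>r<npoints \<nu>. if P (npoints \<nu>) r \<nu> then 1 else 0 :: ennreal) \<in> borel_measurable spm_algebra"
    by (rule measurable_compose_countable[OF _ measurable_cnt[OF unit_borel_top]])
  have 2: "emeasure (pm (thin S (points \<nu>))) A = (\<Sum>r<npoints \<nu>. if P (npoints \<nu>) r \<nu> then 1 else 0)"
    if "\<nu> \<in> space spm_algebra" for \<nu>
  proof -
    have \<nu>: "\<nu> \<in> simple_point_measures"
      using that by (simp add: space_spm_algebra)
    note b = bij_betw_pt[OF \<nu>]
    have "emeasure (pm (thin S (points \<nu>))) A = of_nat (card (thin S (points \<nu>) \<inter> A))"
      using thin_facts[OF \<nu>] A by (rule emeasure_pm)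
    also have "thin S (points \<nu>) \<inter> A = (\<lambda>r. pt r \<nu>) ` {r \<in> {..<npoints \<nu>}. P (npoints \<nu>) r \<nu>}"
    proof (intro set_eqI iffI)
      fix y assume y: "y \<in> thin S (points \<nu>) \<inter> A"
      then obtain r where r: "r < npoints \<nu>" "y = pt r \<nu>"
        using bij_betw_imp_surj_on[OF b] by (auto simp: thin_def)
      then show "y \<in> (\<lambda>r. pt r \<nu>) ` {r \<in> {..<npoints \<nu>}. P (npoints \<nu>) r \<nu>}"
        using y pt_facts[OF \<nu>, of r] by (auto simp: thin_def P_def npoints_eq[OF \<nu>])
    next
      fix y assume "y \<in> (\<lambda>r. pt r \<nu>) ` {r \<in> {..<npoints \<nu>}. P (npoints \<nu>) r \<nu>}"
      then show "y \<in> thin S (points \<nu>) \<inter> A"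
        using pt_facts[OF \<nu>] by (auto simp: thin_def P_def npoints_eq[OF \<nu>])
    qed
    also have "card \<dots> = card {r \<in> {..<npoints \<nu>}. P (npoints \<nu>) r \<nu>}"
      by (intro card_image inj_on_subset[OF bij_betw_imp_inj_on[OF b]]) auto
    also have "of_nat \<dots> = (\<Sum>r<npoints \<nu>. if P (npoints \<nu>) r \<nu> then 1 else 0 :: ennreal)"
      by (simp add: sum.If_cases Int_def)
    finally show ?thesis .
  qed
  show "(\<lambda>\<nu>. emeasure (pm (thin S (points \<nu>))) A) \<in> borel_measurable spm_algebra"
    by (rule measurable_cong[THEN iffD2, OF 2 1])
qed (simp add: space_spm_algebra pm_in_simple_point_measures thin_facts)

text \<open>Since the lottery is independent of the points with ranks in any fixed proper subset, letting it select
  that subset gives the same avoidance probabilities as an independent selection.\<close>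

lemma emeasure_binomial_process_thin:
  assumes A: "A \<in> sets unit_borel"
    and S: "\<And>w. w \<in> {0..<1} \<Longrightarrow> S n w \<subset> {..<n}"
    and W: "\<And>T. T \<subset> {..<n} \<Longrightarrow> {w \<in> {0..<1}. S n w = T} \<in> sets borel"
    and q: "\<And>T. T \<subset> {..<n} \<Longrightarrow> emeasure lborel {w \<in> {0..<1}. S n w = T} = ennreal (q (card T) / real (n choose card T))"
    and q0: "\<And>k. q k \<ge> 0"
    and mf: "(\<lambda>\<nu>. pm (thin S (points \<nu>))) \<in> measurable spm_algebra spm_algebra"
  shows "emeasure (binomial_process n) {\<nu> \<in> simple_point_measures. pm (thin S (points \<nu>)) \<in> void_event A} =
    ennreal (\<Sum>k<n. q k * (1 - measure lborel A) ^ k)"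
proof -
  let ?E = "{\<nu> \<in> simple_point_measures. pm (thin S (points \<nu>)) \<in> void_event A}"
  define b where "b = 1 - measure lborel A"
  have b: "b \<ge> 0"
    using measure_unit_le_1[OF A] by (simp add: b_def)
  have A': "A \<in> sets borel"
    using A by (simp add: sets_unit_borel_iff)
  define \<T> where "\<T> = {T. T \<subset> {..<n}}"
  have fin: "finite \<T>"
    unfolding \<T>_def by (rule finite_subset[of _ "Pow {..<n}"]) auto
  \<comment> \<open>The lottery selects T and the selected points miss A. Up to ties, these events
    decompose the void event of the image.\<close>
  define H where "H = (\<lambda>T. {x \<in> avoid_ranks n T A. lottery (x ` {..<n}) \<in> {w \<in> {0..<1}. S n w = T}})"
  have E: "?E \<in> sets spm_algebra"
    using measurable_sets[OF mf void_event_sets[OF A]]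
    by (simp add: vimage_def Int_def conj_commute space_spm_algebra)
  have H: "H T \<in> sets (cube n)"
    "emeasure (cube n) (H T) = ennreal (q (card T) / real (n choose card T)) * emeasure (cube n) (avoid_ranks n T A)"
    if "T \<in> \<T>" for T
  proof -
    have T: "T \<subset> {..<n}"
      using that by (simp add: \<T>_def)
    show "H T \<in> sets (cube n)"
      unfolding H_def by (rule lottery_indep(2)[OF A' T W[OF T]]) blast
    show "emeasure (cube n) (H T) = ennreal (q (card T) / real (n choose card T)) * emeasure (cube n) (avoid_ranks n T A)"
      unfolding H_def q[OF T, symmetric] by (rule lottery_indep(3)[OF A' T W[OF T]]) blast
  qed
  have "emeasure (binomial_process n) ?E = emeasure (cube n) {x \<in> space (cube n). conf n x \<in> ?E}"
    using E by (rule emeasure_binomial_process)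
  also have "\<dots> = emeasure (cube n) (\<Union>T\<in>\<T>. H T)"
  proof (rule emeasure_eq_AE)
    show "AE x in cube n. x \<in> {x \<in> space (cube n). conf n x \<in> ?E} \<longleftrightarrow> x \<in> (\<Union>T\<in>\<T>. H T)"
      using AE_cube_inj AE_space
    proof eventually_elim
      case (elim x)
      let ?F = "x ` {..<n}"
      have spm: "conf n x \<in> simple_point_measures" and pts: "points (conf n x) = ?F"
        using elim(2) by (auto simp: conf_in_simple_point_measures points_conf)
      note tf = thin_facts[OF spm, of S, unfolded pts]
      have card: "card ?F = n"
        using elim(1) by (simp add: card_image)
      have "conf n x \<in> ?E \<longleftrightarrow> thin S ?F \<inter> A = {}"
        using spm tf A by (auto simp: pts emeasure_pm pm_in_simple_point_measures)
      also have "\<dots> \<longleftrightarrow> x \<in> avoid_ranks n (S n (lottery ?F)) A"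
        using elim by (auto simp: thin_def card avoid_ranks_def)
      also have "\<dots> \<longleftrightarrow> x \<in> (\<Union>T\<in>\<T>. H T)"
        using S lottery_range[of ?F] by (auto simp: H_def \<T>_def)
      finally show ?case
        using elim(2) by simp
    qed
    show "{x \<in> space (cube n). conf n x \<in> ?E} \<in> sets (cube n)"
      using measurable_sets[OF measurable_conf E] by (simp add: vimage_def Int_def conj_commute)
    show "(\<Union>T\<in>\<T>. H T) \<in> sets (cube n)"
      using fin H by (intro sets.finite_UN) auto
  qed
  also have "\<dots> = (\<Sum>T\<in>\<T>. emeasure (cube n) (H T))"
    using fin H by (intro sum_emeasure[symmetric]) (auto simp: disjoint_family_on_def H_def)
  also have "\<dots> = (\<Sum>T\<in>\<T>. ennreal (q (card T) / real (n choose card T)) * emeasure (cube n) (avoid_ranks n T A))"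
    by (intro sum.cong refl H)
  \<comment> \<open>Sets of equal size have equal weight, so grouping by size leaves exactly the
    sums that \<open>sum_avoid_ranks\<close> evaluates.\<close>
  also have "\<dots> = (\<Sum>k<n. \<Sum>T\<in>{T. T \<in> \<T> \<and> card T = k}.
      ennreal (q (card T) / real (n choose card T)) * emeasure (cube n) (avoid_ranks n T A))"
  proof (rule sum.group[symmetric, OF fin finite_lessThan])
    show "card ` \<T> \<subseteq> {..<n}"
      using psubset_card_mono[of "{..<n}"] by (auto simp: \<T>_def)
  qed
  also have "\<dots> = (\<Sum>k<n. ennreal (q k * b ^ k))"
  proof (intro sum.cong refl)
    fix k assume "k \<in> {..<n}"
    then have k: "k < n" by simp
    have "{T. T \<in> \<T> \<and> card T = k} = {T. T \<subseteq> {..<n} \<and> card T = k}"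
      using k by (auto simp: \<T>_def)
    then have "(\<Sum>T\<in>{T. T \<in> \<T> \<and> card T = k}.
        ennreal (q (card T) / real (n choose card T)) * emeasure (cube n) (avoid_ranks n T A)) =
        (\<Sum>T\<in>{T. T \<subseteq> {..<n} \<and> card T = k}. ennreal (q k / real (n choose k)) * emeasure (cube n) (avoid_ranks n T A))"
      by (intro sum.cong) auto
    also have "\<dots> = ennreal (q k / real (n choose k)) * ennreal (real (n choose k) * b ^ k)"
      unfolding b_def sum_avoid_ranks[OF A k, symmetric] by (rule sum_distrib_left[symmetric])
    also have "\<dots> = ennreal (q k / real (n choose k) * (real (n choose k) * b ^ k))"
      using q0[of k] b by (intro ennreal_mult[symmetric]) auto
    also have "q k / real (n choose k) * (real (n choose k) * b ^ k) = q k * b ^ k"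
      using k by simp
    finally show "(\<Sum>T\<in>{T. T \<in> \<T> \<and> card T = k}.
        ennreal (q (card T) / real (n choose card T)) * emeasure (cube n) (avoid_ranks n T A)) = ennreal (q k * b ^ k)" .
  qed
  also have "\<dots> = ennreal (\<Sum>k<n. q k * b ^ k)"
    using q0 b by (intro sum_ennreal) auto
  finally show ?thesis
    by (simp add: b_def)
qed

text \<open>Let b = 1 - |A|, so that b ^ k is the void probability of k uniform points. Level n
  contributes the sum over k of \<open>J n k * b ^ k\<close> to the void probability of the image;
  summing over n first produces the weights \<open>pois m k\<close> of the target law.\<close>

lemma thinnable_imp_poisson_thinning:
  assumes m: "0 < m" "m < l" and t: "thinnable l m"
  shows "\<exists>f. poisson_thinning l m f"
proof -
  have l: "l > 0" using m by simp
  obtain J where J: "\<And>n k. J n k \<ge> 0"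
    "\<And>n k. pois l n \<le> pois m n \<Longrightarrow> J n k = (if k = n then pois l n else 0)"
    "\<And>n k. \<not> pois l n \<le> pois m n \<Longrightarrow> n \<le> k \<Longrightarrow> J n k = 0"
    "\<And>n. (\<Sum>k\<le>n. J n k) = pois l n" "\<And>k. (\<lambda>n. J n k) sums pois m k"
    using thinnable_coupling[OF m t] by blast
  have pos: "pois l n > 0" for n
    using l by (rule pois_pos)
  define keep where "keep = (\<lambda>n. pois l n \<le> pois m n)"
  \<comment> \<open>The conditional law of the number k of survivors given n points.\<close>
  define q where "q = (\<lambda>n k. J n k / pois l n)"
  have q0: "q n k \<ge> 0" for n k
    using J(1) pos[of n] by (simp add: q_def)
  \<comment> \<open>Given k, all k-element sets of ranks are equally likely.\<close>
  define sel where "sel = (\<lambda>n (S :: real \<Rightarrow> nat set). (\<forall>w\<in>{0..<1}. S w \<subset> {..<n}) \<and>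
      (\<forall>T. T \<subset> {..<n} \<longrightarrow> {w \<in> {0..<1}. S w = T} \<in> sets borel \<and>
        emeasure lborel {w \<in> {0..<1}. S w = T} = ennreal (q n (card T) / real (n choose card T))))"
  have "\<exists>S. sel n S"
    if n: "\<not> keep n" for n
  proof -
    let ?\<T> = "{T. T \<subset> {..<n}}"
    have fin: "finite ?\<T>"
      by (rule finite_subset[of _ "Pow {..<n}"]) auto
    have "(\<Sum>T\<in>?\<T>. q n (card T) / real (n choose card T)) =
        (\<Sum>k<n. \<Sum>T\<in>{T. T \<in> ?\<T> \<and> card T = k}. q n (card T) / real (n choose card T))"
    proof (rule sum.group[symmetric, OF fin finite_lessThan])
      show "card ` ?\<T> \<subseteq> {..<n}"
        using psubset_card_mono[of "{..<n}"] by auto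
    qed
    also have "\<dots> = (\<Sum>k<n. q n k)"
    proof (intro sum.cong refl)
      fix k assume "k \<in> {..<n}"
      then have k: "k < n" by simp
      then have "{T. T \<in> ?\<T> \<and> card T = k} = {T. T \<subseteq> {..<n} \<and> card T = k}"
        by auto
      then have "(\<Sum>T\<in>{T. T \<in> ?\<T> \<and> card T = k}. q n (card T) / real (n choose card T)) =
          (\<Sum>T\<in>{T. T \<subseteq> {..<n} \<and> card T = k}. q n k / real (n choose k))"
        by (intro sum.cong) auto
      also have "\<dots> = q n k"
        using n_subsets[of "{..<n}" k] k by simp
      finally show "(\<Sum>T\<in>{T. T \<in> ?\<T> \<and> card T = k}. q n (card T) / real (n choose card T)) = q n k" .
    qed
    \<comment> \<open>On a shrinking level the diagonal entry of J is 0, so proper subsets already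
      exhaust the row.\<close>
    also have "\<dots> = (\<Sum>k\<le>n. J n k) / pois l n"
      using J(3)[of n n] n by (simp add: keep_def q_def sum_divide_distrib flip: lessThan_Suc_atMost)
    also have "\<dots> = 1"
      using pos[of n] by (simp add: J(4))
    finally have sum1: "(\<Sum>T\<in>?\<T>. q n (card T) / real (n choose card T)) = 1" .
    have "0 \<le> q n (card T) / real (n choose card T)" for T :: "nat set"
      using q0 by simp
    from finite_selection[OF fin, of "\<lambda>T. q n (card T) / real (n choose card T)", OF this] show ?thesis
      by (simp only: sel_def sum1 mem_Collect_eq Ball_def)
  qed
  then have "\<forall>n. \<exists>S. \<not> keep n \<longrightarrow> sel n S"
    by blast
  from choice[OF this] obtain S0 where "\<forall>n. \<not> keep n \<longrightarrow> sel n (S0 n)"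
    by blast
  then have S0: "\<And>n w. \<not> keep n \<Longrightarrow> w \<in> {0..<1} \<Longrightarrow> S0 n w \<subset> {..<n}"
    "\<And>n T. \<not> keep n \<Longrightarrow> T \<subset> {..<n} \<Longrightarrow> {w \<in> {0..<1}. S0 n w = T} \<in> sets borel"
    "\<And>n T. \<not> keep n \<Longrightarrow> T \<subset> {..<n} \<Longrightarrow>
      emeasure lborel {w \<in> {0..<1}. S0 n w = T} = ennreal (q n (card T) / real (n choose card T))"
    unfolding sel_def by blast+
  define S where "S = (\<lambda>n w. if keep n then {..<n} else S0 n w)"
  define f where "f = (\<lambda>\<nu>. pm (thin S (points \<nu>)))"
  have mf: "f \<in> measurable spm_algebra spm_algebra"
    unfolding f_def
  proof (rule measurable_thin)
    fix n r
    show "{w \<in> {0..<1}. r \<in> S n w} \<in> sets borel"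
    proof (cases "keep n")
      case False
      have eq: "{w \<in> {0..<1}. r \<in> S n w} = (\<Union>T\<in>{T. T \<subset> {..<n} \<and> r \<in> T}. {w \<in> {0..<1}. S0 n w = T})"
        using S0(1)[OF False] False by (auto simp: S_def)
      have "finite {T. T \<subset> {..<n} \<and> r \<in> T}"
        by (rule finite_subset[of _ "Pow {..<n}"]) auto
      then show ?thesis
        unfolding eq by (rule sets.finite_UN) (rule S0(2)[OF False], blast)
    next
      case True
      then have "{w \<in> {0..<1}. r \<in> S n w} = (if r < n then {0..<1} else {})"
        by (auto simp: S_def)
      then show ?thesis
        by simp
    qed
  qed
  have void: "ennreal (pois l n) * emeasure (binomial_process n) {\<nu> \<in> simple_point_measures. f \<nu> \<in> void_event A} =
      (\<Sum>k. ennreal (J n k * (1 - measure lborel A) ^ k))" if A: "A \<in> sets unit_borel" for A n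
  proof -
    define b where "b = 1 - measure lborel A"
    have b: "b \<ge> 0"
      using measure_unit_le_1[OF A] by (simp add: b_def)
    show ?thesis
    proof (cases "keep n")
      case True
      let ?N = "{\<nu> \<in> simple_point_measures. npoints \<nu> = n}"
      have fix_f: "f \<nu> = \<nu>" if "\<nu> \<in> ?N" for \<nu>
      proof -
        have \<nu>: "\<nu> \<in> simple_point_measures" "card (points \<nu>) = n"
          using that npoints_eq by auto
        have "rk (points \<nu>) y < n" if "y \<in> points \<nu>" for y
          using bij_betw_apply[OF rk_bij[OF finite_points[OF \<nu>(1)]] that] by (simp add: \<nu>)
        then have "thin S (points \<nu>) = points \<nu>"
          using True by (auto simp: thin_def S_def \<nu>)
        then show ?thesis
          using pm_points[OF \<nu>(1)] by (simp add: f_def)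
      qed
      have N: "AE \<nu> in binomial_process n. \<nu> \<in> ?N"
      proof -
        interpret B: prob_space "binomial_process n" by (rule prob_space_binomial_process)
        have "emeasure (binomial_process n) ?N = 1"
          using emeasure_binomial_process_npoints[of n "\<lambda>k. k = n"] by simp
        moreover have "?N \<in> sets (binomial_process n)"
          using cnt_sets[OF unit_borel_top, of "\<lambda>k. k = n"] by simp
        ultimately show ?thesis
          using B.AE_in_set_eq_1[of ?N] by (simp add: B.emeasure_eq_measure)
      qed
      have "emeasure (binomial_process n) {\<nu> \<in> simple_point_measures. f \<nu> \<in> void_event A} =
          emeasure (binomial_process n) (void_event A)"
      proof (rule emeasure_eq_AE)
        show "AE \<nu> in binomial_process n. \<nu> \<in> {\<nu> \<in> simple_point_measures. f \<nu> \<in> void_event A} \<longleftrightarrow> \<nu> \<in> void_event A"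
          using N by eventually_elim (use fix_f in auto)
        show "{\<nu> \<in> simple_point_measures. f \<nu> \<in> void_event A} \<in> sets (binomial_process n)"
          using measurable_sets[OF mf void_event_sets[OF A]]
          by (simp add: vimage_def Int_def conj_commute space_spm_algebra)
        show "void_event A \<in> sets (binomial_process n)"
          using void_event_sets[OF A] by simp
      qed
      also have "\<dots> = ennreal (b ^ n)"
        by (simp add: binomial_process_void[OF A] b_def)
      finally have "ennreal (pois l n) * emeasure (binomial_process n) {\<nu> \<in> simple_point_measures. f \<nu> \<in> void_event A} =
          ennreal (pois l n * b ^ n)"
        using pos[of n] by (simp add: ennreal_mult')
      also have "\<dots> = (\<Sum>k\<in>{n}. ennreal (J n k * b ^ k))"
        using J(2)[of n n] True by (simp add: keep_def)
      also have "\<dots> = (\<Sum>k. ennreal (J n k * b ^ k))"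
        using J(2)[of n] True by (intro suminf_finite[symmetric]) (auto simp: keep_def)
      finally show ?thesis
        by (simp add: b_def)
    next
      case False
      have Sn: "S n = S0 n"
        using False by (simp add: S_def)
      have "emeasure (binomial_process n) {\<nu> \<in> simple_point_measures. f \<nu> \<in> void_event A} =
          ennreal (\<Sum>k<n. q n k * b ^ k)"
        unfolding f_def b_def
        by (rule emeasure_binomial_process_thin[OF A, where n = n and S = S and q = "q n", unfolded Sn,
              OF S0[OF False] q0 mf[unfolded f_def]])
      then have "ennreal (pois l n) * emeasure (binomial_process n) {\<nu> \<in> simple_point_measures. f \<nu> \<in> void_event A} =
          ennreal (pois l n * (\<Sum>k<n. q n k * b ^ k))"
        using pos[of n] by (simp add: ennreal_mult')
      also have "pois l n * (\<Sum>k<n. q n k * b ^ k) = (\<Sum>k<n. J n k * b ^ k)"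
        unfolding sum_distrib_left using pos[of n] by (intro sum.cong) (auto simp: q_def)
      also have "ennreal \<dots> = (\<Sum>k<n. ennreal (J n k * b ^ k))"
        using J(1) b by (intro sum_ennreal[symmetric]) auto
      also have "\<dots> = (\<Sum>k. ennreal (J n k * b ^ k))"
        using J(3)[of n] False by (intro suminf_finite[symmetric]) (auto simp: keep_def)
      finally show ?thesis
        by (simp add: b_def)
    qed
  qed
  have mfl: "f \<in> measurable (poisson_law l) spm_algebra"
    using mf by (simp cong: measurable_cong_sets)
  have D: "distr (poisson_law l) spm_algebra f = poisson_law m"
  proof (rule renyi_avoidance)
    show "finite_measure (distr (poisson_law l) spm_algebra f)"
      by (intro prob_space.finite_measure prob_space.prob_space_distr prob_space_poisson_law mfl)
    fix A assume A: "A \<in> sets unit_borel"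
    define b where "b = 1 - measure lborel A"
    have b: "b \<ge> 0"
      using measure_unit_le_1[OF A] by (simp add: b_def)
    have space: "space (poisson_law l) = simple_point_measures"
      using sets_eq_imp_space_eq[OF sets_poisson_law] by (simp add: space_spm_algebra)
    have E: "{\<nu> \<in> simple_point_measures. f \<nu> \<in> void_event A} \<in> sets spm_algebra"
      using measurable_sets[OF mf void_event_sets[OF A]]
      by (simp add: vimage_def Int_def conj_commute space_spm_algebra)
    have "emeasure (distr (poisson_law l) spm_algebra f) (void_event A) =
        emeasure (poisson_law l) (f -` void_event A \<inter> space (poisson_law l))"
      by (intro emeasure_distr mfl void_event_sets A)
    also have "f -` void_event A \<inter> space (poisson_law l) = {\<nu> \<in> simple_point_measures. f \<nu> \<in> void_event A}"
      by (auto simp: space)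
    also have "emeasure (poisson_law l) \<dots> = (\<Sum>n. \<Sum>k. ennreal (J n k * b ^ k))"
      unfolding emeasure_poisson_law[OF l E] by (simp only: void[OF A] b_def)
    \<comment> \<open>Tonelli for nonnegative double series, to reach the column sums of J.\<close>
    also have "\<dots> = (\<Sum>k. \<Sum>n. ennreal (J n k * b ^ k))"
      using nn_integral_suminf[of "\<lambda>k n. ennreal (J n k * b ^ k)" "count_space UNIV"]
      by (simp add: nn_integral_count_space_nat)
    also have "\<dots> = (\<Sum>k. ennreal (pois m k * b ^ k))"
    proof (intro suminf_cong suminf_ennreal_eq)
      fix k
      show "0 \<le> J n k * b ^ k" for n
        using J(1) b by simp
      show "(\<lambda>n. J n k * b ^ k) sums (pois m k * b ^ k)"
        by (intro sums_mult2 J(5))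
    qed
    also have "\<dots> = (\<Sum>k. ennreal (pois m k) * emeasure (binomial_process k) (void_event A))"
      using m by (simp add: binomial_process_void[OF A] b_def ennreal_mult'[OF pois_nonneg])
    also have "\<dots> = emeasure (poisson_law m) (void_event A)"
      using m by (intro emeasure_poisson_law[symmetric] void_event_sets A)
    finally show "emeasure (distr (poisson_law l) spm_algebra f) (void_event A) =
        emeasure (poisson_law m) (void_event A)" .
  qed auto
  have "poisson_thinning l m f"
    unfolding poisson_thinning_def
  proof (intro conjI allI impI mf)
    fix M :: "real measure measure" and X
    assume X: "poisson_process M l X"
    then have M: "prob_space M" and mX: "X \<in> measurable M spm_algebra"
      by (auto simp: poisson_process_def)
    have "distr M spm_algebra (\<lambda>\<omega>. f (X \<omega>)) = distr (distr M spm_algebra X) spm_algebra f"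
      using mf mX by (simp add: distr_distr comp_def)
    also have "\<dots> = poisson_law m"
      by (simp add: poisson_process_distr_eq[OF l X] D)
    \<comment> \<open>The Poisson property holds for the identity on \<open>poisson_law m\<close>
      and is pulled back along the composition of \<open>f\<close> with X.\<close>
    finally have "poisson_process (distr M spm_algebra (\<lambda>\<omega>. f (X \<omega>))) m (\<lambda>\<nu>. \<nu>)"
      using poisson_process_poisson_law[OF m(1)] by simp
    then show "poisson_process M m (\<lambda>\<omega>. f (X \<omega>))"
      using poisson_process_distr[OF M measurable_compose[OF mX mf] measurable_ident_sets[OF refl]] by simp
    show "AE \<omega> in M. points (f (X \<omega>)) \<subseteq> points (X \<omega>)"
    proof (rule AE_I2)
      fix \<omega> assume "\<omega> \<in> space M"
      then have "X \<omega> \<in> simple_point_measures"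
        using measurable_space[OF mX] by (simp add: space_spm_algebra)
      then show "points (f (X \<omega>)) \<subseteq> points (X \<omega>)"
        by (simp add: f_def points_pm thin_facts) (auto simp: thin_def)
    qed
  qed
  then show ?thesis
    by blast
qed

theorem corollary2:
  fixes l m :: real
  assumes "m > 0" and "l > m"
    and "\<exists>f. poisson_thinning l m f"
  shows "(\<forall>l'. l' > l \<longrightarrow> (\<exists>f. poisson_thinning l' m f)) \<and>
         (\<forall>l' m'. m' / l' = m / l \<longrightarrow> l' > l \<longrightarrow> (\<exists>f. poisson_thinning l' m' f))"
proof (intro conjI allI impI)
  have t: "thinnable l m"
    using assms poisson_thinning_imp_thinnable by blast
  fix l' :: real assume l': "l' > l"
  show "\<exists>f. poisson_thinning l' m f"
    using assms l' thinnable_mono[OF assms(1,2) l' t] by (intro thinnable_imp_poisson_thinning) auto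
  fix m' :: real assume eq: "m' / l' = m / l"
  \<comment> \<open>Equal ratios mean that both intensities grow by this common factor.\<close>
  define c where "c = l' / l"
  have c: "c > 1" "l' = c * l" "m' = c * m"
    using assms l' eq by (auto simp: c_def field_simps)
  show "\<exists>f. poisson_thinning l' m' f"
    unfolding c(2,3) using assms c(1) thinnable_scale[OF assms(1,2) c(1) t]
    by (intro thinnable_imp_poisson_thinning) auto
qed

end
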